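(* There is a deterministic algorithm that, for all positive integers $n,m$, every $\epsilon>0$ and every matrix $A\in\mathbb{R}^{m\times n}$ with $|A_{ij}|\le 1$ for all $i\in[m]$, $j\in[n]$ (where $n,m,\epsilon$ are given to the algorithm and $A$ is accessible only via matvec queries), computes an $\epsilon$-solution of the $\ell_1$-$\ell_1$ game with payoff matrix $A$, i.e., a pair $(\hat x,\hat y)\in\Delta^n\times\Delta^m$ with $\max_{y\in\Delta^m}y^\top A\hat x-\min_{x\in\Delta^n}\hat y^\top Ax\le\epsilon$, using $\tilde O(\epsilon^{-2/3})$ matvecs to $A$.
   Context: $\Delta^k=\{u\in\mathbb{R}^k_{\ge0}:\|u\|_1=1\}$. A matvec (query) to $A$ takes an input $(x,y)\in\Delta^n\times\Delta^m$ and returns $(A^\top y,Ax)$. The algorithm may choose its queries adaptively (each query is a deterministic function of $n,m,\epsilon$ and the previous answers); only the number of matvec queries is counted. $\tilde O(\cdot)$ hides multiplicative polylogarithmic factors in $n$, $m$ and $\epsilon^{-1}$: the number of queries is at most $\epsilon^{-2/3}$ times an absolute constant times a fixed (absolute) power of a logarithm of $n$, $m$, $\epsilon^{-1}$ (e.g. of $\log(2+n+m+\epsilon^{-1})$). *)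

theory Defs
  imports Complex_Main "Jordan_Normal_Form.Matrix"
begin

definition simplex :: "nat \<Rightarrow> real vec set" where
  "simplex k = {u \<in> carrier_vec k. (\<forall>i<k. 0 \<le> u $ i) \<and> (\<Sum>i<k. \<bar>u $ i\<bar>) = 1}"

text \<open>The sets whose supremum and infimum are taken are nonempty (for nonempty \<open>A\<close>) and compact,
  so \<open>SUP\<close> and \<open>INF\<close> are the maximum and the minimum.\<close>

definition duality_gap :: "real mat \<Rightarrow> real vec \<Rightarrow> real vec \<Rightarrow> real" where
  "duality_gap A x' y' =
     (SUP y \<in> simplex (dim_row A). y \<bullet> (A *\<^sub>v x')) - (INF x \<in> simplex (dim_col A). y' \<bullet> (A *\<^sub>v x))"

definition eps_solution :: "real mat \<Rightarrow> real \<Rightarrow> real vec \<Rightarrow> real vec \<Rightarrow> bool" where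
  "eps_solution A \<epsilon> x' y' \<longleftrightarrow>
     x' \<in> simplex (dim_col A) \<and> y' \<in> simplex (dim_row A) \<and> duality_gap A x' y' \<le> \<epsilon>"

definition matvec :: "real mat \<Rightarrow> real vec \<Rightarrow> real vec \<Rightarrow> real vec \<times> real vec" where
  "matvec A x y = (transpose_mat A *\<^sub>v y, A *\<^sub>v x)"

datatype action = Query "real vec" "real vec" | Output "real vec" "real vec"

text \<open>A strategy maps the list of answers received so far (oldest first) to the next action. Its
  own earlier queries are determined by those answers, so they are not part of the argument. An
  algorithm additionally takes \<open>n\<close>, \<open>m\<close> and \<open>\<epsilon>\<close>.\<close>

type_synonym strategy = "(real vec \<times> real vec) list \<Rightarrow> action"
type_synonym algorithm = "nat \<Rightarrow> nat \<Rightarrow> real \<Rightarrow> strategy"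

text \<open>\<open>transcript s A h\<close>: in the run of \<open>s\<close> against \<open>A\<close>, the first \<open>length h\<close> actions are queries
  with inputs in the simplices, and \<open>h\<close> lists their answers. There is at most one such \<open>h\<close> of each
  length, and \<open>h\<close> cannot be extended once \<open>s h\<close> is an output.\<close>

inductive transcript :: "strategy \<Rightarrow> real mat \<Rightarrow> (real vec \<times> real vec) list \<Rightarrow> bool"
  for s :: strategy and A :: "real mat" where
  start: "transcript s A []"
| query: "\<lbrakk>transcript s A h; s h = Query x y; x \<in> simplex (dim_col A); y \<in> simplex (dim_row A)\<rbrakk>
    \<Longrightarrow> transcript s A (h @ [matvec A x y])"

definition returns :: "strategy \<Rightarrow> real mat \<Rightarrow> nat \<Rightarrow> real vec \<Rightarrow> real vec \<Rightarrow> bool" where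
  "returns s A q x' y' \<longleftrightarrow> (\<exists>h. transcript s A h \<and> length h = q \<and> s h = Output x' y')"

end

theory Submission
  imports Defs
begin

text \<open>
  Put \<open>z = (x, y)\<close> and let \<open>B\<close> be the skew matrix with blocks \<open>A\<^sup>T\<close> and \<open>- A\<close>. A query at \<open>z\<close>
  reveals \<open>B z\<close>, and since \<open>\<langle>B z, z\<rangle> = 0\<close> the duality gap of \<open>z\<close> is the maximum of \<open>- \<langle>B z, u\<rangle>\<close>
  over \<open>u\<close> in the product of the simplices. The strategy is a proximal point method for \<open>B\<close> with entropic
  regularisation of strength \<open>\<gamma>\<close>, and it combines two ideas.

  \<^emph>\<open>Learning only what matters.\<close> A skew matrix \<open>M\<close> models \<open>B\<close>. A step is computed with \<open>M\<close>, which costs no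
  query; only the displacement from the last accepted point \<open>b\<close>, where \<open>B b\<close> is known, is affected by
  the residual \<open>R = B - M\<close>. Either the answer at the trial point confirms that the step is as good as an
  exact one, or two displacements satisfy \<open>\<bar>\<langle>R d, d'\<rangle>\<bar> \<ge> c \<gamma> \<parallel>d\<parallel> \<parallel>d'\<parallel>\<close> in the norm with weights
  \<open>1 / \<omega>\<close>, where \<open>\<omega>\<close> dominates the points involved. In the second case a rank two correction of \<open>M\<close>
  lowers the energy \<open>\<Sum>\<omega>\<^sub>j \<omega>\<^sub>k R\<^sub>j\<^sub>k\<^sup>2\<close> by a multiple of \<open>\<gamma>\<^sup>2\<close> (\<open>refine_energy\<close>, \<open>guilty_energy_drop\<close>).
  The energy never exceeds \<open>4 W\<^sup>2\<close> for \<open>W = \<Sum>\<omega>\<^sub>j\<close>, so there are \<open>O(W\<^sup>2 / \<gamma>\<^sup>2)\<close> corrections. The exact steps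
  number \<open>\<gamma> / \<epsilon>\<close> up to logarithms. With \<open>\<gamma> = \<epsilon>\<^bsup>1/3\<^esup>\<close> both counts become \<open>\<epsilon>\<^bsup>-2/3\<^esup>\<close>, provided that
  \<open>W\<close> is polylogarithmic.

  \<^emph>\<open>Keeping the weights small.\<close> \<open>W\<close> bounds the sum over the coordinates of the largest value that any
  iterate takes there. To control it, every step regularises towards several anchors at once: for each level
  \<open>i\<close>, with strength \<open>\<gamma> / 2\<^sup>i\<close>, towards the mean of the last completed block of \<open>2\<^sup>i\<close> iterates. Relative
  entropy is convex in its second argument, so each level telescopes at total cost \<open>\<gamma> (ln n + ln m)\<close>
  (\<open>level_telescope\<close>), and the nonpositive terms of the regret identity bound the divergence of the iterates
  from their anchors at \<^emph>\<open>every\<close> dyadic time scale. The blocks form a binary tree with the uniform point at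
  the root. On each level the squared Hellinger distances along the edges add up to a polylogarithm. A
  coordinate that grows by more than the factor \<open>1 + 1 / log\<close> along an edge is paid for by that distance,
  and all other growth from root to leaf multiplies to at most \<open>e\<close> (\<open>envelope\<close>).

  A trial point may still put mass where no iterate did. Therefore a step is shortened until the mass outside
  \<open>8 \<omega>\<close> is at most \<open>\<theta>\<close>, a polylogarithmic fraction of \<open>\<gamma>\<^sup>2\<close>. Corrections then add little to \<open>W\<close>, and an
  accepted step that was shortened has moved so far that it consumes \<open>\<gamma> \<theta> / 16\<close> of the regret budget
  (\<open>loss_props\<close>), which bounds the number of such steps by \<open>\<epsilon>\<^bsup>-2/3\<^esup>\<close> up to logarithms as well.
\<close>

section \<open>Generalised relative entropy\<close>

text \<open>The terms \<open>- p + q\<close> make every summand nonnegative, so that the estimates below can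
  be proved coordinate by coordinate.\<close>
definition ent :: "real \<Rightarrow> real \<Rightarrow> real" where
  "ent p q = p * ln (p / q) - p + q"

text \<open>This is \<open>ln t \<le> t - 1\<close> at \<open>t = sqrt (q / p)\<close>.\<close>
lemma hellinger_le_ent:
  assumes "0 \<le> p" "0 < q"
  shows "(sqrt p - sqrt q)\<^sup>2 \<le> ent p q"
proof (cases "p = 0")
  case True
  then show ?thesis using assms by (simp add: ent_def)
next
  case False
  then have p: "0 < p" using assms by simp
  have "ln (sqrt (q / p)) \<le> sqrt (q / p) - 1"
    by (rule ln_le_minus_one) (use p assms in simp)
  moreover have "ln (sqrt (q / p)) = - ln (p / q) / 2"
    using p assms by (simp add: ln_sqrt ln_div)
  ultimately have "2 * (1 - sqrt (q / p)) \<le> ln (p / q)" by simp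
  then have "p * (2 * (1 - sqrt (q / p))) \<le> p * ln (p / q)"
    using p by (intro mult_left_mono) auto
  moreover have "p * sqrt (q / p) = sqrt p * sqrt q"
    using p assms by (simp add: real_sqrt_divide field_simps)
  ultimately have "2 * p - 2 * (sqrt p * sqrt q) \<le> p * ln (p / q)"
    by (simp add: algebra_simps)
  then show ?thesis
    using p assms by (simp add: ent_def power2_eq_square algebra_simps)
qed

lemma ent_nonneg: "0 \<le> p \<Longrightarrow> 0 < q \<Longrightarrow> 0 \<le> ent p q"
  using hellinger_le_ent[of p q] by (meson order_trans zero_le_power2)

lemma ent_self: "0 < p \<Longrightarrow> ent p p = 0"
  by (simp add: ent_def)

text \<open>Factor \<open>p - q\<close> into the difference and the sum of the square roots; the sum is at
  most \<open>2 sqrt b\<close>.\<close>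
lemma sq_diff_le_ent:
  assumes "0 \<le> p" "0 < q" "p \<le> b" "q \<le> b"
  shows "(p - q)\<^sup>2 \<le> 4 * b * ent p q"
proof -
  have "p - q = (sqrt p - sqrt q) * (sqrt p + sqrt q)"
    using assms by (simp add: algebra_simps)
  then have "(p - q)\<^sup>2 = (sqrt p + sqrt q)\<^sup>2 * (sqrt p - sqrt q)\<^sup>2"
    by (simp add: power_mult_distrib)
  also have "\<dots> \<le> (4 * b) * ent p q"
  proof (rule mult_mono)
    have "(sqrt p + sqrt q)\<^sup>2 \<le> (2 * sqrt b)\<^sup>2"
      using assms by (intro power_mono) (auto intro!: add_mono[of "sqrt p" "sqrt b" "sqrt q" "sqrt b", simplified])
    then show "(sqrt p + sqrt q)\<^sup>2 \<le> 4 * b" using assms by (simp add: power_mult_distrib)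
  qed (use assms hellinger_le_ent in auto)
  finally show ?thesis .
qed

text \<open>With \<open>r\<close> the mixture, nonnegativity of \<open>ent t r\<close> at \<open>t =
  p\<close> and \<open>t = p'\<close> is the tangent inequality that Jensen's inequality needs.\<close>
lemma ent_convex_left:
  assumes "0 \<le> p" "0 \<le> p'" "0 < q" "0 < h" "h < 1"
  shows "ent ((1 - h) * p + h * p') q \<le> (1 - h) * ent p q + h * ent p' q"
proof (cases "(1 - h) * p + h * p' = 0")
  case True
  then have "p = 0" "p' = 0"
    using assms by (smt (verit) mult_pos_pos mult_nonneg_nonneg)+
  then show ?thesis by (simp add: ent_def algebra_simps)
next
  case False
  define r where "r = (1 - h) * p + h * p'"
  have r: "0 < r" using False assms unfolding r_def by (smt (verit) mult_nonneg_nonneg)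
  have *: "t * ln (r / q) \<le> t * ln (t / q) - t + r" if "0 \<le> t" for t
  proof (cases "t = 0")
    case True then show ?thesis using r by simp
  next
    case False
    then have "0 < t" using that by simp
    then have "ent t r = t * (ln (t / q) - ln (r / q)) - t + r"
      using r assms by (simp add: ent_def ln_div)
    moreover have "0 \<le> ent t r" using that r by (rule ent_nonneg)
    ultimately show ?thesis by (simp add: algebra_simps)
  qed
  have "ent r q = (1 - h) * (p * ln (r / q)) + h * (p' * ln (r / q)) - r + q"
    by (simp add: ent_def r_def algebra_simps)
  also have "\<dots> \<le> (1 - h) * (p * ln (p / q) - p + r) + h * (p' * ln (p' / q) - p' + r) - r + q"
    using *[OF assms(1)] *[OF assms(2)] assms by (intro add_mono diff_mono mult_left_mono) auto
  also have "\<dots> = (1 - h) * ent p q + h * ent p' q"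
    by (simp add: ent_def r_def algebra_simps)
  finally show ?thesis by (simp add: r_def)
qed

text \<open>Convexity in the second argument is what allows the mean of a block of iterates to replace the
  block as an anchor.\<close>
lemma ent_mean_right:
  fixes q :: "'i \<Rightarrow> real"
  assumes "finite S" "S \<noteq> {}" "0 \<le> u" "\<And>l. l \<in> S \<Longrightarrow> 0 < q l"
  shows "real (card S) * ent u ((\<Sum>l\<in>S. q l) / real (card S)) \<le> (\<Sum>l\<in>S. ent u (q l))"
proof -
  define a where "a = (\<Sum>l\<in>S. q l) / real (card S)"
  have c: "0 < real (card S)" using assms by (simp add: card_gt_0_iff)
  have a: "0 < a" unfolding a_def using assms c by (intro divide_pos_pos sum_pos) auto
  have sq: "(\<Sum>l\<in>S. q l) = real (card S) * a" using c by (simp add: a_def)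
  have "ent u a + u - u * (q l / a) - a + q l \<le> ent u (q l)" if "l \<in> S" for l
  proof (cases "u = 0")
    case True then show ?thesis by (simp add: ent_def)
  next
    case False
    have ql: "0 < q l" using assms that by auto
    have "ln (q l / a) \<le> q l / a - 1" by (rule ln_le_minus_one) (use ql a in simp)
    then have "u * ln (q l / a) \<le> u * (q l / a - 1)" using assms by (intro mult_left_mono) auto
    moreover have "u * ln (u / q l) = u * ln (u / a) - u * ln (q l / a)"
      using False assms a ql by (simp add: ln_div algebra_simps)
    ultimately show ?thesis by (simp add: ent_def algebra_simps)
  qed
  then have "(\<Sum>l\<in>S. ent u a + u - u * (q l / a) - a + q l) \<le> (\<Sum>l\<in>S. ent u (q l))"
    by (rule sum_mono)
  also have "(\<Sum>l\<in>S. ent u a + u - u * (q l / a) - a + q l)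
      = real (card S) * (ent u a + u - a) - u * ((\<Sum>l\<in>S. q l) / a) + (\<Sum>l\<in>S. q l)"
    by (simp add: sum.distrib sum_subtractf sum_distrib_left sum_divide_distrib algebra_simps)
  also have "\<dots> = real (card S) * ent u a"
    using a by (simp add: sq algebra_simps)
  finally show ?thesis by (simp add: a_def)
qed

text \<open>Mass that grows by a factor \<open>1 + \<eta>\<close> is paid for by the Hellinger distance
  because \<open>sqrt (1 + \<eta>) \<ge> 1 + \<eta> / 3\<close>.\<close>
lemma hellinger_jump:
  fixes p q \<eta> :: real
  assumes "0 \<le> p" "0 \<le> q" "0 < \<eta>" "\<eta> \<le> 1" "(1 + \<eta>) * q < p"
  shows "p \<le> 16 / \<eta>\<^sup>2 * (sqrt p - sqrt q)\<^sup>2"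
proof -
  have "(1 + \<eta> / 3)\<^sup>2 \<le> 1 + \<eta>"
    using assms by (simp add: power2_eq_square algebra_simps) (simp add: field_simps)
  then have s: "((1 + \<eta> / 3) * sqrt q)\<^sup>2 \<le> (1 + \<eta>) * q"
    using assms by (simp add: power_mult_distrib mult_right_mono)
  then have "(1 + \<eta> / 3) * sqrt q \<le> sqrt p"
    using assms by (intro real_le_rsqrt) auto
  then have "\<eta> / 4 * sqrt p \<le> sqrt p - sqrt q"
  proof -
    assume "(1 + \<eta> / 3) * sqrt q \<le> sqrt p"
    then have "(1 - \<eta> / 4) * ((1 + \<eta> / 3) * sqrt q) \<le> (1 - \<eta> / 4) * sqrt p"
      using assms by (intro mult_left_mono) auto
    moreover have "1 * sqrt q \<le> ((1 - \<eta> / 4) * (1 + \<eta> / 3)) * sqrt q"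
    proof (rule mult_right_mono)
      have "0 \<le> \<eta> * (1 - \<eta>)" using assms by simp
      then show "1 \<le> (1 - \<eta> / 4) * (1 + \<eta> / 3)" by (simp add: algebra_simps)
    qed (use assms in simp)
    moreover have "(1 - \<eta> / 4) * sqrt p = sqrt p - \<eta> / 4 * sqrt p" by (simp add: left_diff_distrib)
    ultimately show ?thesis unfolding mult.assoc by linarith
  qed
  then have "(\<eta> / 4 * sqrt p)\<^sup>2 \<le> (sqrt p - sqrt q)\<^sup>2"
    using assms by (intro power_mono) auto
  then have "\<eta>\<^sup>2 / 16 * p \<le> (sqrt p - sqrt q)\<^sup>2"
    using assms by (simp add: power_mult_distrib power_divide)
  then show ?thesis using assms by (simp add: field_simps)
qed

section \<open>Skew forms and Gibbs points on a product of two simplices\<close>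

definition kl :: "nat \<Rightarrow> (nat \<Rightarrow> real) \<Rightarrow> (nat \<Rightarrow> real) \<Rightarrow> real" where
  "kl N p q = (\<Sum>j<N. ent (p j) (q j))"

definition hellinger :: "nat \<Rightarrow> (nat \<Rightarrow> real) \<Rightarrow> (nat \<Rightarrow> real) \<Rightarrow> real" where
  "hellinger N p q = (\<Sum>j<N. (sqrt (p j) - sqrt (q j))\<^sup>2)"

definition ip :: "nat \<Rightarrow> (nat \<Rightarrow> real) \<Rightarrow> (nat \<Rightarrow> real) \<Rightarrow> real" where
  "ip N f g = (\<Sum>j<N. f j * g j)"

definition mat_app :: "nat \<Rightarrow> (nat \<Rightarrow> nat \<Rightarrow> real) \<Rightarrow> (nat \<Rightarrow> real) \<Rightarrow> nat \<Rightarrow> real" where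
  "mat_app N M z j = (\<Sum>k<N. M j k * z k)"

definition skew :: "nat \<Rightarrow> (nat \<Rightarrow> nat \<Rightarrow> real) \<Rightarrow> bool" where
  "skew N M \<longleftrightarrow> (\<forall>j<N. \<forall>k<N. M j k = - M k j)"

lemma ip_diff_right: "ip N f (\<lambda>j. g j - h j) = ip N f g - ip N f h"
  by (simp add: ip_def right_diff_distrib sum_subtractf)
lemma ip_diff_left: "ip N (\<lambda>j. g j - h j) f = ip N g f - ip N h f"
  by (simp add: ip_def left_diff_distrib sum_subtractf)
lemma ip_add_right: "ip N f (\<lambda>j. g j + h j) = ip N f g + ip N f h"
  by (simp add: ip_def distrib_left sum.distrib)
lemma ip_add_left: "ip N (\<lambda>j. g j + h j) f = ip N g f + ip N h f"
  by (simp add: ip_def distrib_right sum.distrib)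
lemma ip_scale_right: "ip N f (\<lambda>j. c * g j) = c * ip N f g"
  by (simp add: ip_def sum_distrib_left algebra_simps)
lemma ip_scale_left: "ip N (\<lambda>j. c * g j) f = c * ip N g f"
  by (simp add: ip_def sum_distrib_left algebra_simps)
lemmas ip_linear = ip_diff_right ip_diff_left ip_add_right ip_add_left ip_scale_right ip_scale_left

lemma mat_app_diff: "mat_app N M (\<lambda>k. g k - h k) j = mat_app N M g j - mat_app N M h j"
  by (simp add: mat_app_def right_diff_distrib sum_subtractf)
lemma mat_app_add: "mat_app N M (\<lambda>k. g k + h k) j = mat_app N M g j + mat_app N M h j"
  by (simp add: mat_app_def distrib_left sum.distrib)
lemma mat_app_scale: "mat_app N M (\<lambda>k. c * g k) j = c * mat_app N M g j"
  by (simp add: mat_app_def sum_distrib_left algebra_simps)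
lemmas mat_app_linear = mat_app_diff mat_app_add mat_app_scale

lemma skew_ip:
  assumes "skew N M"
  shows "ip N (mat_app N M u) v = - ip N (mat_app N M v) u"
proof -
  have "ip N (mat_app N M u) v = (\<Sum>j<N. \<Sum>k<N. M j k * u k * v j)"
    by (simp add: ip_def mat_app_def sum_distrib_right)
  also have "\<dots> = (\<Sum>k<N. \<Sum>j<N. M j k * u k * v j)" by (rule sum.swap)
  also have "\<dots> = (\<Sum>k<N. \<Sum>j<N. - (M k j * v j * u k))"
  proof (intro sum.cong refl)
    fix k j assume "k \<in> {..<N}" "j \<in> {..<N}"
    then have e: "M j k = - M k j" using assms unfolding skew_def by blast
    show "M j k * u k * v j = - (M k j * v j * u k)" unfolding e by simp
  qed
  also have "\<dots> = - ip N (mat_app N M v) u"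
    by (simp add: ip_def mat_app_def sum_distrib_right sum_negf)
  finally show ?thesis .
qed

lemma skew_ip_self: "skew N M \<Longrightarrow> ip N (mat_app N M u) u = 0"
  using skew_ip[of N M u u] by simp

lemma skewD: "skew N M \<Longrightarrow> j < N \<Longrightarrow> k < N \<Longrightarrow> M j k = - M k j"
  unfolding skew_def by blast

lemma skewI: "(\<And>j k. j < N \<Longrightarrow> k < N \<Longrightarrow> M j k = - M k j) \<Longrightarrow> skew N M"
  unfolding skew_def by blast

lemma skew_scale:
  assumes "skew N M" shows "skew N (\<lambda>j k. s * M j k)"
proof (rule skewI)
  fix j k assume "j < N" "k < N"
  then have e: "M j k = - M k j" using assms by (rule skewD[rotated])
  show "s * M j k = - (s * M k j)" unfolding e by simp
qed

text \<open>A vector \<open>b\<close> that dominates both points turns relative entropy into a norm with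
  fixed weights \<open>1 / b\<close>. The energy argument rests on such a fixed geometry.\<close>
lemma sq_dist_le_kl:
  assumes "\<And>j. j < N \<Longrightarrow> 0 \<le> p j" "\<And>j. j < N \<Longrightarrow> 0 < q j"
    "\<And>j. j < N \<Longrightarrow> p j \<le> b j" "\<And>j. j < N \<Longrightarrow> q j \<le> b j"
  shows "(\<Sum>j<N. (p j - q j)\<^sup>2 / b j) \<le> 4 * kl N p q"
  unfolding kl_def sum_distrib_left
proof (rule sum_mono)
  fix j assume "j \<in> {..<N}"
  then have j: "j < N" by simp
  then have "0 < b j" using assms(2)[of j] assms(4)[of j] by simp
  then show "(p j - q j)\<^sup>2 / b j \<le> 4 * ent (p j) (q j)"
    using sq_diff_le_ent[of "p j" "q j" "b j"] assms j by (simp add: field_simps)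
qed

lemma kl_nonneg: "(\<And>j. j < N \<Longrightarrow> 0 \<le> p j) \<Longrightarrow> (\<And>j. j < N \<Longrightarrow> 0 < q j) \<Longrightarrow> 0 \<le> kl N p q"
  unfolding kl_def by (intro sum_nonneg ent_nonneg) auto

lemma hellinger_le_kl: "(\<And>j. j < N \<Longrightarrow> 0 \<le> p j) \<Longrightarrow> (\<And>j. j < N \<Longrightarrow> 0 < q j) \<Longrightarrow> hellinger N p q \<le> kl N p q"
  unfolding kl_def hellinger_def by (intro sum_mono hellinger_le_ent) auto

lemma hellinger_nonneg: "0 \<le> hellinger N p q" unfolding hellinger_def by (intro sum_nonneg) auto

lemma hellinger_commute: "hellinger N p q = hellinger N q p"
  unfolding hellinger_def by (intro sum.cong refl) (simp add: power2_commute)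

lemma hellinger_triangle: "hellinger N p r \<le> 2 * hellinger N p q + 2 * hellinger N q r"
  unfolding hellinger_def sum_distrib_left sum.distrib[symmetric]
proof (rule sum_mono)
  fix j
  have "(a + b)\<^sup>2 \<le> 2 * a\<^sup>2 + 2 * b\<^sup>2" for a b :: real
    using zero_le_power2[of "a - b"] by (simp add: power2_eq_square algebra_simps)
  from this[of "sqrt (p j) - sqrt (q j)" "sqrt (q j) - sqrt (r j)"]
  show "(sqrt (p j) - sqrt (r j))\<^sup>2 \<le> 2 * (sqrt (p j) - sqrt (q j))\<^sup>2 + 2 * (sqrt (q j) - sqrt (r j))\<^sup>2"
    by simp
qed

locale two_simplices =
  fixes n m N :: nat
  assumes n_pos: "0 < n" and m_pos: "0 < m" and N_eq: "N = n + m"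
begin

lemma n_less_N: "n < N"
  using m_pos by (simp add: N_eq)

definition Z :: "(nat \<Rightarrow> real) set" where
  "Z = {z. (\<forall>j. 0 \<le> z j) \<and> (\<forall>j\<ge>N. z j = 0) \<and> (\<Sum>j<n. z j) = 1 \<and> (\<Sum>j=n..<N. z j) = 1}"

definition blk :: "nat \<Rightarrow> nat set" where
  "blk j = (if j < n then {..<n} else {n..<N})"

text \<open>The Gibbs point with prior \<open>c\<close> and force \<open>g\<close>, normalised separately on
  each simplex; \<open>c\<close> need not be normalised. It minimises \<open>\<langle>g, z\<rangle> + kl N z
  c\<close> over \<open>Z\<close>.\<close>
definition gibbs :: "(nat \<Rightarrow> real) \<Rightarrow> (nat \<Rightarrow> real) \<Rightarrow> nat \<Rightarrow> real" where
  "gibbs c g j = (if j < N then c j * exp (- g j) / (\<Sum>l\<in>blk j. c l * exp (- g l)) else 0)"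

definition z0 :: "nat \<Rightarrow> real" where
  "z0 j = (if j < n then 1 / real n else if j < N then 1 / real m else 0)"

lemma sum_N: "(\<Sum>j<N. f j) = (\<Sum>j<n. f j) + (\<Sum>j=n..<N. f j)" for f :: "nat \<Rightarrow> real"
proof -
  have "{..<N} = {..<n} \<union> {n..<N}" using n_less_N by auto
  then show ?thesis by (simp add: sum.union_disjoint ivl_disj_int)
qed

lemma Z_nonneg: "z \<in> Z \<Longrightarrow> 0 \<le> z j" by (simp add: Z_def)
lemma Z_sum: "z \<in> Z \<Longrightarrow> (\<Sum>j<N. z j) = 2" by (subst sum_N) (simp add: Z_def)
lemma Z_le_1:
  assumes "z \<in> Z" shows "z j \<le> 1"
proof -
  consider "j < n" | "n \<le> j" "j < N" | "N \<le> j" by linarith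
  then show ?thesis
  proof cases
    case 1
    then have "z j \<le> (\<Sum>j<n. z j)" using assms by (intro member_le_sum) (auto simp: Z_def)
    then show ?thesis using assms by (simp add: Z_def)
  next
    case 2
    then have "z j \<le> (\<Sum>j=n..<N. z j)" using assms by (intro member_le_sum) (auto simp: Z_def)
    then show ?thesis using assms by (simp add: Z_def)
  qed (use assms in \<open>simp add: Z_def\<close>)
qed

lemma Z_convex:
  assumes "z \<in> Z" "z' \<in> Z" "0 \<le> h" "h \<le> 1"
  shows "(\<lambda>j. (1 - h) * z j + h * z' j) \<in> Z"
  using assms unfolding Z_def
  by (auto simp: sum.distrib sum_distrib_left[symmetric])

lemma z0_Z: "z0 \<in> Z"
proof -
  have "(\<Sum>j=n..<N. z0 j) = (\<Sum>j=n..<N. 1 / real m)"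
    by (intro sum.cong) (auto simp: z0_def)
  then have "(\<Sum>j=n..<N. z0 j) = 1" using N_eq m_pos by simp
  moreover have "(\<Sum>j<n. z0 j) = (\<Sum>j<n. 1 / real n)"
    by (intro sum.cong) (auto simp: z0_def)
  then have "(\<Sum>j<n. z0 j) = 1" using n_pos by simp
  ultimately show ?thesis using n_less_N by (auto simp: Z_def z0_def)
qed

lemma z0_pos: "j < N \<Longrightarrow> 0 < z0 j"
  using n_pos m_pos by (auto simp: z0_def)

lemma gibbs_norm_pos:
  fixes c g :: "nat \<Rightarrow> real"
  assumes "\<And>j. j < N \<Longrightarrow> 0 < c j"
  shows "0 < (\<Sum>l\<in>blk j. c l * exp (- g l))"
proof (rule sum_pos)
  show "finite (blk j)" by (simp add: blk_def)
  show "blk j \<noteq> {}" using n_pos n_less_N by (auto simp: blk_def)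
  show "0 < c l * exp (- g l)" if "l \<in> blk j" for l
    using that assms[of l] n_less_N by (auto simp: blk_def split: if_splits)
qed

lemma gibbs_pos:
  assumes "\<And>j. j < N \<Longrightarrow> 0 < c j" "j < N"
  shows "0 < gibbs c g j"
  using assms gibbs_norm_pos[where c=c and g=g and j=j] by (simp add: gibbs_def)

lemma gibbs_Z:
  assumes "\<And>j. j < N \<Longrightarrow> 0 < c j"
  shows "gibbs c g \<in> Z"
proof -
  have "0 \<le> gibbs c g j" for j
    using gibbs_pos[of c j g, OF assms] by (cases "j < N") (auto simp: gibbs_def)
  moreover have "(\<Sum>j<n. gibbs c g j) = 1"
  proof -
    have "(\<Sum>j<n. gibbs c g j) = (\<Sum>j<n. c j * exp (- g j)) / (\<Sum>l<n. c l * exp (- g l))"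
      unfolding sum_divide_distrib using n_less_N by (intro sum.cong) (auto simp: gibbs_def blk_def)
    then show ?thesis using gibbs_norm_pos[where c=c and g=g and j=0, OF assms] n_pos by (simp add: blk_def)
  qed
  moreover have "(\<Sum>j=n..<N. gibbs c g j) = 1"
  proof -
    have "(\<Sum>j=n..<N. gibbs c g j) = (\<Sum>j=n..<N. c j * exp (- g j)) / (\<Sum>l=n..<N. c l * exp (- g l))"
      unfolding sum_divide_distrib using n_less_N by (intro sum.cong) (auto simp: gibbs_def blk_def)
    then show ?thesis using gibbs_norm_pos[where c=c and g=g and j=n, OF assms] by (simp add: blk_def)
  qed
  ultimately show ?thesis by (auto simp: Z_def gibbs_def)
qed

lemma blockwise_const:
  assumes "u \<in> Z" "v \<in> Z"
  shows "(\<Sum>j<N. (if j < n then a else b) * (u j - v j)) = (0::real)"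
  using assms by (subst sum_N) (simp add: Z_def sum_distrib_left[symmetric] sum_subtractf)

text \<open>On each block \<open>ln w - ln c + g\<close> is constant for the Gibbs point \<open>w\<close>,
  and \<open>w - u\<close> sums to zero there. So \<open>g\<close> may be replaced by \<open>ln c - ln
  w\<close>, and what remains is an identity between logarithms.\<close>
lemma gibbs_three_point:
  assumes c: "\<And>j. j < N \<Longrightarrow> 0 < c j" and u: "u \<in> Z"
  shows "ip N g (\<lambda>j. gibbs c g j - u j) = kl N u c - kl N u (gibbs c g) - kl N (gibbs c g) c"
proof -
  define w where "w = gibbs c g"
  define S where "S j = (\<Sum>l\<in>blk j. c l * exp (- g l))" for j
  have wZ: "w \<in> Z" unfolding w_def by (rule gibbs_Z) (rule c)
  have w: "0 < w j" if "j < N" for j unfolding w_def using c that by (rule gibbs_pos)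
  have S: "0 < S j" for j unfolding S_def by (rule gibbs_norm_pos) (rule c)
  have lnw: "ln (w j) = ln (c j) - g j - ln (S j)" if "j < N" for j
    using that c[OF that] S[of j] by (simp add: w_def gibbs_def S_def[symmetric] ln_div ln_mult)
  have Sj: "ln (S j) = (if j < n then ln (S 0) else ln (S n))" if "j < N" for j
    using that n_pos n_less_N by (simp add: S_def blk_def)
  have jth: "ent (u j) (c j) - ent (u j) (w j) - ent (w j) (c j)
     = (u j - w j) * (ln (w j) - ln (c j))" if j: "j < N" for j
  proof (cases "u j = 0")
    case True
    then show ?thesis using w[OF j] c[OF j] by (simp add: ent_def ln_div algebra_simps)
  next
    case False
    then have "0 < u j" using Z_nonneg[OF u, of j] by simp
    then show ?thesis using w[OF j] c[OF j] by (simp add: ent_def ln_div algebra_simps)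
  qed
  have "kl N u c - kl N u w - kl N w c = (\<Sum>j<N. (u j - w j) * (ln (w j) - ln (c j)))"
    unfolding kl_def sum_subtractf[symmetric] by (intro sum.cong refl jth) simp
  also have "\<dots> = (\<Sum>j<N. g j * (w j - u j) + (if j < n then ln (S 0) else ln (S n)) * (w j - u j))"
    by (intro sum.cong refl) (auto simp: lnw Sj algebra_simps)
  also have "\<dots> = ip N g (\<lambda>j. w j - u j)"
    by (simp add: sum.distrib blockwise_const[OF wZ u] ip_def)
  finally show ?thesis by (simp add: w_def)
qed

lemma kl_self: "(\<And>j. j < N \<Longrightarrow> 0 < c j) \<Longrightarrow> kl N c c = 0"
  by (simp add: kl_def ent_self)

lemma gibbs_normalises: "z \<in> Z \<Longrightarrow> gibbs z (\<lambda>j. 0) = z"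
  by (rule ext) (auto simp: gibbs_def blk_def Z_def)

lemma kl_z0_le:
  assumes "u \<in> Z"
  shows "kl N u z0 \<le> ln (real n) + ln (real m)"
proof -
  have e: "ent (u j) (z0 j) \<le> - u j + z0 j + u j * (if j < n then ln (real n) else ln (real m))"
    if "j < N" for j
  proof (cases "u j = 0")
    case False
    then have u: "0 < u j" "u j \<le> 1" using Z_nonneg[OF assms, of j] Z_le_1[OF assms, of j] by auto
    have "ln (u j / z0 j) \<le> ln (1 / z0 j)"
      using u z0_pos[OF that] by (subst ln_le_cancel_iff) (auto intro: divide_right_mono)
    also have "\<dots> = (if j < n then ln (real n) else ln (real m))" using that by (simp add: z0_def)
    finally show ?thesis using u by (simp add: ent_def)
  qed (simp add: ent_def)
  have "kl N u z0 \<le> (\<Sum>j<N. - u j + z0 j + u j * (if j < n then ln (real n) else ln (real m)))"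
    unfolding kl_def by (intro sum_mono e) simp
  also have "\<dots> = (\<Sum>j<N. u j * (if j < n then ln (real n) else ln (real m)))"
    using Z_sum[OF assms] Z_sum[OF z0_Z] by (simp add: sum.distrib sum_subtractf)
  also have "\<dots> = ln (real n) + ln (real m)"
    using assms by (subst sum_N) (simp add: Z_def sum_distrib_right[symmetric])
  finally show ?thesis .
qed

end

section \<open>Regularised equilibria of a known skew game\<close>

lemma convergent_coordinates_subseq:
  fixes f :: "nat \<Rightarrow> nat \<Rightarrow> real"
  assumes "\<And>t j. 0 \<le> f t j" "\<And>t j. f t j \<le> 1"
  shows "\<exists>r. strict_mono r \<and> (\<forall>j<d. convergent (\<lambda>t. f (r t) j))"
proof (induction d)
  case 0
  show ?case by (rule exI[of _ id]) (simp add: strict_mono_def)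
next
  case (Suc d)
  then obtain r where r: "strict_mono r" "\<forall>j<d. convergent (\<lambda>t. f (r t) j)" by blast
  obtain s where s: "strict_mono s" "monoseq (\<lambda>t. f (r (s t)) d)"
    using seq_monosub[of "\<lambda>t. f (r t) d"] by blast
  have "Bseq (\<lambda>t. f (r (s t)) d)"
    using assms by (intro BseqI'[of _ 1]) simp
  then have "convergent (\<lambda>t. f (r (s t)) d)"
    using s(2) by (rule Bseq_monoseq_convergent)
  moreover have "convergent (\<lambda>t. f (r (s t)) j)" if "j < d" for j
    using r(2) that convergent_subseq_convergent[OF _ s(1), of "\<lambda>t. f (r t) j"]
    by (simp add: comp_def)
  ultimately have "\<forall>j<Suc d. convergent (\<lambda>t. f ((r \<circ> s) t) j)"
    by (auto simp: less_Suc_eq)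
  moreover have "strict_mono (r \<circ> s)" using r(1) s(1) by (rule strict_mono_o)
  ultimately show ?case by blast
qed

lemma young_ip:
  "h * ip N d x \<le> h\<^sup>2 * (\<Sum>j<N. (d j)\<^sup>2) + (\<Sum>j<N. (x j)\<^sup>2) / 4"
proof -
  have "h * (d j * x j) \<le> h\<^sup>2 * (d j)\<^sup>2 + (x j)\<^sup>2 / 4" for j
    using zero_le_power2[of "h * d j - x j / 2"] by (simp add: power2_eq_square algebra_simps)
  then have "(\<Sum>j<N. h * (d j * x j)) \<le> (\<Sum>j<N. h\<^sup>2 * (d j)\<^sup>2 + (x j)\<^sup>2 / 4)"
    by (intro sum_mono)
  then show ?thesis
    by (simp add: ip_def sum_distrib_left sum.distrib sum_divide_distrib)
qed

text \<open>Supplies step lengths: the full length \<open>b\<close>, or one at which the threshold is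
  attained.\<close>
lemma crossing_point:
  fixes f :: "real \<Rightarrow> real"
  assumes "continuous_on {0..b} f" "f 0 < \<theta>" "0 < b"
  shows "\<exists>t. 0 < t \<and> t \<le> b \<and> f t \<le> \<theta> \<and> (t = b \<or> f t = \<theta>)"
proof (cases "f b \<le> \<theta>")
  case True then show ?thesis using assms by auto
next
  case False
  then obtain t where "0 \<le> t" "t \<le> b" "f t = \<theta>"
    using IVT'[of f 0 \<theta> b] assms by auto
  then show ?thesis using assms(2) by (intro exI[of _ t]) (cases "t = 0", auto)
qed

lemma continuous_on_lipschitz:
  fixes f :: "real \<Rightarrow> real"
  assumes "\<And>x y. x \<in> S \<Longrightarrow> y \<in> S \<Longrightarrow> \<bar>f x - f y\<bar> \<le> L * \<bar>x - y\<bar>"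
  shows "continuous_on S f"
  unfolding continuous_on_def tendsto_iff eventually_at dist_real_def
proof (intro ballI allI impI)
  fix x e :: real assume x: "x \<in> S" and e: "0 < e"
  show "\<exists>d>0. \<forall>x'\<in>S. x' \<noteq> x \<and> \<bar>x' - x\<bar> < d \<longrightarrow> \<bar>f x' - f x\<bar> < e"
  proof (intro exI[of _ "e / (\<bar>L\<bar> + 1)"] conjI ballI impI)
    fix y assume y: "y \<in> S" "y \<noteq> x \<and> \<bar>y - x\<bar> < e / (\<bar>L\<bar> + 1)"
    have "\<bar>f y - f x\<bar> \<le> L * \<bar>y - x\<bar>" using assms x y by blast
    also have "\<dots> \<le> (\<bar>L\<bar> + 1) * \<bar>y - x\<bar>" by (intro mult_right_mono) auto
    also have "\<dots> < e" using y(2) by (simp add: pos_less_divide_eq mult.commute)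
    finally show "\<bar>f y - f x\<bar> < e" .
  qed (use e in simp)
qed

context two_simplices begin

lemma gibbs_gibbs:
  assumes c: "\<And>j. j < N \<Longrightarrow> 0 < c j"
  shows "gibbs (gibbs c g) d = gibbs c (\<lambda>j. g j + d j)"
proof
  fix j
  show "gibbs (gibbs c g) d j = gibbs c (\<lambda>j. g j + d j) j"
  proof (cases "j < N")
    case True
    define S where "S = (\<Sum>l\<in>blk j. c l * exp (- g l))"
    have S: "0 < S" unfolding S_def by (rule gibbs_norm_pos) (rule c)
    have l: "gibbs c g l = c l * exp (- g l) / S" if "l \<in> blk j" for l
      using that True n_less_N by (auto simp: gibbs_def S_def blk_def split: if_splits)
    have jj: "j \<in> blk j" using True by (auto simp: blk_def)
    have "(\<Sum>l\<in>blk j. gibbs c g l * exp (- d l)) = (\<Sum>l\<in>blk j. c l * exp (- (g l + d l))) / S"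
      unfolding sum_divide_distrib by (intro sum.cong) (auto simp: l exp_diff exp_minus field_simps)
    moreover have "gibbs c g j * exp (- d j) = c j * exp (- (g j + d j)) / S"
      using l[OF jj] by (simp add: exp_diff exp_minus field_simps)
    ultimately show ?thesis using True S
      by (simp only: gibbs_def[of "gibbs c g"] gibbs_def[of c "\<lambda>j. g j + d j"] if_True) simp
  qed (simp add: gibbs_def)
qed

text \<open>The entropy smoothed best response to \<open>z\<close> in the game with skew matrix
  \<open>M\<close> and linear payoff \<open>r\<close>.\<close>
definition resp :: "(nat \<Rightarrow> real) \<Rightarrow> (nat \<Rightarrow> nat \<Rightarrow> real) \<Rightarrow> (nat \<Rightarrow> real) \<Rightarrow> (nat \<Rightarrow> real) \<Rightarrow> nat \<Rightarrow> real" where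
  "resp c M r z = gibbs c (\<lambda>j. mat_app N M z j + r j)"

lemma mat_app_diff_bound:
  assumes "\<And>k. \<bar>x k\<bar> \<le> 1"
  shows "(mat_app N M x j)\<^sup>2 \<le> (\<Sum>k<N. \<bar>M j k\<bar>)\<^sup>2"
proof -
  have "\<bar>mat_app N M x j\<bar> \<le> (\<Sum>k<N. \<bar>M j k * x k\<bar>)" unfolding mat_app_def by (rule sum_abs)
  also have "\<dots> \<le> (\<Sum>k<N. \<bar>M j k\<bar>)"
    using assms by (intro sum_mono) (simp add: abs_mult mult_left_le)
  finally have "\<bar>mat_app N M x j\<bar>\<^sup>2 \<le> (\<Sum>k<N. \<bar>M j k\<bar>)\<^sup>2" by (intro power_mono) auto
  then show ?thesis by simp
qed

lemma Z_diff_le_1: "z \<in> Z \<Longrightarrow> y \<in> Z \<Longrightarrow> \<bar>z k - y k\<bar> \<le> 1"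
  using Z_nonneg[of z k] Z_nonneg[of y k] Z_le_1[of z k] Z_le_1[of y k] by linarith

lemma Z_sq_dist_le_kl:
  assumes "z \<in> Z" "y \<in> Z" "\<And>j. j < N \<Longrightarrow> 0 < y j"
  shows "(\<Sum>j<N. (z j - y j)\<^sup>2) \<le> 4 * kl N z y"
  using sq_dist_le_kl[of N z y "\<lambda>_. 1"] assms Z_nonneg Z_le_1 by simp

text \<open>Smoothed fictitious play. The divergence of \<open>z\<close> from its response is the duality
  gap of \<open>z\<close> in the regularised game. Moving a fraction \<open>h\<close> towards the response
  multiplies it by \<open>1 - h\<close>, since skewness cancels all bilinear terms, up to the second order
  effect of the response moving as well.\<close>
lemma response_gap_descent:
  fixes r z :: "nat \<Rightarrow> real"
  assumes M: "skew N M" and c: "\<And>j. j < N \<Longrightarrow> 0 < c j" and z: "z \<in> Z" and h: "0 < h" "h < 1"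
  defines "y \<equiv> \<lambda>j. (1 - h) * z j + h * resp c M r z j"
  shows "kl N y (resp c M r y) \<le> (1 - h) * kl N z (resp c M r z) + h\<^sup>2 * (\<Sum>j<N. (\<Sum>k<N. \<bar>M j k\<bar>)\<^sup>2)"
proof -
  define t where "t = resp c M r z"
  define g where "g = (\<lambda>j. mat_app N M z j + r j)"
  define w where "w = resp c M r y"
  define gy where "gy = (\<lambda>j. mat_app N M y j + r j)"
  define d where "d = mat_app N M (\<lambda>j. t j - z j)"
  have y: "y = (\<lambda>j. (1 - h) * z j + h * t j)" by (simp add: y_def t_def)
  have tg: "t = gibbs c g" and wg: "w = gibbs c gy" by (simp_all add: t_def w_def g_def gy_def resp_def)
  have tZ: "t \<in> Z" unfolding tg by (rule gibbs_Z) (rule c)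
  have wZ: "w \<in> Z" unfolding wg by (rule gibbs_Z) (rule c)
  have yZ: "y \<in> Z" unfolding y using z tZ h by (intro Z_convex) auto
  have tpos: "0 < t j" if "j < N" for j unfolding tg by (rule gibbs_pos) (use c that in auto)
  have wpos: "0 < w j" if "j < N" for j unfolding wg by (rule gibbs_pos) (use c that in auto)
  have mvy: "mat_app N M y j = (1 - h) * mat_app N M z j + h * mat_app N M t j" for j
    unfolding y by (simp add: mat_app_linear)
  have gyd: "gy = (\<lambda>j. g j + h * d j)"
    by (rule ext) (simp add: gy_def g_def d_def mvy mat_app_diff left_diff_distrib right_diff_distrib)
  \<comment> \<open>The two responses are Gibbs points whose forces differ by \<open>h d\<close>. By the three point identity their
    symmetric divergence is \<open>h\<close> times a bilinear term, which Young's inequality bounds in second order.\<close>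
  have drift: "kl N t w \<le> h\<^sup>2 * (\<Sum>j<N. (\<Sum>k<N. \<bar>M j k\<bar>)\<^sup>2)"
  proof -
    have w2: "w = gibbs t (\<lambda>j. h * d j)"
      unfolding wg gyd tg using c by (rule gibbs_gibbs[symmetric])
    have "ip N (\<lambda>j. h * d j) (\<lambda>j. w j - t j) = kl N t t - kl N t w - kl N w t"
      unfolding w2 using tpos tZ by (rule gibbs_three_point)
    then have "kl N t w + kl N w t = h * ip N d (\<lambda>j. t j - w j)"
      using kl_self[of t] tpos by (simp add: ip_linear algebra_simps)
    also have "\<dots> \<le> h\<^sup>2 * (\<Sum>j<N. (d j)\<^sup>2) + (\<Sum>j<N. (t j - w j)\<^sup>2) / 4" by (rule young_ip)
    finally have "kl N t w \<le> h\<^sup>2 * (\<Sum>j<N. (d j)\<^sup>2)"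
      using Z_sq_dist_le_kl[OF wZ tZ tpos] by (simp add: power2_commute)
    also have "\<dots> \<le> h\<^sup>2 * (\<Sum>j<N. (\<Sum>k<N. \<bar>M j k\<bar>)\<^sup>2)"
      unfolding d_def using Z_diff_le_1[OF tZ z] by (intro mult_left_mono sum_mono mat_app_diff_bound) auto
    finally show ?thesis .
  qed
  have e1: "ip N g (\<lambda>j. t j - z j) = kl N z c - kl N z t - kl N t c"
    unfolding tg using c z by (rule gibbs_three_point)
  have e2: "ip N gy (\<lambda>j. w j - y j) = kl N y c - kl N y w - kl N w c"
    unfolding wg using c yZ by (rule gibbs_three_point)
  have e3: "ip N gy (\<lambda>j. w j - t j) = kl N t c - kl N t w - kl N w c"
    unfolding wg using c tZ by (rule gibbs_three_point)
  have cv: "kl N y c \<le> (1 - h) * kl N z c + h * kl N t c"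
    unfolding kl_def sum_distrib_left sum.distrib[symmetric] y
    using c h Z_nonneg[OF z] Z_nonneg[OF tZ] by (intro sum_mono ent_convex_left) auto
  have gyy: "ip N gy y = ip N r y"
    unfolding gy_def using skew_ip_self[OF M, of y] by (simp add: ip_linear)
  have gyt: "ip N gy t = (1 - h) * ip N (mat_app N M z) t + ip N r t"
    unfolding gy_def mvy using skew_ip_self[OF M, of t] by (simp add: ip_linear)
  have gz: "ip N g z = ip N r z" "ip N g t = ip N (mat_app N M z) t + ip N r t"
    unfolding g_def using skew_ip_self[OF M, of z] by (simp_all add: ip_linear)
  have ry: "ip N r y = (1 - h) * ip N r z + h * ip N r t" unfolding y by (simp add: ip_linear)
  have "kl N y w = kl N y c - kl N t c + ip N gy y - ip N gy t + kl N t w"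
    using e2 e3 by (simp add: ip_linear)
  also have "\<dots> \<le> (1 - h) * (kl N z c - kl N t c + ip N r z - ip N r t - ip N (mat_app N M z) t) + kl N t w"
    using cv by (simp add: gyy gyt ry algebra_simps)
  also have "kl N z c - kl N t c + ip N r z - ip N r t - ip N (mat_app N M z) t = kl N z t"
    using e1 gz by (simp add: ip_linear)
  finally show ?thesis using drift by (simp add: w_def t_def)
qed

text \<open>Descent forces the infimum of the gap below \<open>h (1 + C)\<close> for every small
  \<open>h\<close>, hence to zero, and compactness of the simplices turns points of vanishing gap into a
  fixed point.\<close>
lemma response_fixed_point:
  assumes M: "skew N M" and c: "\<And>j. j < N \<Longrightarrow> 0 < c j"
  shows "\<exists>z\<in>Z. z = resp c M r z"
proof -
  define V where "V z = kl N z (resp c M r z)" for z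
  define C where "C = (\<Sum>j<N. (\<Sum>k<N. \<bar>M j k\<bar>)\<^sup>2)"
  have rZ: "resp c M r z \<in> Z" for z unfolding resp_def using c by (rule gibbs_Z)
  have rpos: "0 < resp c M r z j" if "j < N" for z j
    unfolding resp_def by (rule gibbs_pos) (use c that in auto)
  have V0: "0 \<le> V z" if "z \<in> Z" for z
    unfolding V_def using Z_nonneg[OF that] rpos by (intro kl_nonneg) auto
  have C0: "0 \<le> C" unfolding C_def by (intro sum_nonneg) auto
  define v where "v = Inf (V ` Z)"
  have ne: "V ` Z \<noteq> {}" using z0_Z by auto
  have bdd: "bdd_below (V ` Z)" using V0 by (auto intro!: bdd_belowI[of _ 0])
  have v0: "0 \<le> v" unfolding v_def using ne V0 by (auto intro!: cInf_greatest)
  have vle: "v \<le> h * (1 + C)" if h: "0 < h" "h < 1" for h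
  proof -
    obtain z where z: "z \<in> Z" "V z < v + h\<^sup>2"
      using cInf_lessD[OF ne, of "v + h\<^sup>2"] h unfolding v_def by auto
    define y where "y = (\<lambda>j. (1 - h) * z j + h * resp c M r z j)"
    have "y \<in> Z" unfolding y_def using z rZ h by (intro Z_convex) auto
    then have "v \<le> V y" unfolding v_def using bdd by (intro cInf_lower) auto
    also have "\<dots> \<le> (1 - h) * V z + h\<^sup>2 * C"
      unfolding V_def C_def y_def using M c z(1) h by (rule response_gap_descent)
    also have "\<dots> \<le> (1 - h) * (v + h\<^sup>2) + h\<^sup>2 * C"
      using z h by (intro add_mono mult_left_mono) auto
    also have "\<dots> \<le> v - h * v + h * (h * (1 + C))"
      using h by (simp add: power2_eq_square algebra_simps)
    finally have "h * v \<le> h * (h * (1 + C))" by simp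
    then show ?thesis using h by simp
  qed
  have "v = 0"
  proof (rule ccontr)
    assume "v \<noteq> 0"
    then have v: "0 < v" using v0 by simp
    define h where "h = min (1/2) (v / (2 * (1 + C)))"
    have h: "0 < h" "h < 1" using v C0 by (auto simp: h_def)
    have "h * (1 + C) \<le> v / (2 * (1 + C)) * (1 + C)"
      unfolding h_def using C0 by (intro mult_right_mono) auto
    also have "\<dots> = v / 2" using C0 by (simp add: field_simps)
    finally show False using vle[OF h] v by simp
  qed
  then have excess: "\<exists>z\<in>Z. V z < 1 / real (Suc t)" for t
    using cInf_lessD[OF ne, of "1 / real (Suc t)"] unfolding v_def by auto
  then obtain f where f: "\<And>t. f t \<in> Z" "\<And>t. V (f t) < 1 / real (Suc t)" by metis
  obtain q where q: "strict_mono q" "\<forall>j<N. convergent (\<lambda>t. f (q t) j)"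
    using convergent_coordinates_subseq[of f N] f(1) Z_nonneg Z_le_1 by blast
  define z where "z j = (if j < N then lim (\<lambda>t. f (q t) j) else 0)" for j
  have lim: "(\<lambda>t. f (q t) j) \<longlonglongrightarrow> z j" for j
  proof (cases "j < N")
    case True then show ?thesis using q(2) by (simp add: z_def convergent_LIMSEQ_iff)
  next
    case False then show ?thesis using f(1) by (simp add: z_def Z_def)
  qed
  have zZ: "z \<in> Z"
  proof -
    have "0 \<le> z j" for j using lim[of j] f(1) Z_nonneg by (intro LIMSEQ_le_const[OF lim]) auto
    moreover have "(\<Sum>j<n. z j) = 1"
    proof (rule LIMSEQ_unique)
      show "(\<lambda>t. \<Sum>j<n. f (q t) j) \<longlonglongrightarrow> (\<Sum>j<n. z j)" by (intro tendsto_sum lim)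
      show "(\<lambda>t. \<Sum>j<n. f (q t) j) \<longlonglongrightarrow> 1" using f(1) by (simp add: Z_def)
    qed
    moreover have "(\<Sum>j=n..<N. z j) = 1"
    proof (rule LIMSEQ_unique)
      show "(\<lambda>t. \<Sum>j=n..<N. f (q t) j) \<longlonglongrightarrow> (\<Sum>j=n..<N. z j)" by (intro tendsto_sum lim)
      show "(\<lambda>t. \<Sum>j=n..<N. f (q t) j) \<longlonglongrightarrow> 1" using f(1) by (simp add: Z_def)
    qed
    ultimately show ?thesis by (auto simp: Z_def z_def)
  qed
  have limr: "(\<lambda>t. resp c M r (f (q t)) j) \<longlonglongrightarrow> resp c M r z j" for j
  proof (cases "j < N")
    case True
    have "(\<Sum>l\<in>blk j. c l * exp (- (mat_app N M z l + r l))) \<noteq> 0"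
      using gibbs_norm_pos[where c=c and g="\<lambda>l. mat_app N M z l + r l" and j=j, OF c] by simp
    then show ?thesis using True
      unfolding resp_def gibbs_def mat_app_def by (auto intro!: tendsto_intros lim)
  qed (simp add: resp_def gibbs_def)
  have "z j = resp c M r z j" if j: "j < N" for j
  proof -
    have b: "(f (q t) j - resp c M r (f (q t)) j)\<^sup>2 \<le> 4 * (1 / real (Suc (q t)))" for t
    proof -
      have "(f (q t) j - resp c M r (f (q t)) j)\<^sup>2 \<le> (\<Sum>j<N. (f (q t) j - resp c M r (f (q t)) j)\<^sup>2)"
        using j by (intro member_le_sum) auto
      also have "\<dots> \<le> 4 * V (f (q t))" unfolding V_def using f(1) rZ rpos by (rule Z_sq_dist_le_kl)
      finally show ?thesis using f(2)[of "q t"] by linarith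
    qed
    have "(\<lambda>t. 4 * (1 / real (Suc (q t)))) \<longlonglongrightarrow> 4 * 0"
      using LIMSEQ_subseq_LIMSEQ[OF LIMSEQ_inverse_real_of_nat q(1)]
      by (intro tendsto_mult tendsto_const) (simp add: comp_def inverse_eq_divide)
    moreover have "(\<lambda>t. (f (q t) j - resp c M r (f (q t)) j)\<^sup>2) \<longlonglongrightarrow> (z j - resp c M r z j)\<^sup>2"
      by (intro tendsto_intros lim limr)
    ultimately have "(z j - resp c M r z j)\<^sup>2 \<le> 4 * 0"
      using b by (intro LIMSEQ_le) auto
    then show ?thesis by simp
  qed
  then have "z = resp c M r z" using zZ rZ by (intro ext) (metis (mono_tags, lifting) Z_def leI mem_Collect_eq)
  then show ?thesis using zZ by blast
qed

text \<open>Adding the three point identities of the two fixed points cancels the skew part of the forces;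
  \<open>s - t\<close> times a bounded force remains, against a symmetric divergence that dominates the
  squared distance.\<close>
lemma scaled_response_lipschitz:
  assumes M: "skew N M" and c: "\<And>j. j < N \<Longrightarrow> 0 < c j"
    and z: "z = gibbs c (\<lambda>j. s * (mat_app N M z j + r j))" and y: "y = gibbs c (\<lambda>j. t * (mat_app N M y j + r j))"
    and j: "j < N"
  shows "\<bar>z j - y j\<bar> \<le> 2 * sqrt (\<Sum>j<N. ((\<Sum>k<N. \<bar>M j k\<bar>) + \<bar>r j\<bar>)\<^sup>2) * \<bar>s - t\<bar>"
proof -
  define C where "C = (\<Sum>j<N. ((\<Sum>k<N. \<bar>M j k\<bar>) + \<bar>r j\<bar>)\<^sup>2)"
  define S where "S = (\<Sum>j<N. (z j - y j)\<^sup>2)"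
  have C0: "0 \<le> C" unfolding C_def by (intro sum_nonneg) auto
  have zZ: "z \<in> Z" by (subst z) (rule gibbs_Z[OF c])
  have yZ: "y \<in> Z" by (subst y) (rule gibbs_Z[OF c])
  have zp: "0 < z j" if "j < N" for j by (subst z) (rule gibbs_pos[OF c that])
  have yp: "0 < y j" if "j < N" for j by (subst y) (rule gibbs_pos[OF c that])
  have e1: "ip N (\<lambda>j. s * (mat_app N M z j + r j)) (\<lambda>j. z j - y j) = kl N y c - kl N y z - kl N z c"
    using gibbs_three_point[where c=c and g="\<lambda>j. s * (mat_app N M z j + r j)" and u=y, OF c yZ]
    unfolding z[symmetric] .
  have e2: "ip N (\<lambda>j. t * (mat_app N M y j + r j)) (\<lambda>j. y j - z j) = kl N z c - kl N z y - kl N y c"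
    using gibbs_three_point[where c=c and g="\<lambda>j. t * (mat_app N M y j + r j)" and u=z, OF c zZ]
    unfolding y[symmetric] .
  have "kl N y z + kl N z y = - (s - t) * ip N (\<lambda>j. mat_app N M y j + r j) (\<lambda>j. z j - y j)"
  proof -
    have "ip N (mat_app N M z) z = 0" "ip N (mat_app N M y) y = 0" "ip N (mat_app N M z) y = - ip N (mat_app N M y) z"
      by (rule skew_ip_self[OF M], rule skew_ip_self[OF M], rule skew_ip[OF M])
    then show ?thesis using e1 e2 by (simp add: ip_linear algebra_simps)
  qed
  also have "\<dots> \<le> (- (s - t))\<^sup>2 * (\<Sum>j<N. (mat_app N M y j + r j)\<^sup>2) + S / 4"
    unfolding S_def by (rule young_ip)
  also have "(\<Sum>j<N. (mat_app N M y j + r j)\<^sup>2) \<le> C"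
    unfolding C_def
  proof (rule sum_mono)
    fix j
    have "\<bar>y k\<bar> \<le> 1" for k using Z_nonneg[OF yZ] Z_le_1[OF yZ] by simp
    then have "(mat_app N M y j)\<^sup>2 \<le> (\<Sum>k<N. \<bar>M j k\<bar>)\<^sup>2" by (rule mat_app_diff_bound)
    then have "\<bar>mat_app N M y j\<bar> \<le> (\<Sum>k<N. \<bar>M j k\<bar>)"
      by (simp add: abs_le_square_iff[symmetric] sum_nonneg)
    then have "\<bar>mat_app N M y j + r j\<bar> \<le> (\<Sum>k<N. \<bar>M j k\<bar>) + \<bar>r j\<bar>" by linarith
    then have "\<bar>mat_app N M y j + r j\<bar>\<^sup>2 \<le> ((\<Sum>k<N. \<bar>M j k\<bar>) + \<bar>r j\<bar>)\<^sup>2" by (intro power_mono) auto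
    then show "(mat_app N M y j + r j)\<^sup>2 \<le> ((\<Sum>k<N. \<bar>M j k\<bar>) + \<bar>r j\<bar>)\<^sup>2" by simp
  qed
  finally have "kl N y z + kl N z y \<le> (s - t)\<^sup>2 * C + S / 4"
    by (simp add: mult_left_mono power2_commute)
  moreover have "S \<le> 4 * kl N z y" unfolding S_def using zZ yZ yp by (rule Z_sq_dist_le_kl)
  moreover have "S \<le> 4 * kl N y z"
    unfolding S_def using Z_sq_dist_le_kl[OF yZ zZ zp] by (simp add: power2_commute)
  ultimately have "S \<le> 4 * ((s - t)\<^sup>2 * C)" by linarith
  moreover have "(z j - y j)\<^sup>2 \<le> S" unfolding S_def using j by (intro member_le_sum) auto
  ultimately have "(z j - y j)\<^sup>2 \<le> (2 * sqrt C * \<bar>s - t\<bar>)\<^sup>2"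
    using C0 by (simp add: power_mult_distrib algebra_simps)
  then show ?thesis
    using abs_le_square_iff[of "z j - y j" "2 * sqrt C * \<bar>s - t\<bar>"] C0 by (simp add: C_def abs_mult)
qed

text \<open>The factor \<open>8\<close> leaves room for normalising a prior and for moderate growth within a
  step; only the mass beyond it has to be limited.\<close>
definition excess :: "(nat \<Rightarrow> real) \<Rightarrow> (nat \<Rightarrow> real) \<Rightarrow> real" where
  "excess \<omega> z = (\<Sum>j<N. max 0 (z j - 8 * \<omega> j))"

text \<open>At step length zero the fixed point is the normalised prior, which has no excess, and the fixed
  point depends continuously on the step length.\<close>
lemma probe_exists:
  assumes M: "skew N M" and c: "\<And>j. j < N \<Longrightarrow> 0 < c j" and th: "0 < \<theta>"
    and base: "\<And>j. j < N \<Longrightarrow> gibbs c (\<lambda>j. 0) j \<le> 8 * \<omega> j"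
  shows "\<exists>\<tau> z. 0 < \<tau> \<and> \<tau> \<le> 1 \<and> z = gibbs c (\<lambda>j. \<tau> / \<Gamma> * (mat_app N M z j + r j))
     \<and> excess \<omega> z \<le> \<theta> \<and> (\<tau> = 1 \<or> excess \<omega> z = \<theta>)"
proof -
  have "\<exists>z. z = gibbs c (\<lambda>j. s * (mat_app N M z j + r j))" for s
  proof -
    have "\<exists>z\<in>Z. z = resp c (\<lambda>j k. s * M j k) (\<lambda>j. s * r j) z"
      by (rule response_fixed_point[OF skew_scale[OF M]]) (rule c)
    then obtain z where z: "z = resp c (\<lambda>j k. s * M j k) (\<lambda>j. s * r j) z"
      by (elim bexE)
    have "mat_app N (\<lambda>j k. s * M j k) z j = s * mat_app N M z j" for j
      by (simp add: mat_app_def sum_distrib_left mult.assoc)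
    then have "resp c (\<lambda>j k. s * M j k) (\<lambda>j. s * r j) z = gibbs c (\<lambda>j. s * (mat_app N M z j + r j))"
      by (simp add: resp_def distrib_left)
    then show ?thesis using z by metis
  qed
  then obtain zz where zz: "\<And>s. zz s = gibbs c (\<lambda>j. s * (mat_app N M (zz s) j + r j))" by metis
  define K where "K = 2 * sqrt (\<Sum>j<N. ((\<Sum>k<N. \<bar>M j k\<bar>) + \<bar>r j\<bar>)\<^sup>2)"
  have cont: "continuous_on {0..1} (\<lambda>\<tau>. zz (\<tau> / \<Gamma>) j)" if "j < N" for j
  proof (rule continuous_on_lipschitz)
    fix x y
    have "\<bar>zz (x / \<Gamma>) j - zz (y / \<Gamma>) j\<bar> \<le> K * \<bar>x / \<Gamma> - y / \<Gamma>\<bar>"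
      unfolding K_def using M c zz zz that by (rule scaled_response_lipschitz)
    then show "\<bar>zz (x / \<Gamma>) j - zz (y / \<Gamma>) j\<bar> \<le> (K / \<bar>\<Gamma>\<bar>) * \<bar>x - y\<bar>"
      by (simp add: diff_divide_distrib[symmetric] abs_divide)
  qed
  have "continuous_on {0..1} (\<lambda>\<tau>. excess \<omega> (zz (\<tau> / \<Gamma>)))"
    unfolding excess_def using cont by (intro continuous_intros) auto
  moreover have "excess \<omega> (zz (0 / \<Gamma>)) < \<theta>"
  proof -
    have "zz 0 = gibbs c (\<lambda>j. 0)" using zz[of 0] by simp
    then have "excess \<omega> (zz (0 / \<Gamma>)) = 0" unfolding excess_def using base by (intro sum.neutral) auto
    then show ?thesis using th by simp
  qed
  ultimately obtain \<tau> where "0 < \<tau>" "\<tau> \<le> 1" "excess \<omega> (zz (\<tau> / \<Gamma>)) \<le> \<theta>" "\<tau> = 1 \<or> excess \<omega> (zz (\<tau> / \<Gamma>)) = \<theta>"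
    using crossing_point[of 1 "\<lambda>\<tau>. excess \<omega> (zz (\<tau> / \<Gamma>))" \<theta>] by auto
  then show ?thesis using zz by blast
qed

lemma corrector_exists:
  assumes c: "\<And>j. j < N \<Longrightarrow> 0 < c j" and th: "0 < \<theta>" and t: "0 < \<tau>"
    and base: "\<And>j. j < N \<Longrightarrow> gibbs c (\<lambda>j. 0) j \<le> 8 * \<omega> j"
  shows "\<exists>\<sigma> w. 0 < \<sigma> \<and> \<sigma> \<le> \<tau> \<and> w = gibbs c (\<lambda>j. \<sigma> / \<Gamma> * a j)
     \<and> excess \<omega> w \<le> \<theta> \<and> (\<sigma> = \<tau> \<or> excess \<omega> w = \<theta>)"
proof -
  define f where "f \<sigma> = gibbs c (\<lambda>j. \<sigma> / \<Gamma> * a j)" for \<sigma>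
  have cont: "continuous_on {0..\<tau>} (\<lambda>\<sigma>. f \<sigma> j)" if "j < N" for j
  proof -
    have "(\<Sum>l\<in>blk j. c l * exp (- (\<sigma> / \<Gamma> * a l))) \<noteq> 0" for \<sigma>
      using gibbs_norm_pos[where c=c and g="\<lambda>l. \<sigma> / \<Gamma> * a l" and j=j, OF c] by simp
    then show ?thesis using that unfolding f_def gibbs_def divide_inverse[of _ "\<Gamma>"]
      by (auto simp: divide_inverse intro!: continuous_intros)
  qed
  have "continuous_on {0..\<tau>} (\<lambda>\<sigma>. excess \<omega> (f \<sigma>))"
    unfolding excess_def using cont by (intro continuous_intros) auto
  moreover have "excess \<omega> (f 0) < \<theta>"
  proof -
    have "excess \<omega> (f 0) = 0" unfolding excess_def using base by (intro sum.neutral) (auto simp: f_def)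
    then show ?thesis using th by simp
  qed
  ultimately obtain \<sigma> where "0 < \<sigma>" "\<sigma> \<le> \<tau>" "excess \<omega> (f \<sigma>) \<le> \<theta>" "\<sigma> = \<tau> \<or> excess \<omega> (f \<sigma>) = \<theta>"
    using crossing_point[of \<tau> "\<lambda>\<sigma>. excess \<omega> (f \<sigma>)" \<theta>] t by auto
  then show ?thesis unfolding f_def by blast
qed

end

section \<open>Anchors at dyadic time scales\<close>

text \<open>Regularising towards several priors is regularising towards their geometric mean, up to a
  constant: both sides depend on \<open>u\<close> in the same way.\<close>
lemma ent_geometric_mean:
  fixes c :: "nat \<Rightarrow> real"
  assumes g: "\<And>i. i \<in> S \<Longrightarrow> 0 \<le> a i" and A: "0 < sum a S" and c: "\<And>i. i \<in> S \<Longrightarrow> 0 < c i" and u: "0 \<le> u"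
  shows "(\<Sum>i\<in>S. a i * ent u (c i)) = sum a S * ent u (exp ((\<Sum>i\<in>S. a i * ln (c i)) / sum a S))
     + (\<Sum>i\<in>S. a i * c i) - sum a S * exp ((\<Sum>i\<in>S. a i * ln (c i)) / sum a S)"
proof -
  define L where "L = (\<Sum>i\<in>S. a i * ln (c i))"
  have e: "ent u (c i) = (u * ln u - u) - u * ln (c i) + c i" if "i \<in> S" for i
    using c[OF that] u by (cases "u = 0") (auto simp: ent_def ln_div algebra_simps)
  have "(\<Sum>i\<in>S. a i * ent u (c i)) = (\<Sum>i\<in>S. a i * (u * ln u - u) - u * (a i * ln (c i)) + a i * c i)"
    by (intro sum.cong refl, subst e) (auto simp: algebra_simps)
  also have "\<dots> = sum a S * (u * ln u - u) - u * L + (\<Sum>i\<in>S. a i * c i)"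
    by (simp add: sum.distrib sum_subtractf sum_distrib_left sum_distrib_right L_def)
  moreover have "ent u (exp (L / sum a S)) = u * ln u - u - u * (L / sum a S) + exp (L / sum a S)"
    using u by (cases "u = 0") (auto simp: ent_def ln_div algebra_simps)
  then have "sum a S * ent u (exp (L / sum a S)) = sum a S * (u * ln u - u) - u * L + sum a S * exp (L / sum a S)"
    using A by (simp add: distrib_left right_diff_distrib)
  ultimately show ?thesis by (simp add: L_def)
qed

locale multilevel = two_simplices +
  fixes \<gamma> :: real and I :: nat
  assumes gamma_pos: "0 < \<gamma>"
begin

text \<open>Level \<open>0\<close> gives the previous iterate, and every level starts from the uniform point
  until its first block is complete.\<close>
definition anchor :: "(nat \<Rightarrow> nat \<Rightarrow> real) \<Rightarrow> nat \<Rightarrow> nat \<Rightarrow> nat \<Rightarrow> real" where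
  "anchor w i k = (if k div 2 ^ i = 0 then z0
     else (\<lambda>j. (\<Sum>l = (k div 2 ^ i - 1) * 2 ^ i..<(k div 2 ^ i - 1) * 2 ^ i + 2 ^ i. w l j) / 2 ^ i))"

definition gam :: "nat \<Rightarrow> real" where "gam i = \<gamma> / 2 ^ i"

definition Gam :: real where "Gam = (\<Sum>i\<le>I. gam i)"

definition Kreg :: "(nat \<Rightarrow> nat \<Rightarrow> real) \<Rightarrow> nat \<Rightarrow> (nat \<Rightarrow> real) \<Rightarrow> real" where
  "Kreg w k u = (\<Sum>i\<le>I. gam i * kl N u (anchor w i k))"

definition geo :: "(nat \<Rightarrow> nat \<Rightarrow> real) \<Rightarrow> nat \<Rightarrow> nat \<Rightarrow> real" where
  "geo w k j = exp ((\<Sum>i\<le>I. gam i * ln (anchor w i k j)) / Gam)"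

definition good :: "(nat \<Rightarrow> nat \<Rightarrow> real) \<Rightarrow> nat \<Rightarrow> bool" where
  "good w K \<longleftrightarrow> (\<forall>s<K. w s \<in> Z \<and> (\<forall>j<N. 0 < w s j))"

lemma gam_pos: "0 < gam i" using gamma_pos by (simp add: gam_def)

lemma gamma_le_Gam: "\<gamma> \<le> Gam"
proof -
  have "gam 0 \<le> Gam" unfolding Gam_def using gam_pos by (intro member_le_sum) (auto intro: less_imp_le)
  then show ?thesis by (simp add: gam_def)
qed

lemma Gam_pos: "0 < Gam" using gamma_le_Gam gamma_pos by linarith

lemma anchor_block_le: "k div 2 ^ i \<noteq> 0 \<Longrightarrow> (k div 2 ^ i - 1) * 2 ^ i + 2 ^ i \<le> (k::nat)"
  by (metis One_nat_def Suc_pred add.commute bot_nat_0.not_eq_extremum mult_Suc times_div_less_eq_dividend mult.commute)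

lemma anchor_cong:
  assumes "\<And>s. s < k \<Longrightarrow> w s = w' s"
  shows "anchor w i k = anchor w' i k"
proof (cases "k div 2 ^ i = 0")
  case False
  then show ?thesis using assms anchor_block_le[OF False]
    unfolding anchor_def by (auto intro!: ext arg_cong2[of _ _ _ _ "(/)"] sum.cong)
qed (simp add: anchor_def)

lemma Kreg_cong: "(\<And>s. s < k \<Longrightarrow> w s = w' s) \<Longrightarrow> Kreg w k = Kreg w' k"
  unfolding Kreg_def by (rule ext) (simp add: anchor_cong[of k w w'])

lemma anchor_mean_Z:
  fixes a :: nat
  assumes "\<And>l. l \<in> {a..<a + 2 ^ i} \<Longrightarrow> w l \<in> Z"
  shows "(\<lambda>j. (\<Sum>l = a..<a + 2 ^ i. w l j) / 2 ^ i) \<in> Z"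
proof -
  have c: "(\<Sum>j\<in>J. (\<Sum>l = a..<a + 2 ^ i. w l j) / 2 ^ i) = 1"
    if "\<And>l. l \<in> {a..<a + 2 ^ i} \<Longrightarrow> (\<Sum>j\<in>J. w l j) = (1::real)" for J
  proof -
    have "(\<Sum>j\<in>J. (\<Sum>l = a..<a + 2 ^ i. w l j) / 2 ^ i) = (\<Sum>l = a..<a + 2 ^ i. \<Sum>j\<in>J. w l j) / 2 ^ i"
      unfolding sum_divide_distrib[symmetric] by (subst sum.swap) simp
    also have "(\<Sum>l = a..<a + 2 ^ i. \<Sum>j\<in>J. w l j) = (\<Sum>l = a..<a + 2 ^ i. 1)"
      by (intro sum.cong refl that)
    finally show ?thesis by simp
  qed
  show ?thesis unfolding Z_def
    using assms by (auto simp: Z_def intro!: c divide_nonneg_pos sum_nonneg)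
qed

lemma anchor_Z:
  assumes "good w K" "k \<le> K"
  shows "anchor w i k \<in> Z"
proof (cases "k div 2 ^ i = 0")
  case True then show ?thesis by (simp add: anchor_def z0_Z)
next
  case False
  then show ?thesis using anchor_block_le[OF False] assms
    unfolding anchor_def by (auto simp: good_def intro!: anchor_mean_Z)
qed

lemma anchor_pos:
  assumes "good w K" "k \<le> K" "j < N"
  shows "0 < anchor w i k j"
proof (cases "k div 2 ^ i = 0")
  case True then show ?thesis using assms by (simp add: anchor_def z0_pos)
next
  case False
  then show ?thesis using anchor_block_le[OF False] assms
    unfolding anchor_def by (auto simp: good_def intro!: divide_pos_pos sum_pos)
qed

lemma anchor_le:
  assumes "k \<le> K" "z0 j \<le> S" "\<And>s. s < K \<Longrightarrow> w s j \<le> S"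
  shows "anchor w i k j \<le> S"
proof (cases "k div 2 ^ i = 0")
  case True then show ?thesis using assms by (simp add: anchor_def)
next
  case False
  have "(\<Sum>l = (k div 2 ^ i - 1) * 2 ^ i..<(k div 2 ^ i - 1) * 2 ^ i + 2 ^ i. w l j)
      \<le> (\<Sum>l = (k div 2 ^ i - 1) * 2 ^ i..<(k div 2 ^ i - 1) * 2 ^ i + 2 ^ i. S)"
    using anchor_block_le[OF False] assms by (intro sum_mono) auto
  then show ?thesis using False by (simp add: anchor_def field_simps)
qed

lemma anchor_0_Suc: "anchor w 0 (Suc k) = w k"
  by (simp add: anchor_def)

lemma anchor_0_0: "anchor w i 0 = z0"
  by (simp add: anchor_def)

lemma geo_pos: "0 < geo w k j" by (simp add: geo_def)

text \<open>The deficit in the inequality between geometric and arithmetic means of the anchors. It is a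
  lower bound of the regulariser on \<open>Z\<close> and is large when the anchors are far apart.\<close>
definition slack :: "(nat \<Rightarrow> nat \<Rightarrow> real) \<Rightarrow> nat \<Rightarrow> real" where
  "slack w k = Gam * (2 - (\<Sum>j<N. geo w k j))"

text \<open>Apply \<open>ent_geometric_mean\<close> at the geometric mean itself: the left side is
  nonnegative and the entropy on the right vanishes.\<close>
lemma geo_le_mean:
  assumes "good w K" "k \<le> K" "j < N"
  shows "Gam * geo w k j \<le> (\<Sum>i\<le>I. gam i * anchor w i k j)"
proof -
  have "0 \<le> (\<Sum>i\<le>I. gam i * ent (geo w k j) (anchor w i k j))"
    using gam_pos anchor_pos[OF assms] geo_pos[of w k j]
    by (intro sum_nonneg mult_nonneg_nonneg ent_nonneg) (auto intro: less_imp_le)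
  also have "\<dots> = (\<Sum>i\<le>I. gam i * anchor w i k j) - Gam * geo w k j"
    using ent_geometric_mean[of "{..I}" gam "\<lambda>i. anchor w i k j" "geo w k j"]
      gam_pos Gam_pos anchor_pos[OF assms] geo_pos[of w k j]
    by (simp add: Gam_def[symmetric] geo_def[symmetric] ent_self less_imp_le)
  finally show ?thesis by simp
qed

lemma Kreg_geo:
  assumes "good w K" "k \<le> K" "\<And>j. j < N \<Longrightarrow> 0 \<le> u j"
  shows "Kreg w k u = Gam * kl N u (geo w k) + slack w k"
proof -
  have a: "(\<Sum>i\<le>I. gam i * ent (u j) (anchor w i k j))
      = Gam * ent (u j) (geo w k j) + (\<Sum>i\<le>I. gam i * anchor w i k j) - Gam * geo w k j" if "j < N" for j
    using ent_geometric_mean[of "{..I}" gam "\<lambda>i. anchor w i k j" "u j"]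
      gam_pos Gam_pos anchor_pos[OF assms(1,2) that] assms(3)[OF that]
    by (simp add: Gam_def[symmetric] geo_def[symmetric] less_imp_le)
  have "Kreg w k u = (\<Sum>j<N. \<Sum>i\<le>I. gam i * ent (u j) (anchor w i k j))"
    unfolding Kreg_def kl_def sum_distrib_left by (rule sum.swap)
  also have "\<dots> = (\<Sum>j<N. Gam * ent (u j) (geo w k j) + (\<Sum>i\<le>I. gam i * anchor w i k j) - Gam * geo w k j)"
    by (intro sum.cong refl a) simp
  also have "\<dots> = Gam * kl N u (geo w k) + (\<Sum>i\<le>I. \<Sum>j<N. gam i * anchor w i k j) - Gam * (\<Sum>j<N. geo w k j)"
    unfolding sum.distrib sum_subtractf kl_def sum_distrib_left by (subst sum.swap) simp
  also have "(\<Sum>i\<le>I. \<Sum>j<N. gam i * anchor w i k j) = Gam * 2"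
    using Z_sum[OF anchor_Z[OF assms(1,2)]] by (simp add: sum_distrib_left[symmetric] sum_distrib_right[symmetric] Gam_def)
  finally show ?thesis by (simp add: slack_def algebra_simps)
qed

lemma sum_geo_le_1:
  assumes "good w K" "k \<le> K" "J \<subseteq> {..<N}" "\<And>z. z \<in> Z \<Longrightarrow> (\<Sum>j\<in>J. z j) = 1"
  shows "(\<Sum>j\<in>J. geo w k j) \<le> 1"
proof -
  have "Gam * (\<Sum>j\<in>J. geo w k j) \<le> (\<Sum>j\<in>J. \<Sum>i\<le>I. gam i * anchor w i k j)"
    unfolding sum_distrib_left using assms by (intro sum_mono geo_le_mean) auto
  also have "\<dots> = (\<Sum>i\<le>I. gam i * (\<Sum>j\<in>J. anchor w i k j))"
    by (subst sum.swap) (simp add: sum_distrib_left)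
  also have "\<dots> = Gam * 1" using assms(4)[OF anchor_Z[OF assms(1,2)]] by (simp add: Gam_def)
  finally show ?thesis using Gam_pos by simp
qed

lemma sum_geo_blocks:
  assumes "good w K" "k \<le> K"
  shows "(\<Sum>j<n. geo w k j) \<le> 1" "(\<Sum>j=n..<N. geo w k j) \<le> 1"
proof -
  have "{..<n} \<subseteq> {..<N}" "{n..<N} \<subseteq> {..<N}" using n_less_N by auto
  then show "(\<Sum>j<n. geo w k j) \<le> 1" "(\<Sum>j=n..<N. geo w k j) \<le> 1"
    using sum_geo_le_1[OF assms, of "{..<n}"] sum_geo_le_1[OF assms, of "{n..<N}"] by (auto simp: Z_def)
qed

lemma slack_nonneg: "good w K \<Longrightarrow> k \<le> K \<Longrightarrow> 0 \<le> slack w k"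
  using sum_geo_blocks[of w K k] Gam_pos sum_N[of "geo w k"] by (simp add: slack_def)

lemma Kreg_ge_slack:
  assumes "good w K" "k \<le> K" "u \<in> Z"
  shows "slack w k \<le> Kreg w k u"
  using Kreg_geo[OF assms(1,2), of u] Z_nonneg[OF assms(3)] Gam_pos geo_pos
  by (simp add: kl_nonneg)

text \<open>The geometric mean lies below \<open>\<omega>\<close>, so its normalisation can exceed \<open>8
  \<omega>\<close> only if it has mass below \<open>1 / 8\<close> on a block, and then the slack is at least
  \<open>7 / 8\<close> of the total strength.\<close>
lemma base_excess:
  assumes w: "good w K" "k \<le> K" and om: "\<And>j. j < N \<Longrightarrow> z0 j \<le> \<omega> j" "\<And>j s. j < N \<Longrightarrow> s < K \<Longrightarrow> w s j \<le> \<omega> j"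
    and j: "j < N" "8 * \<omega> j < gibbs (geo w k) (\<lambda>j. 0) j"
  shows "\<gamma> / 2 \<le> slack w k"
proof -
  define S where "S = (\<Sum>l\<in>blk j. geo w k l)"
  have S: "0 < S" unfolding S_def
    using gibbs_norm_pos[where c="geo w k" and g="\<lambda>_. 0" and j=j] geo_pos by simp
  have om0: "0 < \<omega> j" using om(1)[of j] z0_pos[of j] j by simp
  have "geo w k j \<le> \<omega> j"
  proof -
    have "(\<Sum>i\<le>I. gam i * ln (anchor w i k j)) \<le> (\<Sum>i\<le>I. gam i * ln (\<omega> j))"
    proof (intro sum_mono mult_left_mono)
      fix i
      have "anchor w i k j \<le> \<omega> j" using w(2) om j(1) by (intro anchor_le[where K=K]) auto
      then show "ln (anchor w i k j) \<le> ln (\<omega> j)" using anchor_pos[OF w j(1)] om0 by simp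
    qed (use gam_pos in \<open>auto intro: less_imp_le\<close>)
    also have "\<dots> = Gam * ln (\<omega> j)" by (simp add: Gam_def sum_distrib_right)
    finally have "(\<Sum>i\<le>I. gam i * ln (anchor w i k j)) / Gam \<le> ln (\<omega> j)"
      using Gam_pos by (simp add: field_simps)
    then have "geo w k j \<le> exp (ln (\<omega> j))" unfolding geo_def by simp
    then show ?thesis using om0 by simp
  qed
  moreover have "gibbs (geo w k) (\<lambda>j. 0) j = geo w k j / S"
    using j(1) by (simp add: gibbs_def S_def)
  ultimately have "8 * \<omega> j < \<omega> j / S"
    using j(2) S by (smt (verit) divide_right_mono)
  then have "S < 1 / 8" using S om0 by (simp add: field_simps)
  moreover have "S = sum (geo w k) {..<n} \<or> S = sum (geo w k) {n..<N}"
    by (simp add: S_def blk_def)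
  ultimately have "7 / 8 \<le> 2 - (\<Sum>j<N. geo w k j)"
    using sum_geo_blocks[OF w] sum_N[of "geo w k"] by linarith
  then have "Gam * (7 / 8) \<le> slack w k" unfolding slack_def using Gam_pos by (intro mult_left_mono) auto
  then show ?thesis using gamma_le_Gam gamma_pos by linarith
qed

lemma kl_anchor_mean:
  assumes "good w K" "Suc k \<le> K" "Suc k mod 2 ^ i = 0" "\<And>j. j < N \<Longrightarrow> 0 \<le> u j"
  shows "2 ^ i * kl N u (anchor w i (Suc k)) \<le> (\<Sum>l = Suc k - 2 ^ i..<Suc k. kl N u (w l))"
proof -
  define q where "q = Suc k div 2 ^ i"
  have d: "Suc k div 2 ^ i = q" by (simp add: q_def)
  have "Suc k div 2 ^ i * 2 ^ i + Suc k mod 2 ^ i = Suc k" by (rule div_mult_mod_eq)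
  then have q: "Suc k = q * 2 ^ i" unfolding assms(3) q_def by linarith
  have q0: "q \<noteq> 0"
  proof
    assume "q = 0"
    then show False using q by simp
  qed
  obtain q' where q': "q = Suc q'" using q0 by (cases q) auto
  have r: "(q - 1) * 2 ^ i = Suc k - 2 ^ i" "(q - 1) * 2 ^ i + 2 ^ i = Suc k"
    using q unfolding q' by simp_all
  have e: "2 ^ i * ent (u j) (anchor w i (Suc k) j) \<le> (\<Sum>l = Suc k - 2 ^ i..<Suc k. ent (u j) (w l j))"
    if j: "j < N" for j
  proof -
    have c: "card {Suc k - 2 ^ i..<Suc k} = 2 ^ i" using r by auto
    have r3: "Suc k - 2 ^ i + 2 ^ i = Suc k" by (simp only: r(1)[symmetric] r(2))
    have "anchor w i (Suc k) j = (\<Sum>l\<in>{Suc k - 2 ^ i..<Suc k}. w l j) / real (card {Suc k - 2 ^ i..<Suc k})"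
      using q0 unfolding anchor_def d r r3 c by (simp only: if_False of_nat_power of_nat_numeral)
    moreover have "{Suc k - 2 ^ i..<Suc k} \<noteq> {}" by auto
    moreover have "0 < w l j" if "l \<in> {Suc k - 2 ^ i..<Suc k}" for l
      using that assms(1,2) j by (auto simp: good_def)
    ultimately show ?thesis
      using ent_mean_right[of "{Suc k - 2 ^ i..<Suc k}" "u j" "\<lambda>l. w l j"] assms(4)[OF j] c by simp
  qed
  have "2 ^ i * kl N u (anchor w i (Suc k)) \<le> (\<Sum>j<N. \<Sum>l = Suc k - 2 ^ i..<Suc k. ent (u j) (w l j))"
    unfolding kl_def sum_distrib_left by (intro sum_mono e) simp
  also have "\<dots> = (\<Sum>l = Suc k - 2 ^ i..<Suc k. kl N u (w l))"
    unfolding kl_def by (rule sum.swap)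
  finally show ?thesis .
qed

text \<open>Inside a block, the steps still to come are charged to the anchor and the finished ones to the
  iterates. When the block is complete, its iterates are worth at least as much as the anchor that they
  form.\<close>
lemma level_telescope:
  assumes w: "good w K" and u: "u \<in> Z"
  shows "(\<Sum>s<K. kl N u (anchor w i s) - kl N u (w s)) \<le> 2 ^ i * kl N u z0"
proof -
  have u0: "0 \<le> u j" for j using Z_nonneg[OF u] .
  have an: "0 \<le> kl N u (anchor w i k)" if "k \<le> K" for k
    using u0 anchor_pos[OF w that] by (intro kl_nonneg) auto
  have wn: "0 \<le> kl N u (w s)" if "s < K" for s
    using u0 w that by (intro kl_nonneg) (auto simp: good_def)
  have "k \<le> K \<Longrightarrow> (\<Sum>s<k. kl N u (anchor w i s) - kl N u (w s))
      + real (2 ^ i - k mod 2 ^ i) * kl N u (anchor w i k) + (\<Sum>l = k - k mod 2 ^ i..<k. kl N u (w l))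
      \<le> 2 ^ i * kl N u z0" for k
  proof (induction k)
    case 0 then show ?case by (simp add: anchor_0_0)
  next
    case (Suc k)
    then have IH: "(\<Sum>s<k. kl N u (anchor w i s) - kl N u (w s))
      + real (2 ^ i - k mod 2 ^ i) * kl N u (anchor w i k) + (\<Sum>l = k - k mod 2 ^ i..<k. kl N u (w l))
      \<le> 2 ^ i * kl N u z0" by simp
    have lt: "k mod 2 ^ i < (2::nat) ^ i" by simp
    have split: "(\<Sum>l = k - k mod 2 ^ i..<Suc k. kl N u (w l)) = (\<Sum>l = k - k mod 2 ^ i..<k. kl N u (w l)) + kl N u (w k)"
      by (simp add: sum.atLeastLessThan_Suc)
    show ?case
    proof (cases "Suc k mod 2 ^ i = 0")
      case False
      then have m: "Suc k mod 2 ^ i = Suc (k mod 2 ^ i)" by (simp add: mod_Suc split: if_splits)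
      then have d: "Suc k div 2 ^ i = k div 2 ^ i" by (simp add: div_Suc)
      have a: "anchor w i (Suc k) = anchor w i k" unfolding anchor_def d ..
      have s: "Suc k - Suc k mod 2 ^ i = k - k mod 2 ^ i" by (simp add: m)
      have r: "real (2 ^ i - k mod 2 ^ i) = real (2 ^ i - Suc k mod 2 ^ i) + 1"
        using lt unfolding m by linarith
      have "real (2 ^ i - k mod 2 ^ i) * kl N u (anchor w i k)
          = real (2 ^ i - Suc k mod 2 ^ i) * kl N u (anchor w i k) + kl N u (anchor w i k)"
        unfolding r by (simp add: distrib_right)
      then show ?thesis using IH unfolding a s split sum.lessThan_Suc by linarith
    next
      case True
      then have m: "Suc (k mod 2 ^ i) = 2 ^ i" by (simp add: mod_Suc split: if_splits)
      then have r: "2 ^ i - k mod 2 ^ i = Suc 0" by linarith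
      have s: "Suc k - 2 ^ i = k - k mod 2 ^ i" using m by arith
      have "2 ^ i * kl N u (anchor w i (Suc k)) \<le> (\<Sum>l = k - k mod 2 ^ i..<Suc k. kl N u (w l))"
        using kl_anchor_mean[OF w Suc.prems True u0] unfolding s .
      moreover have "real (2 ^ i - Suc k mod 2 ^ i) = 2 ^ i" "{Suc k - Suc k mod 2 ^ i..<Suc k} = {}"
        unfolding True by simp_all
      ultimately show ?thesis using IH unfolding split sum.lessThan_Suc r by simp
    qed
  qed
  from this[of K] have "(\<Sum>s<K. kl N u (anchor w i s) - kl N u (w s))
      + (real (2 ^ i - K mod 2 ^ i) * kl N u (anchor w i K) + (\<Sum>l = K - K mod 2 ^ i..<K. kl N u (w l)))
      \<le> 2 ^ i * kl N u z0" by simp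
  moreover have "0 \<le> real (2 ^ i - K mod 2 ^ i) * kl N u (anchor w i K) + (\<Sum>l = K - K mod 2 ^ i..<K. kl N u (w l))"
    using an[of K] wn by (intro add_nonneg_nonneg mult_nonneg_nonneg sum_nonneg) auto
  ultimately show ?thesis by linarith
qed

lemma all_levels_telescope:
  assumes w: "good w K" and u: "u \<in> Z"
  shows "(\<Sum>s<K. Kreg w s u - Gam * kl N u (w s)) \<le> real (I + 1) * \<gamma> * kl N u z0"
proof -
  have "(\<Sum>s<K. Kreg w s u - Gam * kl N u (w s))
      = (\<Sum>s<K. \<Sum>i\<le>I. gam i * (kl N u (anchor w i s) - kl N u (w s)))"
    by (intro sum.cong refl) (simp add: Kreg_def Gam_def sum_distrib_right right_diff_distrib sum_subtractf)
  also have "\<dots> = (\<Sum>i\<le>I. gam i * (\<Sum>s<K. kl N u (anchor w i s) - kl N u (w s)))"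
    by (subst sum.swap) (simp add: sum_distrib_left)
  also have "\<dots> \<le> (\<Sum>i\<le>I. gam i * (2 ^ i * kl N u z0))"
    using gam_pos level_telescope[OF w u] by (intro sum_mono mult_left_mono) (auto intro: less_imp_le)
  also have "\<dots> = real (I + 1) * \<gamma> * kl N u z0" by (simp add: gam_def)
  finally show ?thesis .
qed

end

section \<open>Energy of the residual and the envelope of the iterates\<close>

definition energy :: "nat \<Rightarrow> (nat \<Rightarrow> real) \<Rightarrow> (nat \<Rightarrow> nat \<Rightarrow> real) \<Rightarrow> real" where
  "energy N \<omega> R = (\<Sum>j<N. \<Sum>k<N. \<omega> j * \<omega> k * (R j k)\<^sup>2)"

text \<open>The norm in which displacements are measured; \<open>sq_dist_le_kl\<close> bounds it by relative
  entropies.\<close>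
definition wnorm2 :: "nat \<Rightarrow> (nat \<Rightarrow> real) \<Rightarrow> (nat \<Rightarrow> real) \<Rightarrow> real" where
  "wnorm2 N \<omega> d = (\<Sum>j<N. (d j)\<^sup>2 / \<omega> j)"

definition clip :: "real \<Rightarrow> real" where "clip x = max (- 1) (min 1 x)"

text \<open>A correction of \<open>M\<close> along the skew tensor of \<open>d\<close> and
  \<open>d'\<close>. Clipping moves the model closer to any matrix with entries in \<open>[-1, 1]\<close>
  and keeps the residual entries below \<open>2\<close>.\<close>
definition refine :: "nat \<Rightarrow> (nat \<Rightarrow> real) \<Rightarrow> (nat \<Rightarrow> nat \<Rightarrow> real) \<Rightarrow> (nat \<Rightarrow> real) \<Rightarrow> (nat \<Rightarrow> real) \<Rightarrow> real \<Rightarrow> nat \<Rightarrow> nat \<Rightarrow> real" where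
  "refine N \<omega> M d d' \<rho> j k = clip (M j k + \<rho> / (wnorm2 N \<omega> d * wnorm2 N \<omega> d') * ((d' j * d k - d j * d' k) / (\<omega> j * \<omega> k)))"

lemma energy_nonneg: "(\<And>j. j < N \<Longrightarrow> 0 \<le> \<omega> j) \<Longrightarrow> 0 \<le> energy N \<omega> R"
  unfolding energy_def by (intro sum_nonneg mult_nonneg_nonneg) auto

text \<open>Residual entries are at most \<open>2\<close>, so raising the weights raises the energy by no
  more than four times the growth of the squared total weight.\<close>
lemma energy_weight_increase:
  assumes R: "\<And>j k. j < N \<Longrightarrow> k < N \<Longrightarrow> \<bar>R j k\<bar> \<le> 2"
    and w: "\<And>j. j < N \<Longrightarrow> 0 \<le> \<omega> j" "\<And>j. j < N \<Longrightarrow> \<omega> j \<le> \<omega>' j"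
  shows "energy N \<omega>' R - 4 * (\<Sum>j<N. \<omega>' j)\<^sup>2 \<le> energy N \<omega> R - 4 * (\<Sum>j<N. \<omega> j)\<^sup>2"
proof -
  have e: "energy N v R - 4 * (\<Sum>j<N. v j)\<^sup>2 = (\<Sum>j<N. \<Sum>k<N. (v j * v k) * ((R j k)\<^sup>2 - 4))" for v
    unfolding energy_def power2_eq_square sum_product
    by (simp add: right_diff_distrib sum_subtractf sum_distrib_left mult.commute)
  have "(\<omega>' j * \<omega>' k) * ((R j k)\<^sup>2 - 4) \<le> (\<omega> j * \<omega> k) * ((R j k)\<^sup>2 - 4)"
    if "j < N" "k < N" for j k
  proof (rule mult_right_mono_neg)
    show "\<omega> j * \<omega> k \<le> \<omega>' j * \<omega>' k"
      using w(1)[OF that(1)] w(1)[OF that(2)] w(2)[OF that(1)] w(2)[OF that(2)] by (intro mult_mono) auto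
    have "\<bar>R j k\<bar>\<^sup>2 \<le> 2\<^sup>2" using R[OF that] by (intro power_mono) auto
    then show "(R j k)\<^sup>2 - 4 \<le> 0" by simp
  qed
  then show ?thesis unfolding e by (intro sum_mono) auto
qed

lemma refine_skew:
  assumes "skew N M"
  shows "skew N (refine N \<omega> M d d' \<rho>)"
proof (rule skewI)
  fix j k assume "j < N" "k < N"
  then have e: "M j k = - M k j" using assms skewD by blast
  have c: "clip (- x) = - clip x" for x unfolding clip_def by (simp add: max_def min_def)
  define a where "a = \<rho> / (wnorm2 N \<omega> d * wnorm2 N \<omega> d')"
  define t where "t = (d' k * d j - d k * d' j) / (\<omega> k * \<omega> j)"
  have t: "(d' j * d k - d j * d' k) / (\<omega> j * \<omega> k) = - t"
    unfolding t_def minus_divide_left by (simp add: mult.commute)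
  show "refine N \<omega> M d d' \<rho> j k = - refine N \<omega> M d d' \<rho> k j"
    unfolding refine_def t e a_def[symmetric] t_def[symmetric] c[symmetric] by simp
qed

lemma clip_bounded: "\<bar>clip x\<bar> \<le> 1"
  by (auto simp: clip_def abs_le_iff)

lemma refine_bounded: "\<bar>refine N \<omega> M d d' \<rho> j k\<bar> \<le> 1"
  unfolding refine_def by (rule clip_bounded)

lemma clip_closer: "\<bar>b\<bar> \<le> 1 \<Longrightarrow> (b - clip x)\<^sup>2 \<le> (b - x)\<^sup>2"
  unfolding abs_le_square_iff[symmetric] clip_def by (auto simp: max_def min_def)

text \<open>In the scalar product with weights \<open>\<omega>\<^sub>j \<omega>\<^sub>k\<close> the
  functional \<open>R \<mapsto> \<langle>R d, d'\<rangle>\<close> on skew matrices is represented by a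
  tensor whose squared norm is at most half the product of the squared norms of \<open>d\<close> and
  \<open>d'\<close>. Subtracting the matching multiple of that tensor lowers the energy as in an orthogonal
  projection.\<close>
lemma refine_energy:
  fixes B M :: "nat \<Rightarrow> nat \<Rightarrow> real"
  assumes B: "skew N B" "\<And>j k. j < N \<Longrightarrow> k < N \<Longrightarrow> \<bar>B j k\<bar> \<le> 1" and M: "skew N M"
    and w: "\<And>j. j < N \<Longrightarrow> 0 < \<omega> j" and d: "0 < wnorm2 N \<omega> d" "0 < wnorm2 N \<omega> d'"
    and rho: "\<rho> = ip N (mat_app N (\<lambda>j k. B j k - M j k) d) d'"
  shows "energy N \<omega> (\<lambda>j k. B j k - refine N \<omega> M d d' \<rho> j k)
    \<le> energy N \<omega> (\<lambda>j k. B j k - M j k) - 2 * \<rho>\<^sup>2 / (wnorm2 N \<omega> d * wnorm2 N \<omega> d')"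
proof -
  define R where "R j k = B j k - M j k" for j k
  define a where "a = wnorm2 N \<omega> d * wnorm2 N \<omega> d'"
  define D where "D j k = d' j * d k - d j * d' k" for j k
  define T where "T j k = D j k / (\<omega> j * \<omega> k)" for j k
  have a: "0 < a" unfolding a_def using d by simp
  have wn: "\<omega> j \<noteq> 0" if "j < N" for j using w[OF that] by simp
  have Rs: "R j k = - R k j" if "j < N" "k < N" for j k
    unfolding R_def using skewD[OF B(1) that] skewD[OF M that] by simp
  have cross: "(\<Sum>j<N. \<Sum>k<N. R j k * D j k) = 2 * \<rho>"
  proof -
    have r1: "(\<Sum>j<N. \<Sum>k<N. R j k * (d' j * d k)) = \<rho>"
      unfolding rho ip_def mat_app_def R_def sum_distrib_right by (intro sum.cong refl) (simp add: mult_ac)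
    have "(\<Sum>j<N. \<Sum>k<N. R j k * (d j * d' k)) = (\<Sum>k<N. \<Sum>j<N. R j k * (d j * d' k))"
      by (rule sum.swap)
    also have "\<dots> = (\<Sum>k<N. \<Sum>j<N. - (R k j * (d' k * d j)))"
    proof (intro sum.cong refl)
      fix k j assume "k \<in> {..<N}" "j \<in> {..<N}"
      then have e: "R j k = - R k j" using Rs by blast
      show "R j k * (d j * d' k) = - (R k j * (d' k * d j))" unfolding e by (simp add: mult.commute)
    qed
    also have "\<dots> = - \<rho>" using r1 by (simp add: sum_negf)
    finally have "(\<Sum>j<N. \<Sum>k<N. R j k * (d j * d' k)) = - \<rho>" .
    then show ?thesis using r1 by (simp add: D_def right_diff_distrib sum_subtractf)
  qed
  have size: "(\<Sum>j<N. \<Sum>k<N. (D j k)\<^sup>2 / (\<omega> j * \<omega> k)) \<le> 2 * a"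
  proof -
    define c where "c = (\<Sum>j<N. d j * d' j / \<omega> j)"
    have "(\<Sum>j<N. \<Sum>k<N. (D j k)\<^sup>2 / (\<omega> j * \<omega> k))
       = (\<Sum>j<N. \<Sum>k<N. ((d' j)\<^sup>2 / \<omega> j) * ((d k)\<^sup>2 / \<omega> k) + ((d j)\<^sup>2 / \<omega> j) * ((d' k)\<^sup>2 / \<omega> k)
            - 2 * ((d j * d' j / \<omega> j) * (d k * d' k / \<omega> k)))"
    proof (intro sum.cong refl)
      fix j k assume "j \<in> {..<N}" "k \<in> {..<N}"
      then have n: "\<omega> j \<noteq> 0" "\<omega> k \<noteq> 0" using wn by auto
      show "(D j k)\<^sup>2 / (\<omega> j * \<omega> k) = ((d' j)\<^sup>2 / \<omega> j) * ((d k)\<^sup>2 / \<omega> k) + ((d j)\<^sup>2 / \<omega> j) * ((d' k)\<^sup>2 / \<omega> k)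
            - 2 * ((d j * d' j / \<omega> j) * (d k * d' k / \<omega> k))"
        unfolding D_def using n by (simp add: field_simps power2_eq_square)
    qed
    also have "\<dots> = wnorm2 N \<omega> d' * wnorm2 N \<omega> d + wnorm2 N \<omega> d * wnorm2 N \<omega> d' - 2 * (c * c)"
      unfolding wnorm2_def c_def sum_product by (simp add: sum.distrib sum_subtractf sum_distrib_left)
    also have "\<dots> \<le> 2 * a" unfolding a_def by (simp add: mult.commute)
    finally show ?thesis .
  qed
  have "energy N \<omega> (\<lambda>j k. B j k - refine N \<omega> M d d' \<rho> j k) \<le> energy N \<omega> (\<lambda>j k. R j k - \<rho> / a * T j k)"
    unfolding energy_def
  proof (intro sum_mono mult_left_mono)
    fix j k assume jk: "j \<in> {..<N}" "k \<in> {..<N}"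
    have "(B j k - refine N \<omega> M d d' \<rho> j k)\<^sup>2 \<le> (B j k - (M j k + \<rho> / a * T j k))\<^sup>2"
      unfolding refine_def a_def[symmetric] D_def[symmetric] T_def[symmetric]
      using B(2) jk by (intro clip_closer) auto
    then show "(B j k - refine N \<omega> M d d' \<rho> j k)\<^sup>2 \<le> (R j k - \<rho> / a * T j k)\<^sup>2"
      by (simp add: R_def algebra_simps)
    show "0 \<le> \<omega> j * \<omega> k" using w jk by (simp add: less_imp_le)
  qed
  also have "\<dots> = (\<Sum>j<N. \<Sum>k<N. \<omega> j * \<omega> k * (R j k)\<^sup>2 - 2 * (\<rho> / a) * (R j k * D j k)
      + (\<rho> / a)\<^sup>2 * ((D j k)\<^sup>2 / (\<omega> j * \<omega> k)))"
    unfolding energy_def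
  proof (intro sum.cong refl)
    fix j k assume "j \<in> {..<N}" "k \<in> {..<N}"
    then have n: "\<omega> j * \<omega> k \<noteq> 0" using wn by auto
    define W where "W = \<omega> j * \<omega> k"
    define s where "s = \<rho> / a"
    have Wn: "W \<noteq> 0" using n by (simp add: W_def)
    have "W * (R j k - s * (D j k / W))\<^sup>2 = W * (R j k)\<^sup>2 - 2 * s * (R j k * D j k) + s\<^sup>2 * ((D j k)\<^sup>2 / W)"
      using Wn by (simp add: field_simps power2_eq_square)
    then show "\<omega> j * \<omega> k * (R j k - \<rho> / a * T j k)\<^sup>2 = \<omega> j * \<omega> k * (R j k)\<^sup>2 - 2 * (\<rho> / a) * (R j k * D j k)
      + (\<rho> / a)\<^sup>2 * ((D j k)\<^sup>2 / (\<omega> j * \<omega> k))"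
      by (simp add: T_def W_def s_def)
  qed
  also have "\<dots> = energy N \<omega> R - 2 * (\<rho> / a) * (\<Sum>j<N. \<Sum>k<N. R j k * D j k)
      + (\<rho> / a)\<^sup>2 * (\<Sum>j<N. \<Sum>k<N. (D j k)\<^sup>2 / (\<omega> j * \<omega> k))"
    unfolding energy_def by (simp add: sum.distrib sum_subtractf sum_distrib_left)
  also have "\<dots> \<le> energy N \<omega> R - 2 * (\<rho> / a) * (2 * \<rho>) + (\<rho> / a)\<^sup>2 * (2 * a)"
    unfolding cross using size by (intro add_left_mono mult_left_mono) auto
  also have "\<dots> = energy N \<omega> R - 2 * \<rho>\<^sup>2 / a" using a by (simp add: field_simps power2_eq_square)
  also have "R = (\<lambda>j k. B j k - M j k)" by (intro ext) (simp add: R_def)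
  finally show ?thesis by (simp add: a_def)
qed

context multilevel begin

definition jump :: "real \<Rightarrow> (nat \<Rightarrow> real) \<Rightarrow> (nat \<Rightarrow> real) \<Rightarrow> nat \<Rightarrow> real" where
  "jump \<eta> p r j = (if (1 + \<eta>) * r j < p j then p j else 0)"

lemma jump_mass:
  assumes "p \<in> Z" "r \<in> Z" "0 < \<eta>" "\<eta> \<le> 1"
  shows "(\<Sum>j<N. jump \<eta> p r j) \<le> 16 / \<eta>\<^sup>2 * hellinger N p r"
  unfolding hellinger_def sum_distrib_left
proof (rule sum_mono)
  fix j
  show "jump \<eta> p r j \<le> 16 / \<eta>\<^sup>2 * (sqrt (p j) - sqrt (r j))\<^sup>2"
    using hellinger_jump[OF Z_nonneg[OF assms(1)] Z_nonneg[OF assms(2)] assms(3,4), of j j]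
    by (cases "(1 + \<eta>) * r j < p j") (simp_all add: jump_def)
qed

lemma jump_mass_2:
  assumes "p \<in> Z" shows "(\<Sum>j<N. jump \<eta> p r j) \<le> 2"
proof -
  have "(\<Sum>j<N. jump \<eta> p r j) \<le> (\<Sum>j<N. p j)"
    unfolding jump_def using Z_nonneg[OF assms] by (intro sum_mono) auto
  then show ?thesis using Z_sum[OF assms] by simp
qed

lemma jump_nonneg: "p \<in> Z \<Longrightarrow> 0 \<le> jump \<eta> p r j"
  using Z_nonneg[of p j] by (simp add: jump_def)

lemma jump_cover:
  assumes "r j \<le> G" "0 \<le> G" "0 < \<eta>"
  shows "p j \<le> (1 + \<eta>) * G + jump \<eta> p r j"
proof (cases "(1 + \<eta>) * r j < p j")
  case True then show ?thesis using assms by (simp add: jump_def)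
next
  case False
  then have "p j \<le> (1 + \<eta>) * r j" by simp
  also have "\<dots> \<le> (1 + \<eta>) * G" using assms by (intro mult_left_mono) auto
  finally show ?thesis by (simp add: jump_def False)
qed

lemma anchor_block_start:
  "anchor w i (k div 2 ^ i * 2 ^ i) = anchor w i k"
  "anchor w (Suc i) (k div 2 ^ i * 2 ^ i) = anchor w (Suc i) k"
proof -
  have "(k div 2 ^ i * 2 ^ i) div 2 ^ i = k div 2 ^ i" by simp
  then show "anchor w i (k div 2 ^ i * 2 ^ i) = anchor w i k" by (simp add: anchor_def)
  have "x div 2 ^ Suc i = x div 2 ^ i div 2" for x :: nat
    unfolding power_Suc2 by (rule div_mult2_eq)
  then have "(k div 2 ^ i * 2 ^ i) div 2 ^ Suc i = k div 2 ^ Suc i" by simp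
  then show "anchor w (Suc i) (k div 2 ^ i * 2 ^ i) = anchor w (Suc i) k" by (simp only: anchor_def)
qed

text \<open>Passing from the blocks of length \<open>2\<^bsup>i+1\<^esup>\<close> to their halves, a
  coordinate grows by the factor \<open>1 + \<eta>\<close> or it jumps. For a complete block the jumps are
  paid for by averaging, over the iterates of the block, their Hellinger distances to both anchors. Only the
  last block can be incomplete, and it contributes at most its mass \<open>2\<close>.\<close>
lemma envelope_step:
  assumes w: "good w K" and eta: "0 < \<eta>" "\<eta> \<le> 1"
    and H: "(\<Sum>s<K. hellinger N (w s) (anchor w i s)) \<le> 2 ^ i * H"
      "(\<Sum>s<K. hellinger N (w s) (anchor w (Suc i) s)) \<le> 2 ^ Suc i * H"
    and G: "\<And>k j. k \<le> K \<Longrightarrow> j < N \<Longrightarrow> anchor w (Suc i) k j \<le> G j" "\<And>j. j < N \<Longrightarrow> z0 j \<le> G j"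
      "(\<Sum>j<N. G j) \<le> b"
  shows "\<exists>G'. (\<forall>k\<le>K. \<forall>j<N. anchor w i k j \<le> G' j) \<and> (\<forall>j<N. z0 j \<le> G' j)
     \<and> (\<Sum>j<N. G' j) \<le> (1 + \<eta>) * b + (2 + 96 * H / \<eta>\<^sup>2)"
proof -
  define Q where "Q = K div 2 ^ i"
  define p where "p q = anchor w i (q * 2 ^ i)" for q
  define r where "r q = anchor w (Suc i) (q * 2 ^ i)" for q
  define G' where "G' j = (1 + \<eta>) * G j + (\<Sum>q\<le>Q. jump \<eta> (p q) (r q) j)" for j
  have qK: "q * 2 ^ i \<le> K" if "q \<le> Q" for q
  proof -
    have "q * 2 ^ i \<le> Q * 2 ^ i" using that by simp
    also have "\<dots> \<le> K" unfolding Q_def by simp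
    finally show ?thesis .
  qed
  have pZ: "p q \<in> Z" if "q \<le> Q" for q unfolding p_def using w qK[OF that] by (rule anchor_Z)
  have rZ: "r q \<in> Z" if "q \<le> Q" for q unfolding r_def using w qK[OF that] by (rule anchor_Z)
  have G0: "0 \<le> G j" if "j < N" for j using G(2)[OF that] z0_pos[OF that] by linarith
  have cover: "anchor w i k j \<le> G' j" if k: "k \<le> K" and j: "j < N" for k j
  proof -
    define q where "q = k div 2 ^ i"
    have q: "q \<le> Q" unfolding q_def Q_def using k by (rule div_le_mono)
    have "anchor w i k j = p q j" unfolding p_def q_def anchor_block_start ..
    also have "\<dots> \<le> (1 + \<eta>) * G j + jump \<eta> (p q) (r q) j"
      using G(1)[OF qK[OF q] j] G0[OF j] eta(1) unfolding r_def by (rule jump_cover)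
    also have "jump \<eta> (p q) (r q) j \<le> (\<Sum>q\<le>Q. jump \<eta> (p q) (r q) j)"
      using q pZ by (intro member_le_sum) (auto intro: jump_nonneg)
    finally show ?thesis by (simp add: G'_def)
  qed
  have zG: "z0 j \<le> G' j" if j: "j < N" for j
  proof -
    have "1 * G j \<le> (1 + \<eta>) * G j" using eta G0[OF j] by (intro mult_right_mono) auto
    moreover have "0 \<le> (\<Sum>q\<le>Q. jump \<eta> (p q) (r q) j)" using pZ by (intro sum_nonneg jump_nonneg) auto
    ultimately show ?thesis using G(2)[OF j] by (simp add: G'_def)
  qed
  define f where "f s = 2 * hellinger N (w s) (anchor w i s) + 2 * hellinger N (w s) (anchor w (Suc i) s)" for s
  have block: "(\<Sum>j<N. jump \<eta> (p q) (r q) j) \<le> 16 / \<eta>\<^sup>2 / 2 ^ i * (\<Sum>s = q * 2 ^ i..<q * 2 ^ i + 2 ^ i. f s)"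
    if q: "q < Q" for q
  proof -
    have "hellinger N (p q) (r q) \<le> f s" if s: "s \<in> {q * 2 ^ i..<q * 2 ^ i + 2 ^ i}" for s
    proof -
      have "s div 2 ^ i = q"
        by (rule div_nat_eqI) (use s in \<open>auto simp: mult.commute\<close>)
      then have "p q = anchor w i s" "r q = anchor w (Suc i) s"
        unfolding p_def r_def using anchor_block_start[of w i s] by auto
      then show ?thesis
        using hellinger_triangle[of N "p q" "r q" "w s"] hellinger_commute[of N "p q" "w s"] by (simp add: f_def)
    qed
    then have "(\<Sum>s = q * 2 ^ i..<q * 2 ^ i + 2 ^ i. hellinger N (p q) (r q)) \<le> (\<Sum>s = q * 2 ^ i..<q * 2 ^ i + 2 ^ i. f s)"
      by (rule sum_mono)
    then have "hellinger N (p q) (r q) \<le> (\<Sum>s = q * 2 ^ i..<q * 2 ^ i + 2 ^ i. f s) / 2 ^ i"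
      by (simp add: field_simps)
    then have "16 / \<eta>\<^sup>2 * hellinger N (p q) (r q) \<le> 16 / \<eta>\<^sup>2 * ((\<Sum>s = q * 2 ^ i..<q * 2 ^ i + 2 ^ i. f s) / 2 ^ i)"
      by (intro mult_left_mono) auto
    then show ?thesis using jump_mass[OF pZ rZ eta, of q q] q by simp
  qed
  have "(\<Sum>q\<le>Q. \<Sum>j<N. jump \<eta> (p q) (r q) j) = (\<Sum>q<Q. \<Sum>j<N. jump \<eta> (p q) (r q) j) + (\<Sum>j<N. jump \<eta> (p Q) (r Q) j)"
    by (simp add: lessThan_Suc_atMost[symmetric])
  also have "\<dots> \<le> (\<Sum>q<Q. 16 / \<eta>\<^sup>2 / 2 ^ i * (\<Sum>s = q * 2 ^ i..<q * 2 ^ i + 2 ^ i. f s)) + 2"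
    using block pZ by (intro add_mono sum_mono jump_mass_2) auto
  also have "(\<Sum>q<Q. 16 / \<eta>\<^sup>2 / 2 ^ i * (\<Sum>s = q * 2 ^ i..<q * 2 ^ i + 2 ^ i. f s)) = 16 / \<eta>\<^sup>2 / 2 ^ i * (\<Sum>s<Q * 2 ^ i. f s)"
    unfolding sum_distrib_left[symmetric] by (simp add: sum.nat_group)
  also have "\<dots> \<le> 16 / \<eta>\<^sup>2 / 2 ^ i * (2 * (2 ^ i * H) + 2 * (2 ^ Suc i * H))"
  proof (intro mult_left_mono)
    have "(\<Sum>s<Q * 2 ^ i. f s) \<le> (\<Sum>s<K. f s)"
      using qK[of Q] by (intro sum_mono2) (auto simp: f_def hellinger_nonneg)
    then show "(\<Sum>s<Q * 2 ^ i. f s) \<le> 2 * (2 ^ i * H) + 2 * (2 ^ Suc i * H)"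
      using H unfolding f_def sum.distrib sum_distrib_left[symmetric] by linarith
  qed auto
  also have "\<dots> = 96 * H / \<eta>\<^sup>2" by (simp add: field_simps)
  finally have X: "(\<Sum>q\<le>Q. \<Sum>j<N. jump \<eta> (p q) (r q) j) \<le> 2 + 96 * H / \<eta>\<^sup>2" by simp
  have "(\<Sum>j<N. G' j) = (1 + \<eta>) * (\<Sum>j<N. G j) + (\<Sum>q\<le>Q. \<Sum>j<N. jump \<eta> (p q) (r q) j)"
    unfolding G'_def by (simp add: sum.distrib sum_distrib_left sum.swap[of _ "{..<N}" "{..Q}"])
  also have "\<dots> \<le> (1 + \<eta>) * b + (2 + 96 * H / \<eta>\<^sup>2)"
    using X G(3) eta by (intro add_mono mult_left_mono) auto
  finally show ?thesis using cover zG by blast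
qed

text \<open>Descending from the uniform point at level \<open>I\<close> to the iterates takes \<open>I +
  1\<close> steps. With \<open>\<eta> = 1 / (I + 1)\<close> the factors multiply to at most \<open>e \<le>
  3\<close>.\<close>
lemma envelope:
  assumes w: "good w K" and K: "K < 2 ^ I"
    and H: "\<And>i. i \<le> I \<Longrightarrow> (\<Sum>s<K. hellinger N (w s) (anchor w i s)) \<le> 2 ^ i * H"
  shows "\<exists>S. (\<forall>s<K. \<forall>j<N. w s j \<le> S j) \<and> (\<forall>j<N. z0 j \<le> S j)
     \<and> (\<Sum>j<N. S j) \<le> 3 * (2 + real (I + 1) * (2 + 96 * H * (real (I + 1))\<^sup>2))"
proof -
  define \<eta> where "\<eta> = 1 / real (I + 1)"
  define X where "X = 2 + 96 * H / \<eta>\<^sup>2"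
  have eta: "0 < \<eta>" "\<eta> \<le> 1" by (auto simp: \<eta>_def)
  have H0: "0 \<le> H"
    using H[of 0] sum_nonneg[of "{..<K}" "\<lambda>s. hellinger N (w s) (anchor w 0 s)"] hellinger_nonneg by simp
  have X2: "2 \<le> X" using H0 by (simp add: X_def)
  have level: "d \<le> I \<Longrightarrow> \<exists>G. (\<forall>k\<le>K. \<forall>j<N. anchor w (I - d) k j \<le> G j) \<and> (\<forall>j<N. z0 j \<le> G j)
     \<and> (\<Sum>j<N. G j) \<le> (1 + \<eta>) ^ d * (2 + real d * X)" for d
  proof (induction d)
    case 0
    have "anchor w I k = z0" if "k \<le> K" for k using that K by (simp add: anchor_def)
    then show ?case using Z_sum[OF z0_Z] by (intro exI[of _ z0]) auto
  next
    case (Suc d)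
    then obtain G where G: "\<And>k j. k \<le> K \<Longrightarrow> j < N \<Longrightarrow> anchor w (I - d) k j \<le> G j" "\<And>j. j < N \<Longrightarrow> z0 j \<le> G j"
      "(\<Sum>j<N. G j) \<le> (1 + \<eta>) ^ d * (2 + real d * X)" by auto
    have i: "I - d = Suc (I - Suc d)" using Suc.prems by simp
    obtain G' where G': "\<forall>k\<le>K. \<forall>j<N. anchor w (I - Suc d) k j \<le> G' j" "\<forall>j<N. z0 j \<le> G' j"
      "(\<Sum>j<N. G' j) \<le> (1 + \<eta>) * ((1 + \<eta>) ^ d * (2 + real d * X)) + (2 + 96 * H / \<eta>\<^sup>2)"
      using envelope_step[where i="I - Suc d" and G=G and b="(1 + \<eta>) ^ d * (2 + real d * X)",
          OF w eta H[of "I - Suc d"] H[of "Suc (I - Suc d)"] G[unfolded i]] Suc.prems i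
      by (metis Suc_leD diff_le_self)
    have "1 * X \<le> (1 + \<eta>) ^ Suc d * X"
      using eta X2 by (intro mult_right_mono one_le_power) auto
    then have "(\<Sum>j<N. G' j) \<le> (1 + \<eta>) ^ Suc d * (2 + real (Suc d) * X)"
      using G'(3) unfolding X_def[symmetric] by (simp add: algebra_simps)
    then show ?case using G' by blast
  qed
  obtain G where G: "\<And>k j. k \<le> K \<Longrightarrow> j < N \<Longrightarrow> anchor w 0 k j \<le> G j" "\<And>j. j < N \<Longrightarrow> z0 j \<le> G j"
    "(\<Sum>j<N. G j) \<le> (1 + \<eta>) ^ I * (2 + real I * X)" using level[of I] by auto
  define S where "S j = (1 + \<eta>) * G j + (\<Sum>s<K. jump \<eta> (w s) (anchor w 0 s) j)" for j
  have wZ: "w s \<in> Z" if "s < K" for s using w that by (simp add: good_def)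
  have G0: "0 \<le> G j" if "j < N" for j using G(2)[OF that] z0_pos[OF that] by linarith
  have e0: "0 \<le> (\<Sum>s<K. jump \<eta> (w s) (anchor w 0 s) j)" for j using wZ by (intro sum_nonneg jump_nonneg) auto
  have "w s j \<le> S j" if s: "s < K" and j: "j < N" for s j
  proof -
    have "w s j \<le> (1 + \<eta>) * G j + jump \<eta> (w s) (anchor w 0 s) j"
      using G(1)[of s j] G0[OF j] eta(1) s j by (intro jump_cover) auto
    also have "jump \<eta> (w s) (anchor w 0 s) j \<le> (\<Sum>s<K. jump \<eta> (w s) (anchor w 0 s) j)"
      using s wZ by (intro member_le_sum) (auto intro: jump_nonneg)
    finally show ?thesis by (simp add: S_def)
  qed
  moreover have "z0 j \<le> S j" if j: "j < N" for j
  proof -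
    have "1 * G j \<le> (1 + \<eta>) * G j" using eta G0[OF j] by (intro mult_right_mono) auto
    then show ?thesis using G(2)[OF j] e0[of j] by (simp add: S_def)
  qed
  moreover have "(\<Sum>j<N. S j) \<le> 3 * (2 + real (I + 1) * (2 + 96 * H * (real (I + 1))\<^sup>2))"
  proof -
    have "(\<Sum>j<N. \<Sum>s<K. jump \<eta> (w s) (anchor w 0 s) j) = (\<Sum>s<K. \<Sum>j<N. jump \<eta> (w s) (anchor w 0 s) j)"
      by (rule sum.swap)
    also have "\<dots> \<le> (\<Sum>s<K. 16 / \<eta>\<^sup>2 * hellinger N (w s) (anchor w 0 s))"
      using eta by (intro sum_mono jump_mass wZ anchor_Z[OF w]) auto
    also have "\<dots> \<le> 16 / \<eta>\<^sup>2 * (2 ^ 0 * H)"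
      unfolding sum_distrib_left[symmetric] using H[of 0] by (intro mult_left_mono) auto
    also have "\<dots> \<le> X"
    proof -
      have "16 * H / \<eta>\<^sup>2 \<le> 96 * H / \<eta>\<^sup>2" using H0 by (intro divide_right_mono) auto
      then show ?thesis by (simp add: X_def)
    qed
    finally have e: "(\<Sum>j<N. \<Sum>s<K. jump \<eta> (w s) (anchor w 0 s) j) \<le> X" .
    have "(\<Sum>j<N. S j) = (1 + \<eta>) * (\<Sum>j<N. G j) + (\<Sum>j<N. \<Sum>s<K. jump \<eta> (w s) (anchor w 0 s) j)"
      unfolding S_def by (simp add: sum.distrib sum_distrib_left)
    also have "\<dots> \<le> (1 + \<eta>) * ((1 + \<eta>) ^ I * (2 + real I * X)) + (1 + \<eta>) ^ Suc I * X"
    proof (intro add_mono mult_left_mono)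
      have "1 * X \<le> (1 + \<eta>) ^ Suc I * X"
        using eta X2 by (intro mult_right_mono one_le_power) auto
      then show "(\<Sum>j<N. \<Sum>s<K. jump \<eta> (w s) (anchor w 0 s) j) \<le> (1 + \<eta>) ^ Suc I * X" using e by linarith
    qed (use G eta in auto)
    also have "\<dots> = (1 + \<eta>) ^ Suc I * (2 + real (I + 1) * X)" by (simp add: algebra_simps)
    also have "\<dots> \<le> 3 * (2 + real (I + 1) * X)"
    proof (rule mult_right_mono)
      have "(1 + \<eta>) ^ Suc I \<le> exp \<eta> ^ Suc I"
        using eta exp_ge_add_one_self[of \<eta>] by (intro power_mono) auto
      also have "\<dots> = exp (real (Suc I) * \<eta>)" by (simp only: exp_of_nat_mult)
      also have "real (Suc I) * \<eta> = 1" by (simp add: \<eta>_def)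
      also have "exp (1::real) \<le> 3" by (rule exp_le)
      finally show "(1 + \<eta>) ^ Suc I \<le> 3" .
    qed (use X2 in auto)
    also have "X = 2 + 96 * H * (real (I + 1))\<^sup>2" by (simp add: X_def \<eta>_def power_divide)
    finally show ?thesis .
  qed
  ultimately show ?thesis by blast
qed

end

section \<open>One step of the method and its regret\<close>

text \<open>The state between two trials: the number of accepted steps, the accepted iterates, the sum of
  the step lengths, the sum of the trial points weighted by step length, the weights
  \<open>\<omega>\<close>, the model \<open>M\<close>, and the image under \<open>B\<close> of the last
  accepted iterate.\<close>
datatype core = Core (steps: nat) (iter: "nat \<Rightarrow> nat \<Rightarrow> real") (time: real) (total: "nat \<Rightarrow> real")
  (weight: "nat \<Rightarrow> real") (model: "nat \<Rightarrow> nat \<Rightarrow> real") (image: "nat \<Rightarrow> real")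

text \<open>Adding the whole excess of \<open>v\<close>, rather than an eighth of it, is more than is needed
  to cover \<open>v\<close> by \<open>8 \<omega>\<close>, and it lets the growth of the total weight be read
  off from excesses.\<close>
definition inject :: "(nat \<Rightarrow> real) \<Rightarrow> (nat \<Rightarrow> real) \<Rightarrow> nat \<Rightarrow> real" where
  "inject \<omega> v j = \<omega> j + max 0 (v j - 8 * \<omega> j)"

lemma inject_ge: "\<omega> j \<le> inject \<omega> v j" by (simp add: inject_def)

lemma inject_covers: "0 \<le> \<omega> j \<Longrightarrow> v j \<le> 8 * inject \<omega> v j"
  by (simp add: inject_def max_def)

lemma wnorm2_pos:
  assumes "\<And>j. j < N \<Longrightarrow> 0 < \<omega> j" "j < N" "d j \<noteq> 0"
  shows "0 < wnorm2 N \<omega> d"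
proof -
  have "0 < (d j)\<^sup>2 / \<omega> j" using assms by simp
  also have "\<dots> \<le> wnorm2 N \<omega> d" unfolding wnorm2_def
    using assms by (intro member_le_sum) (auto simp: less_imp_le)
  finally show ?thesis .
qed

locale scheme = multilevel +
  fixes \<theta> :: real
  assumes theta_pos: "0 < \<theta>"
begin

definition base :: "core \<Rightarrow> nat \<Rightarrow> real" where
  "base \<sigma> = anchor (iter \<sigma>) 0 (steps \<sigma>)"

definition ctr :: "core \<Rightarrow> nat \<Rightarrow> real" where
  "ctr \<sigma> = geo (iter \<sigma>) (steps \<sigma>)"

definition offset :: "core \<Rightarrow> nat \<Rightarrow> real" where
  "offset \<sigma> j = image \<sigma> j - mat_app N (model \<sigma>) (base \<sigma>) j"

text \<open>The trial point: an exact proximal step in which \<open>B\<close> is replaced by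
  \<open>M\<close> on the displacement from the base point.\<close>
definition is_probe :: "core \<Rightarrow> real \<times> (nat \<Rightarrow> real) \<Rightarrow> bool" where
  "is_probe \<sigma> = (\<lambda>(\<tau>, z). 0 < \<tau> \<and> \<tau> \<le> 1 \<and>
     z = gibbs (ctr \<sigma>) (\<lambda>j. \<tau> / Gam * (mat_app N (model \<sigma>) z j + offset \<sigma> j)) \<and>
     excess (weight \<sigma>) z \<le> \<theta> \<and> (\<tau> = 1 \<or> excess (weight \<sigma>) z = \<theta>))"

definition probe :: "core \<Rightarrow> real \<times> (nat \<Rightarrow> real)" where
  "probe \<sigma> = (SOME p. is_probe \<sigma> p)"

text \<open>The second half of an extragradient step: it uses the true force \<open>a\<close> at the trial
  point, and its length may be shortened further.\<close>
definition is_corrector :: "core \<Rightarrow> (nat \<Rightarrow> real) \<Rightarrow> real \<times> (nat \<Rightarrow> real) \<Rightarrow> bool" where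
  "is_corrector \<sigma> a = (\<lambda>(\<tau>, w). 0 < \<tau> \<and> \<tau> \<le> fst (probe \<sigma>) \<and>
     w = gibbs (ctr \<sigma>) (\<lambda>j. \<tau> / Gam * a j) \<and>
     excess (weight \<sigma>) w \<le> \<theta> \<and> (\<tau> = fst (probe \<sigma>) \<or> excess (weight \<sigma>) w = \<theta>))"

definition corrector :: "core \<Rightarrow> (nat \<Rightarrow> real) \<Rightarrow> real \<times> (nat \<Rightarrow> real)" where
  "corrector \<sigma> a = (SOME p. is_corrector \<sigma> a p)"

text \<open>The error of the predicted force, which equals \<open>R\<close> applied to the displacement of
  the trial point from the base point.\<close>
definition surprise :: "core \<Rightarrow> (nat \<Rightarrow> real) \<Rightarrow> nat \<Rightarrow> real" where
  "surprise \<sigma> a j = a j - (mat_app N (model \<sigma>) (snd (probe \<sigma>)) j + offset \<sigma> j)"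

definition misfit :: "core \<Rightarrow> (nat \<Rightarrow> real) \<Rightarrow> real" where
  "misfit \<sigma> a = ip N (surprise \<sigma> a) (\<lambda>j. snd (probe \<sigma>) j - snd (corrector \<sigma> a) j)"

text \<open>The error exceeds what the negative divergence terms of the regret identity can absorb.
  Otherwise the step is as good as a step with \<open>B\<close>.\<close>
definition guilty :: "core \<Rightarrow> (nat \<Rightarrow> real) \<Rightarrow> bool" where
  "guilty \<sigma> a \<longleftrightarrow> (Gam * kl N (snd (corrector \<sigma> a)) (snd (probe \<sigma>)) + \<gamma> * kl N (snd (probe \<sigma>)) (base \<sigma>)) / 2
      < fst (probe \<sigma>) * misfit \<sigma> a"

definition learn :: "core \<Rightarrow> (nat \<Rightarrow> real) \<Rightarrow> core" where
  "learn \<sigma> a = (let z = snd (probe \<sigma>); w = snd (corrector \<sigma> a);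
      \<omega> = inject (inject (weight \<sigma>) z) w in
    Core (steps \<sigma>) (iter \<sigma>) (time \<sigma>) (total \<sigma>) \<omega>
      (refine N \<omega> (model \<sigma>) (\<lambda>j. z j - base \<sigma> j) (\<lambda>j. z j - w j) (misfit \<sigma> a)) (image \<sigma>))"

text \<open>The next centre may lie outside the covered region, so it is injected at once; then the trials
  of the next step start without excess.\<close>
definition advance :: "core \<Rightarrow> (nat \<Rightarrow> real) \<Rightarrow> (nat \<Rightarrow> real) \<Rightarrow> core" where
  "advance \<sigma> a a' = (let z = snd (probe \<sigma>); \<tau> = fst (corrector \<sigma> a); w = snd (corrector \<sigma> a);
      it = (iter \<sigma>)(steps \<sigma> := w) in
    Core (Suc (steps \<sigma>)) it (time \<sigma> + \<tau>) (\<lambda>j. total \<sigma> j + \<tau> * z j)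
      (inject (\<lambda>j. max (weight \<sigma> j) (w j)) (gibbs (geo it (Suc (steps \<sigma>))) (\<lambda>j. 0)))
      (model \<sigma>) a')"

definition start :: "(nat \<Rightarrow> real) \<Rightarrow> core" where
  "start a = Core 0 (\<lambda>s. z0) 0 (\<lambda>j. 0) z0 (\<lambda>j k. 0) a"

lemma excess_le_hellinger:
  assumes "\<And>j. j < N \<Longrightarrow> 0 \<le> v j" "\<And>j. j < N \<Longrightarrow> 0 \<le> b j" "\<And>j. j < N \<Longrightarrow> b j \<le> \<omega> j"
  shows "excess \<omega> v \<le> 4 * hellinger N v b"
  unfolding excess_def hellinger_def sum_distrib_left
proof (rule sum_mono)
  fix j assume "j \<in> {..<N}"
  then have j: "0 \<le> v j" "0 \<le> b j" "b j \<le> \<omega> j" using assms by auto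
  show "max 0 (v j - 8 * \<omega> j) \<le> 4 * (sqrt (v j) - sqrt (b j))\<^sup>2"
  proof (cases "v j \<le> 8 * \<omega> j")
    case True then show ?thesis by simp
  next
    case False
    then have "4 * b j \<le> v j" using j by linarith
    then have "sqrt (4 * b j) \<le> sqrt (v j)" by simp
    then have "2 * sqrt (b j) \<le> sqrt (v j)" by (simp add: real_sqrt_mult)
    then have "(sqrt (v j))\<^sup>2 \<le> (2 * (sqrt (v j) - sqrt (b j)))\<^sup>2"
      using j by (intro power_mono) auto
    then have "v j \<le> 4 * (sqrt (v j) - sqrt (b j))\<^sup>2"
      using j(1) by (simp only: power_mult_distrib) simp
    then show ?thesis using j False by simp
  qed
qed

lemma excess_antimono: "(\<And>j. j < N \<Longrightarrow> \<omega> j \<le> \<omega>' j) \<Longrightarrow> excess \<omega>' v \<le> excess \<omega> v"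
  unfolding excess_def by (intro sum_mono max.mono diff_left_mono mult_left_mono) auto

end

locale game = scheme +
  fixes B :: "nat \<Rightarrow> nat \<Rightarrow> real"
  assumes B_skew: "skew N B" and B_bounded: "\<And>j k. j < N \<Longrightarrow> k < N \<Longrightarrow> \<bar>B j k\<bar> \<le> 1"
begin

definition consistent :: "core \<Rightarrow> bool" where
  "consistent \<sigma> \<longleftrightarrow> good (iter \<sigma>) (steps \<sigma>)
    \<and> (\<forall>j<N. z0 j \<le> weight \<sigma> j \<and> (\<forall>s<steps \<sigma>. iter \<sigma> s j \<le> weight \<sigma> j) \<and> gibbs (ctr \<sigma>) (\<lambda>j. 0) j \<le> 8 * weight \<sigma> j)
    \<and> skew N (model \<sigma>) \<and> (\<forall>j<N. \<forall>k<N. \<bar>model \<sigma> j k\<bar> \<le> 1)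
    \<and> (\<forall>j<N. image \<sigma> j = mat_app N B (base \<sigma>) j)"

definition energy_bound :: "core \<Rightarrow> nat \<Rightarrow> bool" where
  "energy_bound \<sigma> g \<longleftrightarrow> energy N (weight \<sigma>) (\<lambda>j k. B j k - model \<sigma> j k) + real g * \<gamma>\<^sup>2 / 512
     \<le> 4 * (\<Sum>j<N. weight \<sigma> j)\<^sup>2"

text \<open>\<open>ls s\<close> is what the accepted step \<open>s\<close> gains beyond the telescoping
  terms. It pays for the Hellinger distances of the iterate to its anchors and for the step length that was
  lost by shortening.\<close>
definition regret_bound :: "core \<Rightarrow> (nat \<Rightarrow> real) \<Rightarrow> bool" where
  "regret_bound \<sigma> ls \<longleftrightarrow>
     (\<forall>s<steps \<sigma>. 0 \<le> ls s \<and> (\<Sum>i\<le>I. gam i * hellinger N (iter \<sigma> s) (anchor (iter \<sigma>) i s)) \<le> 4 * ls s)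
   \<and> (\<forall>u\<in>Z. - ip N (mat_app N B (total \<sigma>)) u + (\<Sum>s<steps \<sigma>. ls s)
        \<le> (\<Sum>s<steps \<sigma>. Kreg (iter \<sigma>) s u - Gam * kl N u (iter \<sigma> s)))
   \<and> real (steps \<sigma>) \<le> time \<sigma> + 16 / (\<gamma> * \<theta>) * (\<Sum>s<steps \<sigma>. ls s)
   \<and> (0 < steps \<sigma> \<longrightarrow> 0 < time \<sigma>) \<and> 0 \<le> time \<sigma>
   \<and> (\<forall>j. 0 \<le> total \<sigma> j) \<and> (\<forall>j\<ge>N. total \<sigma> j = 0)
   \<and> (\<Sum>j<n. total \<sigma> j) = time \<sigma> \<and> (\<Sum>j=n..<N. total \<sigma> j) = time \<sigma>"

text \<open>Besides an envelope \<open>S\<close> of the iterates the weights contain injected mass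
  \<open>h\<close>: at most \<open>2 \<theta>\<close> per correction, and the injected centres. A centre
  with excess comes with large slack and is paid for by the loss of its step; \<open>p\<close> is the share
  of the current centre, whose step is still to be accepted.\<close>
definition weight_bound :: "core \<Rightarrow> nat \<Rightarrow> (nat \<Rightarrow> real) \<Rightarrow> bool" where
  "weight_bound \<sigma> g ls \<longleftrightarrow> (\<exists>h p. (\<forall>j<N. 0 \<le> h j) \<and> 0 \<le> p \<and> p \<le> 2 \<and> (p = 0 \<or> \<gamma> / 2 \<le> slack (iter \<sigma>) (steps \<sigma>))
   \<and> (\<Sum>j<N. h j) \<le> 2 * \<theta> * real g + 8 / \<gamma> * (\<Sum>s<steps \<sigma>. ls s) + p
   \<and> (\<forall>S. (\<forall>j<N. z0 j \<le> S j) \<longrightarrow> (\<forall>s<steps \<sigma>. \<forall>j<N. iter \<sigma> s j \<le> S j) \<longrightarrow> (\<forall>j<N. weight \<sigma> j \<le> S j + h j)))"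

definition invariant :: "core \<Rightarrow> nat \<Rightarrow> bool" where
  "invariant \<sigma> g \<longleftrightarrow> consistent \<sigma> \<and> energy_bound \<sigma> g \<and> (\<exists>ls. regret_bound \<sigma> ls \<and> weight_bound \<sigma> g ls)"

lemma base_pos: "consistent \<sigma> \<Longrightarrow> j < N \<Longrightarrow> 0 < base \<sigma> j"
  unfolding base_def consistent_def by (auto intro: anchor_pos)

lemma base_le_weight: "consistent \<sigma> \<Longrightarrow> j < N \<Longrightarrow> base \<sigma> j \<le> weight \<sigma> j"
  unfolding base_def consistent_def by (intro anchor_le[where K="steps \<sigma>"]) auto

lemma weight_pos: "consistent \<sigma> \<Longrightarrow> j < N \<Longrightarrow> 0 < weight \<sigma> j"
  using base_pos[of \<sigma> j] base_le_weight[of \<sigma> j] by linarith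

lemma ctr_pos: "0 < ctr \<sigma> j" by (simp add: ctr_def geo_pos)

lemma probe_props:
  assumes "consistent \<sigma>"
  defines "\<tau> \<equiv> fst (probe \<sigma>)" and "z \<equiv> snd (probe \<sigma>)"
  shows "0 < \<tau>" "\<tau> \<le> 1" "z = gibbs (ctr \<sigma>) (\<lambda>j. \<tau> / Gam * (mat_app N (model \<sigma>) z j + offset \<sigma> j))"
    "excess (weight \<sigma>) z \<le> \<theta>" "\<tau> = 1 \<or> excess (weight \<sigma>) z = \<theta>" "z \<in> Z" "\<And>j. j < N \<Longrightarrow> 0 < z j"
proof -
  have "\<exists>\<tau> z. is_probe \<sigma> (\<tau>, z)"
    unfolding is_probe_def prod.case using assms(1) ctr_pos theta_pos
    by (intro probe_exists) (auto simp: consistent_def)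
  then have "is_probe \<sigma> (probe \<sigma>)" unfolding probe_def by (metis someI_ex)
  then have p: "0 < \<tau> \<and> \<tau> \<le> 1 \<and> z = gibbs (ctr \<sigma>) (\<lambda>j. \<tau> / Gam * (mat_app N (model \<sigma>) z j + offset \<sigma> j)) \<and>
     excess (weight \<sigma>) z \<le> \<theta> \<and> (\<tau> = 1 \<or> excess (weight \<sigma>) z = \<theta>)"
    unfolding is_probe_def \<tau>_def z_def case_prod_beta .
  then show "0 < \<tau>" "\<tau> \<le> 1" "excess (weight \<sigma>) z \<le> \<theta>" "\<tau> = 1 \<or> excess (weight \<sigma>) z = \<theta>" by blast+
  from p show zz: "z = gibbs (ctr \<sigma>) (\<lambda>j. \<tau> / Gam * (mat_app N (model \<sigma>) z j + offset \<sigma> j))" by blast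
  show "z \<in> Z" by (subst zz) (rule gibbs_Z, rule ctr_pos)
  show "0 < z j" if "j < N" for j by (subst zz) (rule gibbs_pos, rule ctr_pos, rule that)
qed

lemma corrector_props:
  fixes a :: "nat \<Rightarrow> real"
  assumes "consistent \<sigma>"
  defines "\<tau> \<equiv> fst (corrector \<sigma> a)" and "w \<equiv> snd (corrector \<sigma> a)"
  shows "0 < \<tau>" "\<tau> \<le> fst (probe \<sigma>)" "w = gibbs (ctr \<sigma>) (\<lambda>j. \<tau> / Gam * a j)"
    "excess (weight \<sigma>) w \<le> \<theta>" "\<tau> = fst (probe \<sigma>) \<or> excess (weight \<sigma>) w = \<theta>" "w \<in> Z" "\<And>j. j < N \<Longrightarrow> 0 < w j"
proof -
  have "\<exists>\<tau> w. is_corrector \<sigma> a (\<tau>, w)"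
    unfolding is_corrector_def prod.case using assms(1) ctr_pos theta_pos probe_props(1)[OF assms(1)]
    by (intro corrector_exists) (auto simp: consistent_def)
  then have "is_corrector \<sigma> a (corrector \<sigma> a)" unfolding corrector_def by (metis someI_ex)
  then have p: "0 < \<tau> \<and> \<tau> \<le> fst (probe \<sigma>) \<and> w = gibbs (ctr \<sigma>) (\<lambda>j. \<tau> / Gam * a j) \<and>
     excess (weight \<sigma>) w \<le> \<theta> \<and> (\<tau> = fst (probe \<sigma>) \<or> excess (weight \<sigma>) w = \<theta>)"
    unfolding is_corrector_def \<tau>_def w_def case_prod_beta .
  then show "0 < \<tau>" "\<tau> \<le> fst (probe \<sigma>)" "excess (weight \<sigma>) w \<le> \<theta>" "\<tau> = fst (probe \<sigma>) \<or> excess (weight \<sigma>) w = \<theta>" by blast+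
  from p show ww: "w = gibbs (ctr \<sigma>) (\<lambda>j. \<tau> / Gam * a j)" by blast
  show "w \<in> Z" by (subst ww) (rule gibbs_Z, rule ctr_pos)
  show "0 < w j" if "j < N" for j by (subst ww) (rule gibbs_pos, rule ctr_pos, rule that)
qed

text \<open>The part of the divergences in the regret identity that remains after the error of the
  prediction has been absorbed.\<close>
definition loss :: "core \<Rightarrow> (nat \<Rightarrow> real) \<Rightarrow> real" where
  "loss \<sigma> a = (let z = snd (probe \<sigma>); w = snd (corrector \<sigma> a); r = fst (corrector \<sigma> a) / fst (probe \<sigma>);
      R = Kreg (iter \<sigma>) (steps \<sigma>) in
     ((1 - r) * R w + r * (Gam * kl N w z + R z)) / 2)"

lemma Kreg_ge_base:
  assumes "consistent \<sigma>" "u \<in> Z"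
  shows "\<gamma> * kl N u (base \<sigma>) \<le> Kreg (iter \<sigma>) (steps \<sigma>) u"
proof -
  have "0 \<le> kl N u (anchor (iter \<sigma>) i (steps \<sigma>))" for i
    using assms Z_nonneg[OF assms(2)] by (intro kl_nonneg) (auto simp: consistent_def intro: anchor_pos)
  then have "gam 0 * kl N u (anchor (iter \<sigma>) 0 (steps \<sigma>)) \<le> Kreg (iter \<sigma>) (steps \<sigma>) u"
    unfolding Kreg_def using gam_pos
    by (intro member_le_sum[where f="\<lambda>i. gam i * kl N u (anchor (iter \<sigma>) i (steps \<sigma>))"]) (auto simp: less_imp_le)
  then show ?thesis by (simp add: gam_def base_def)
qed

lemma ip_cong: "(\<And>j. j < N \<Longrightarrow> f j = f' j) \<Longrightarrow> ip N f g = ip N f' g"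
  by (simp add: ip_def)

text \<open>Add the three point identities of the corrector, compared with \<open>u\<close>, and of the
  probe, compared with the corrector. Half of the negative divergences absorbs the error term of an
  unsuspicious step and the other half is the loss.\<close>
lemma step_regret:
  assumes c: "consistent \<sigma>" and a: "\<And>j. j < N \<Longrightarrow> a j = mat_app N B (snd (probe \<sigma>)) j"
    and ng: "\<not> guilty \<sigma> a" and u: "u \<in> Z"
  shows "- fst (corrector \<sigma> a) * ip N (mat_app N B (snd (probe \<sigma>))) u + loss \<sigma> a
    \<le> Kreg (iter \<sigma>) (steps \<sigma>) u - Gam * kl N u (snd (corrector \<sigma> a))"
proof -
  define z where "z = snd (probe \<sigma>)"
  define t where "t = fst (probe \<sigma>)"
  define w where "w = snd (corrector \<sigma> a)"
  define s where "s = fst (corrector \<sigma> a)"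
  define e where "e = surprise \<sigma> a"
  define f where "f = (\<lambda>j. mat_app N (model \<sigma>) z j + offset \<sigma> j)"
  define k where "k = slack (iter \<sigma>) (steps \<sigma>)"
  note pz = probe_props[OF c, folded z_def t_def]
  note pw = corrector_props[OF c, where a=a, folded w_def s_def t_def]
  have g: "good (iter \<sigma>) (steps \<sigma>)" using c by (simp add: consistent_def)
  have K: "Kreg (iter \<sigma>) (steps \<sigma>) v = Gam * kl N v (ctr \<sigma>) + k" if "v \<in> Z" for v
    unfolding k_def ctr_def using Z_nonneg[OF that] by (intro Kreg_geo[OF g]) auto
  have k0: "0 \<le> k" unfolding k_def using g by (rule slack_nonneg) simp
  have dn: "0 \<le> Gam * kl N v (ctr \<sigma>)" if "v \<in> Z" for v
    using Gam_pos Z_nonneg[OF that] ctr_pos by (simp add: kl_nonneg)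
  define r where "r = s / t"
  have r: "0 < r" "r \<le> 1" "s = r * t" using pz(1) pw(1,2) by (auto simp: r_def)
  have tw: "s * ip N a (\<lambda>j. w j - u j) = Gam * kl N u (ctr \<sigma>) - Gam * kl N u w - Gam * kl N w (ctr \<sigma>)"
  proof -
    have "ip N (\<lambda>j. s / Gam * a j) (\<lambda>j. w j - u j) = kl N u (ctr \<sigma>) - kl N u w - kl N w (ctr \<sigma>)"
      using gibbs_three_point[where c="ctr \<sigma>" and g="\<lambda>j. s / Gam * a j" and u=u, OF ctr_pos u]
      unfolding pw(3)[symmetric] .
    then have "Gam * (s / Gam * ip N a (\<lambda>j. w j - u j)) = Gam * (kl N u (ctr \<sigma>) - kl N u w - kl N w (ctr \<sigma>))"
      unfolding ip_scale_left by simp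
    then show ?thesis using Gam_pos by (simp add: right_diff_distrib)
  qed
  have tz: "t * ip N f (\<lambda>j. z j - w j) = Gam * kl N w (ctr \<sigma>) - Gam * kl N w z - Gam * kl N z (ctr \<sigma>)"
  proof -
    have "ip N (\<lambda>j. t / Gam * f j) (\<lambda>j. z j - w j) = kl N w (ctr \<sigma>) - kl N w z - kl N z (ctr \<sigma>)"
      using gibbs_three_point[where c="ctr \<sigma>" and g="\<lambda>j. t / Gam * f j" and u=w, OF ctr_pos pw(6)]
      unfolding f_def pz(3)[symmetric] .
    then have "Gam * (t / Gam * ip N f (\<lambda>j. z j - w j)) = Gam * (kl N w (ctr \<sigma>) - kl N w z - kl N z (ctr \<sigma>))"
      unfolding ip_scale_left by simp
    then show ?thesis using Gam_pos by (simp add: right_diff_distrib)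
  qed
  have af: "ip N a v = ip N f v + ip N e v" for v
  proof -
    have "ip N a v = ip N (\<lambda>j. f j + e j) v"
      by (rule ip_cong) (simp add: e_def surprise_def f_def z_def)
    then show ?thesis by (simp add: ip_add_left)
  qed
  \<comment> \<open>The only term that depends on the residual of the model.\<close>
  have X: "t * ip N e (\<lambda>j. z j - w j) \<le> (Gam * kl N w z + \<gamma> * kl N z (base \<sigma>)) / 2"
    using ng unfolding guilty_def misfit_def z_def w_def t_def e_def by simp
  have zb: "\<gamma> * kl N z (base \<sigma>) \<le> Gam * kl N z (ctr \<sigma>) + k"
    using Kreg_ge_base[OF c pz(6)] K[OF pz(6)] by simp
  have az: "ip N a z = 0"
  proof -
    have "ip N a z = ip N (mat_app N B z) z" by (rule ip_cong) (simp add: a z_def)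
    then show ?thesis by (simp add: skew_ip_self[OF B_skew])
  qed
  have "- s * ip N (mat_app N B z) u = - s * ip N a u"
    using ip_cong[of a "mat_app N B z" u] a by (simp add: z_def)
  also have "\<dots> = r * (t * ip N f (\<lambda>j. z j - w j)) + r * (t * ip N e (\<lambda>j. z j - w j)) + s * ip N a (\<lambda>j. w j - u j)"
  proof -
    have x: "ip N f (\<lambda>j. z j - w j) + ip N e (\<lambda>j. z j - w j) = - ip N a w"
      using az af[of "\<lambda>j. z j - w j"] by (simp add: ip_diff_right)
    have "r * (t * ip N f (\<lambda>j. z j - w j)) + r * (t * ip N e (\<lambda>j. z j - w j)) + s * ip N a (\<lambda>j. w j - u j)
        = r * t * (ip N f (\<lambda>j. z j - w j) + ip N e (\<lambda>j. z j - w j)) + s * (ip N a w - ip N a u)"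
      by (simp add: ip_diff_right[of N a w u] distrib_left mult.assoc)
    also have "\<dots> = - s * ip N a u" unfolding x r(3) by (simp add: right_diff_distrib)
    finally show ?thesis ..
  qed
  also have "\<dots> \<le> r * (Gam * kl N w (ctr \<sigma>) - Gam * kl N w z - Gam * kl N z (ctr \<sigma>))
      + r * ((Gam * kl N w z + Gam * kl N z (ctr \<sigma>) + k) / 2)
      + (Gam * kl N u (ctr \<sigma>) - Gam * kl N u w - Gam * kl N w (ctr \<sigma>))"
    unfolding tz tw using X zb r by (intro add_mono mult_left_mono) auto
  finally have main: "- s * ip N (mat_app N B z) u \<le> r * (Gam * kl N w (ctr \<sigma>) - Gam * kl N w z - Gam * kl N z (ctr \<sigma>))
      + r * ((Gam * kl N w z + Gam * kl N z (ctr \<sigma>) + k) / 2)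
      + (Gam * kl N u (ctr \<sigma>) - Gam * kl N u w - Gam * kl N w (ctr \<sigma>))" .
  have L: "loss \<sigma> a = ((1 - r) * (Gam * kl N w (ctr \<sigma>) + k) + r * (Gam * kl N w z + (Gam * kl N z (ctr \<sigma>) + k))) / 2"
    unfolding loss_def Let_def using K[OF pw(6)] K[OF pz(6)] by (simp add: z_def w_def r_def s_def t_def)
  have "0 \<le> (1 - r) * (Gam * kl N w (ctr \<sigma>)) / 2 + (1 - r) * k / 2"
    using r k0 dn[OF pw(6)] by (intro add_nonneg_nonneg) auto
  then have "- s * ip N (mat_app N B z) u + loss \<sigma> a \<le> Gam * kl N u (ctr \<sigma>) + k - Gam * kl N u w"
    using main unfolding L by (simp add: algebra_simps) argo
  then show ?thesis using K[OF u] by (simp add: z_def w_def s_def)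
qed

text \<open>The loss contains the divergence from every anchor, either directly or by way of the trial
  point, whence the first bound. A shortened step has a trial point or an iterate with excess exactly
  \<open>\<theta>\<close>. The weights dominate the base point, so the point with the excess lies at squared
  Hellinger distance at least \<open>\<theta> / 4\<close> from the base point, which makes the loss at least
  \<open>\<gamma> \<theta> / 16\<close>.\<close>
lemma loss_props:
  assumes c: "consistent \<sigma>"
  shows "(\<Sum>i\<le>I. gam i * hellinger N (snd (corrector \<sigma> a)) (anchor (iter \<sigma>) i (steps \<sigma>))) \<le> 4 * loss \<sigma> a"
    and "slack (iter \<sigma>) (steps \<sigma>) / 2 \<le> loss \<sigma> a"
    and "0 \<le> loss \<sigma> a"
    and "1 \<le> fst (corrector \<sigma> a) + 16 / (\<gamma> * \<theta>) * loss \<sigma> a"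
proof -
  define z where "z = snd (probe \<sigma>)"
  define t where "t = fst (probe \<sigma>)"
  define w where "w = snd (corrector \<sigma> a)"
  define s where "s = fst (corrector \<sigma> a)"
  define R where "R = Kreg (iter \<sigma>) (steps \<sigma>)"
  define A where "A i = anchor (iter \<sigma>) i (steps \<sigma>)" for i
  define k where "k = slack (iter \<sigma>) (steps \<sigma>)"
  note pz = probe_props[OF c, folded z_def t_def]
  note pw = corrector_props[OF c, where a=a, folded w_def s_def t_def]
  have g: "good (iter \<sigma>) (steps \<sigma>)" using c by (simp add: consistent_def)
  have Ap: "0 < A i j" if "j < N" for i j unfolding A_def using g _ that by (rule anchor_pos) simp
  define r where "r = s / t"
  have r: "0 < r" "r \<le> 1" "s = r * t" using pz(1) pw(1,2) by (auto simp: r_def)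
  have L: "loss \<sigma> a = ((1 - r) * R w + r * (Gam * kl N w z + R z)) / 2"
    unfolding loss_def Let_def by (simp add: z_def w_def r_def s_def t_def R_def)
  have wz: "0 \<le> kl N w z" "hellinger N w z \<le> kl N w z"
    using Z_nonneg[OF pw(6)] pz(7) by (auto intro: kl_nonneg hellinger_le_kl)
  have hz: "hellinger N z (A i) \<le> kl N z (A i)" and hw: "hellinger N w (A i) \<le> kl N w (A i)" for i
    using Z_nonneg[OF pz(6)] Z_nonneg[OF pw(6)] Ap by (auto intro: hellinger_le_kl)
  have "hellinger N w (A i) / 2 \<le> (1 - r) * kl N w (A i) + r * (kl N w z + kl N z (A i))" for i
  proof -
    have "hellinger N w (A i) / 2 \<le> kl N w z + kl N z (A i)"
      using hellinger_triangle[of N w "A i" z] wz hz[of i] by linarith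
    then have "r * (hellinger N w (A i) / 2) \<le> r * (kl N w z + kl N z (A i))" using r by (intro mult_left_mono) auto
    moreover have "(1 - r) * (hellinger N w (A i) / 2) \<le> (1 - r) * kl N w (A i)"
      using r hw[of i] hellinger_nonneg[of N w "A i"] by (intro mult_left_mono) auto
    moreover have "hellinger N w (A i) / 2 = (1 - r) * (hellinger N w (A i) / 2) + r * (hellinger N w (A i) / 2)"
      by (simp only: distrib_right[symmetric]) simp
    ultimately show ?thesis by linarith
  qed
  then have "(\<Sum>i\<le>I. gam i * (hellinger N w (A i) / 2)) \<le> (\<Sum>i\<le>I. gam i * ((1 - r) * kl N w (A i) + r * (kl N w z + kl N z (A i))))"
    using gam_pos by (intro sum_mono mult_left_mono) (auto simp: less_imp_le)
  also have "\<dots> = (1 - r) * R w + r * (Gam * kl N w z + R z)"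
    unfolding R_def Kreg_def Gam_def A_def
    by (simp add: sum.distrib sum_distrib_left sum_distrib_right algebra_simps sum_subtractf)
  finally have h1: "(\<Sum>i\<le>I. gam i * hellinger N w (A i)) \<le> 4 * loss \<sigma> a"
    unfolding L by (simp add: sum_divide_distrib[symmetric])
  then show "(\<Sum>i\<le>I. gam i * hellinger N (snd (corrector \<sigma> a)) (anchor (iter \<sigma>) i (steps \<sigma>))) \<le> 4 * loss \<sigma> a"
    by (simp add: w_def A_def)
  have k0: "0 \<le> k" unfolding k_def using g by (rule slack_nonneg) simp
  have "k \<le> R w" "k \<le> R z" unfolding k_def R_def using g pw(6) pz(6) by (auto intro: Kreg_ge_slack)
  then have "(1 - r) * k \<le> (1 - r) * R w" "r * k \<le> r * (Gam * kl N w z + R z)"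
    using r wz Gam_pos by (auto intro!: mult_left_mono add_increasing)
  then have kl: "k / 2 \<le> loss \<sigma> a" unfolding L by (simp add: algebra_simps)
  then show "slack (iter \<sigma>) (steps \<sigma>) / 2 \<le> loss \<sigma> a" by (simp add: k_def)
  show l0: "0 \<le> loss \<sigma> a" using kl k0 by linarith
  have gt: "0 < \<gamma> * \<theta>" using gamma_pos theta_pos by simp
  have pause: "1 \<le> s + 16 / (\<gamma> * \<theta>) * loss \<sigma> a" if "\<gamma> * \<theta> / 16 \<le> loss \<sigma> a"
  proof -
    have "16 / (\<gamma> * \<theta>) * (\<gamma> * \<theta> / 16) \<le> 16 / (\<gamma> * \<theta>) * loss \<sigma> a"
      using that gt by (intro mult_left_mono) auto
    moreover have "16 / (\<gamma> * \<theta>) * (\<gamma> * \<theta> / 16) = 1" using gamma_pos theta_pos by simp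
    ultimately show ?thesis using pw(1) by linarith
  qed
  have bw: "base \<sigma> j \<le> weight \<sigma> j" "0 \<le> base \<sigma> j" if "j < N" for j
    using base_le_weight[OF c that] base_pos[OF c that] by auto
  have A0: "A 0 = base \<sigma>" by (simp add: A_def base_def)
  consider "excess (weight \<sigma>) w = \<theta>" | "s = t" "excess (weight \<sigma>) z = \<theta>" | "s = 1"
    using pw(5) pz(5) by auto
  then have "1 \<le> s + 16 / (\<gamma> * \<theta>) * loss \<sigma> a"
  proof cases
    case 1
    have "\<theta> \<le> 4 * hellinger N w (base \<sigma>)"
      using excess_le_hellinger[of w "base \<sigma>" "weight \<sigma>"] Z_nonneg[OF pw(6)] bw 1 by simp
    moreover have "gam 0 * hellinger N w (A 0) \<le> (\<Sum>i\<le>I. gam i * hellinger N w (A i))"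
      using gam_pos hellinger_nonneg by (intro member_le_sum) (auto simp: less_imp_le)
    moreover have "gam 0 = \<gamma>" by (simp add: gam_def)
    ultimately have "\<theta> / 4 \<le> hellinger N w (base \<sigma>)" "\<gamma> * hellinger N w (base \<sigma>) \<le> 4 * loss \<sigma> a"
      using h1 unfolding A0 by auto
    moreover from this(1) have "\<gamma> * (\<theta> / 4) \<le> \<gamma> * hellinger N w (base \<sigma>)"
      using gamma_pos by (intro mult_left_mono) auto
    ultimately have "\<gamma> * (\<theta> / 4) \<le> 4 * loss \<sigma> a" by linarith
    then show ?thesis by (intro pause) simp
  next
    case 2
    have "\<theta> \<le> 4 * hellinger N z (base \<sigma>)"
      using excess_le_hellinger[of z "base \<sigma>" "weight \<sigma>"] Z_nonneg[OF pz(6)] bw 2 by simp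
    then have "\<theta> / 4 \<le> kl N z (base \<sigma>)" using hz[of 0] A0 by simp
    then have "\<gamma> * (\<theta> / 4) \<le> \<gamma> * kl N z (base \<sigma>)" using gamma_pos by (intro mult_left_mono) auto
    also have "\<dots> \<le> R z" unfolding R_def using c pz(6) by (rule Kreg_ge_base)
    finally have "\<gamma> * \<theta> / 4 \<le> R z" by simp
    moreover have "r = 1" using 2 pz(1) by (simp add: r_def)
    then have "R z / 2 \<le> loss \<sigma> a" unfolding L using wz Gam_pos by simp
    ultimately have "\<gamma> * \<theta> / 16 \<le> loss \<sigma> a" using gt by linarith
    then show ?thesis by (rule pause)
  next
    case 3 then show ?thesis using l0 gt by simp
  qed
  then show "1 \<le> fst (corrector \<sigma> a) + 16 / (\<gamma> * \<theta>) * loss \<sigma> a" by (simp add: s_def)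
qed

end

section \<open>The invariant and the resulting bounds\<close>

text \<open>The bound of \<open>envelope\<close>, plus what the injected centres add, plus \<open>1\<close>
  for all corrections together.\<close>
definition weight_cap :: "real \<Rightarrow> real \<Rightarrow> real" where
  "weight_cap i D = 3 * (2 + i * (2 + 96 * (4 * i * D) * i\<^sup>2)) + 8 * i * D + 3"

definition guilt_cap :: "real \<Rightarrow> real \<Rightarrow> real \<Rightarrow> real" where
  "guilt_cap i D \<gamma> = 2048 * (weight_cap i D)\<^sup>2 / \<gamma>\<^sup>2"

context two_simplices begin

lemma gibbs_cong:
  assumes "\<And>j. j < N \<Longrightarrow> c j = c' j"
  shows "gibbs c g = gibbs c' g"
proof
  fix j
  have "(\<Sum>l\<in>blk j. c l * exp (- g l)) = (\<Sum>l\<in>blk j. c' l * exp (- g l))" if "j < N"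
    using assms n_less_N by (intro sum.cong) (auto simp: blk_def split: if_splits)
  then show "gibbs c g j = gibbs c' g j" using assms by (simp add: gibbs_def)
qed
end

context game begin

lemma geo_start: "j < N \<Longrightarrow> geo w 0 j = z0 j"
proof -
  assume j: "j < N"
  have "(\<Sum>i\<le>I. gam i * ln (anchor w i 0 j)) = Gam * ln (z0 j)"
    by (simp add: anchor_0_0 Gam_def sum_distrib_right)
  then show ?thesis using Gam_pos z0_pos[OF j] by (simp add: geo_def)
qed

lemma start_invariant:
  assumes "\<And>j. j < N \<Longrightarrow> a j = mat_app N B z0 j"
  shows "invariant (start a) 0"
proof -
  have "gibbs (geo (\<lambda>s. z0) 0) (\<lambda>j. 0) = gibbs z0 (\<lambda>j. 0)" by (intro gibbs_cong geo_start)
  then have gb: "gibbs (geo (\<lambda>s. z0) 0) (\<lambda>j. 0) = z0" by (simp add: gibbs_normalises z0_Z)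
  have c: "consistent (start a)"
    unfolding consistent_def using assms Z_nonneg[OF z0_Z]
    by (auto simp: start_def good_def ctr_def base_def gb anchor_0_0 intro!: skewI)
  have "energy N z0 (\<lambda>j k. B j k - 0) \<le> (\<Sum>j<N. \<Sum>k<N. z0 j * z0 k)"
    unfolding energy_def
  proof (intro sum_mono)
    fix j k assume "j \<in> {..<N}" "k \<in> {..<N}"
    then have "\<bar>B j k\<bar>\<^sup>2 \<le> 1\<^sup>2" using B_bounded by (intro power_mono) auto
    then have "z0 j * z0 k * (B j k - 0)\<^sup>2 \<le> z0 j * z0 k * 1"
      using Z_nonneg[OF z0_Z] by (intro mult_left_mono mult_nonneg_nonneg) auto
    then show "z0 j * z0 k * (B j k - 0)\<^sup>2 \<le> z0 j * z0 k" by simp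
  qed
  also have "\<dots> = (\<Sum>j<N. z0 j)\<^sup>2" by (simp add: power2_eq_square sum_product)
  finally have e: "energy_bound (start a) 0"
    using Z_sum[OF z0_Z] by (simp add: energy_bound_def start_def)
  have r: "regret_bound (start a) (\<lambda>s. 0)"
    unfolding regret_bound_def by (auto simp: start_def ip_def mat_app_def)
  have w: "weight_bound (start a) 0 (\<lambda>s. 0)"
    unfolding weight_bound_def by (intro exI[of _ "\<lambda>j. 0"] exI[of _ 0]) (auto simp: start_def)
  show ?thesis unfolding invariant_def using c e r w by blast
qed

lemma consistent_B_minus_model:
  assumes "consistent \<sigma>" "j < N" "k < N"
  shows "\<bar>B j k - model \<sigma> j k\<bar> \<le> 2"
proof -
  have "\<bar>model \<sigma> j k\<bar> \<le> 1" using assms by (simp add: consistent_def)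
  then show ?thesis using B_bounded[OF assms(2,3)] by linarith
qed

text \<open>After injection \<open>8 \<omega>\<close> covers the three points involved, so their divergences
  dominate weighted squared norms. The guilt condition then becomes \<open>\<langle>R d, d'\<rangle> >
  \<gamma> / 64 \<cdot> (\<parallel>d\<parallel>\<^sup>2 + \<parallel>d'\<parallel>\<^sup>2)\<close>, and
  the inequality of arithmetic and geometric means turns this into the size required by
  \<open>refine_energy\<close>.\<close>
lemma guilty_energy_drop:
  assumes c: "consistent \<sigma>" and a: "\<And>j. j < N \<Longrightarrow> a j = mat_app N B (snd (probe \<sigma>)) j"
    and gu: "guilty \<sigma> a"
  shows "energy N (weight (learn \<sigma> a)) (\<lambda>j k. B j k - model (learn \<sigma> a) j k)
    \<le> energy N (weight (learn \<sigma> a)) (\<lambda>j k. B j k - model \<sigma> j k) - \<gamma>\<^sup>2 / 512"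
proof -
  define z where "z = snd (probe \<sigma>)"
  define t where "t = fst (probe \<sigma>)"
  define w where "w = snd (corrector \<sigma> a)"
  define b where "b = base \<sigma>"
  define \<omega> where "\<omega> = inject (inject (weight \<sigma>) z) w"
  define \<rho> where "\<rho> = misfit \<sigma> a"
  define d where "d = (\<lambda>j. z j - b j)"
  define d' where "d' = (\<lambda>j. z j - w j)"
  note pz = probe_props[OF c, folded z_def t_def]
  note pw = corrector_props[OF c, where a=a, folded w_def t_def]
  have bp: "0 < b j" and bw: "b j \<le> weight \<sigma> j" if "j < N" for j
    unfolding b_def using base_pos[OF c that] base_le_weight[OF c that] by auto
  have wp: "0 < weight \<sigma> j" if "j < N" for j using weight_pos[OF c that] .
  have i1: "weight \<sigma> j \<le> inject (weight \<sigma>) z j" for j by (rule inject_ge)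
  have i2: "inject (weight \<sigma>) z j \<le> \<omega> j" for j unfolding \<omega>_def by (rule inject_ge)
  have op: "0 < \<omega> j" if "j < N" for j using wp[OF that] i1[of j] i2[of j] by linarith
  have z8: "z j \<le> 8 * \<omega> j" if "j < N" for j
  proof -
    have "z j \<le> 8 * inject (weight \<sigma>) z j" using wp[OF that] by (intro inject_covers) simp
    then show ?thesis using i2[of j] by linarith
  qed
  have w8: "w j \<le> 8 * \<omega> j" if "j < N" for j
    unfolding \<omega>_def using wp[OF that] i1[of j] by (intro inject_covers) simp
  have b8: "b j \<le> 8 * \<omega> j" if "j < N" for j
    using bw[OF that] i1[of j] i2[of j] op[OF that] by linarith
  have k1: "wnorm2 N \<omega> d' / 32 \<le> kl N w z"
  proof -
    have "(\<Sum>j<N. (w j - z j)\<^sup>2 / (8 * \<omega> j)) \<le> 4 * kl N w z"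
      using Z_nonneg[OF pw(6)] pz(7) w8 z8 by (intro sq_dist_le_kl) auto
    moreover have "(\<Sum>j<N. (w j - z j)\<^sup>2 / (8 * \<omega> j)) = wnorm2 N \<omega> d' / 8"
      unfolding wnorm2_def d'_def sum_divide_distrib
      by (intro sum.cong) (auto simp: power2_commute mult.commute)
    ultimately show ?thesis by linarith
  qed
  have k2: "wnorm2 N \<omega> d / 32 \<le> kl N z b"
  proof -
    have "(\<Sum>j<N. (z j - b j)\<^sup>2 / (8 * \<omega> j)) \<le> 4 * kl N z b"
      using Z_nonneg[OF pz(6)] bp b8 z8 by (intro sq_dist_le_kl) auto
    moreover have "(\<Sum>j<N. (z j - b j)\<^sup>2 / (8 * \<omega> j)) = wnorm2 N \<omega> d / 8"
      unfolding wnorm2_def d_def sum_divide_distrib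
      by (intro sum.cong) (auto simp: mult.commute)
    ultimately show ?thesis by linarith
  qed
  have n0: "0 \<le> wnorm2 N \<omega> v" for v unfolding wnorm2_def using op by (intro sum_nonneg) (auto simp: less_imp_le)
  have t\<rho>: "\<gamma> / 64 * (wnorm2 N \<omega> d + wnorm2 N \<omega> d') < t * \<rho>"
  proof -
    have "\<gamma> * (wnorm2 N \<omega> d' / 32) \<le> Gam * kl N w z"
      using k1 gamma_le_Gam gamma_pos n0[of d'] Gam_pos by (intro mult_mono) auto
    moreover have "\<gamma> * (wnorm2 N \<omega> d / 32) \<le> \<gamma> * kl N z b"
      using k2 gamma_pos by (intro mult_left_mono) auto
    ultimately have "(\<gamma> * (wnorm2 N \<omega> d' / 32) + \<gamma> * (wnorm2 N \<omega> d / 32)) / 2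
        \<le> (Gam * kl N w z + \<gamma> * kl N z b) / 2"
      by (intro divide_right_mono add_mono) auto
    also have "\<dots> < t * \<rho>"
      using gu unfolding guilty_def z_def w_def t_def b_def \<rho>_def .
    finally show ?thesis by (simp add: field_simps)
  qed
  have rpos: "0 < t * \<rho>"
  proof -
    have "0 \<le> \<gamma> / 64 * (wnorm2 N \<omega> d + wnorm2 N \<omega> d')" using gamma_pos n0 by simp
    then show ?thesis using t\<rho> by linarith
  qed
  then have "0 < \<rho>" using pz(1) by (simp add: zero_less_mult_iff)
  moreover have "t * \<rho> \<le> 1 * \<rho>" using pz(2) \<open>0 < \<rho>\<close> by (intro mult_right_mono) auto
  ultimately have big: "\<gamma> / 64 * (wnorm2 N \<omega> d + wnorm2 N \<omega> d') < \<rho>" using t\<rho> by linarith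
  have e: "surprise \<sigma> a j = mat_app N (\<lambda>j k. B j k - model \<sigma> j k) d j" if "j < N" for j
  proof -
    have "image \<sigma> j = mat_app N B b j" using c that by (simp add: consistent_def b_def)
    then have "surprise \<sigma> a j = mat_app N B d j - mat_app N (model \<sigma>) d j"
      using a[OF that] unfolding surprise_def offset_def d_def mat_app_diff by (simp add: z_def b_def)
    then show ?thesis by (simp add: mat_app_def left_diff_distrib sum_subtractf)
  qed
  have rho: "\<rho> = ip N (mat_app N (\<lambda>j k. B j k - model \<sigma> j k) d) d'"
    unfolding \<rho>_def misfit_def d'_def z_def w_def by (rule ip_cong) (rule e)
  have d'p: "0 < wnorm2 N \<omega> d'"
  proof (rule ccontr)
    assume "\<not> 0 < wnorm2 N \<omega> d'"
    then have "d' j = 0" if "j < N" for j using wnorm2_pos[of N \<omega> j d', OF op that] by blast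
    then have "\<rho> = 0" unfolding rho by (simp add: ip_def)
    then show False using \<open>0 < \<rho>\<close> by simp
  qed
  have dp: "0 < wnorm2 N \<omega> d"
  proof (rule ccontr)
    assume "\<not> 0 < wnorm2 N \<omega> d"
    then have "d j = 0" if "j < N" for j using wnorm2_pos[of N \<omega> j d, OF op that] by blast
    then have "\<rho> = 0" unfolding rho by (simp add: ip_def mat_app_def)
    then show False using \<open>0 < \<rho>\<close> by simp
  qed
  have gain: "\<gamma>\<^sup>2 / 512 \<le> 2 * \<rho>\<^sup>2 / (wnorm2 N \<omega> d * wnorm2 N \<omega> d')"
  proof -
    define x where "x = wnorm2 N \<omega> d"
    define y where "y = wnorm2 N \<omega> d'"
    have xy: "0 < x" "0 < y" "\<gamma> / 64 * (x + y) < \<rho>" using dp d'p big by (auto simp: x_def y_def)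
    have "0 \<le> (x - y)\<^sup>2" by simp
    then have "4 * (x * y) \<le> (x + y)\<^sup>2" by (simp add: power2_eq_square algebra_simps)
    then have "(\<gamma> / 64)\<^sup>2 * (4 * (x * y)) \<le> (\<gamma> / 64)\<^sup>2 * (x + y)\<^sup>2" by (intro mult_left_mono) auto
    also have "\<dots> = (\<gamma> / 64 * (x + y))\<^sup>2" by (rule power_mult_distrib[symmetric])
    also have "\<dots> \<le> \<rho>\<^sup>2" using xy gamma_pos by (intro power_mono) auto
    finally have "\<gamma>\<^sup>2 / 512 * (x * y) \<le> 2 * \<rho>\<^sup>2" by (simp add: power_divide mult_ac)
    then show ?thesis using xy by (simp add: pos_le_divide_eq flip: x_def y_def)
  qed
  have le: "weight (learn \<sigma> a) = \<omega>" "model (learn \<sigma> a) = refine N \<omega> (model \<sigma>) d d' \<rho>"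
    unfolding learn_def Let_def \<omega>_def d_def d'_def \<rho>_def z_def w_def b_def by simp_all
  have sk: "skew N (model \<sigma>)" using c by (simp add: consistent_def)
  have "energy N \<omega> (\<lambda>j k. B j k - refine N \<omega> (model \<sigma>) d d' \<rho> j k)
    \<le> energy N \<omega> (\<lambda>j k. B j k - model \<sigma> j k) - 2 * \<rho>\<^sup>2 / (wnorm2 N \<omega> d * wnorm2 N \<omega> d')"
    using B_skew B_bounded sk op dp d'p rho by (rule refine_energy)
  then show ?thesis unfolding le using gain by linarith
qed

lemma learn_invariant:
  assumes inv: "invariant \<sigma> g" and a: "\<And>j. j < N \<Longrightarrow> a j = mat_app N B (snd (probe \<sigma>)) j"
    and gu: "guilty \<sigma> a"
  shows "invariant (learn \<sigma> a) (Suc g)"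
proof -
  define z where "z = snd (probe \<sigma>)"
  define w where "w = snd (corrector \<sigma> a)"
  define \<omega>1 where "\<omega>1 = inject (weight \<sigma>) z"
  define \<omega> where "\<omega> = inject \<omega>1 w"
  obtain ls where c: "consistent \<sigma>" and energy: "energy_bound \<sigma> g" and rg: "regret_bound \<sigma> ls" and wb: "weight_bound \<sigma> g ls"
    using inv unfolding invariant_def by blast
  note pz = probe_props[OF c, folded z_def]
  note pw = corrector_props[OF c, where a=a, folded w_def]
  have L: "steps (learn \<sigma> a) = steps \<sigma>" "iter (learn \<sigma> a) = iter \<sigma>" "time (learn \<sigma> a) = time \<sigma>"
    "total (learn \<sigma> a) = total \<sigma>" "image (learn \<sigma> a) = image \<sigma>" "weight (learn \<sigma> a) = \<omega>"
    unfolding learn_def Let_def \<omega>_def \<omega>1_def z_def w_def by simp_all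
  have B: "base (learn \<sigma> a) = base \<sigma>" "ctr (learn \<sigma> a) = ctr \<sigma>"
    unfolding base_def ctr_def L by simp_all
  have mono1: "weight \<sigma> j \<le> \<omega>1 j" for j unfolding \<omega>1_def by (rule inject_ge)
  have mono: "weight \<sigma> j \<le> \<omega> j" for j unfolding \<omega>_def using inject_ge mono1 by (rule order_trans[rotated])
  have skm: "skew N (model \<sigma>)" using c by (simp add: consistent_def)
  have M: "skew N (model (learn \<sigma> a))" "\<bar>model (learn \<sigma> a) j k\<bar> \<le> 1" for j k
    unfolding learn_def Let_def using refine_skew[OF skm] by (simp_all add: refine_bounded)
  have c': "consistent (learn \<sigma> a)"
    unfolding consistent_def L B
  proof (intro conjI allI impI)
    fix j assume j: "j < N"
    have cj: "z0 j \<le> weight \<sigma> j" "\<forall>s<steps \<sigma>. iter \<sigma> s j \<le> weight \<sigma> j" "gibbs (ctr \<sigma>) (\<lambda>j. 0) j \<le> 8 * weight \<sigma> j"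
      using c j by (auto simp: consistent_def)
    show "z0 j \<le> \<omega> j" using cj(1) mono[of j] by linarith
    show "iter \<sigma> s j \<le> \<omega> j" if "s < steps \<sigma>" for s using cj(2) that mono[of j] by force
    show "gibbs (ctr \<sigma>) (\<lambda>j. 0) j \<le> 8 * \<omega> j" using cj(3) mono[of j] by linarith
  qed (use c M in \<open>auto simp: consistent_def\<close>)
  have e': "energy_bound (learn \<sigma> a) (Suc g)"
  proof -
    have "energy N \<omega> (\<lambda>j k. B j k - model \<sigma> j k) - 4 * (\<Sum>j<N. \<omega> j)\<^sup>2
        \<le> energy N (weight \<sigma>) (\<lambda>j k. B j k - model \<sigma> j k) - 4 * (\<Sum>j<N. weight \<sigma> j)\<^sup>2"
      using consistent_B_minus_model[OF c] weight_pos[OF c] mono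
      by (intro energy_weight_increase) (auto simp: less_imp_le)
    moreover have "energy N \<omega> (\<lambda>j k. B j k - model (learn \<sigma> a) j k) \<le> energy N \<omega> (\<lambda>j k. B j k - model \<sigma> j k) - \<gamma>\<^sup>2 / 512"
      using guilty_energy_drop[OF c a gu] unfolding L .
    ultimately show ?thesis using energy unfolding energy_bound_def L by (simp add: field_simps)
  qed
  have r': "regret_bound (learn \<sigma> a) ls" using rg unfolding regret_bound_def L .
  have w': "weight_bound (learn \<sigma> a) (Suc g) ls"
  proof -
    obtain h p where h: "\<And>j. j < N \<Longrightarrow> 0 \<le> h j" and p: "0 \<le> p" "p \<le> 2" "p = 0 \<or> \<gamma> / 2 \<le> slack (iter \<sigma>) (steps \<sigma>)"
      and hs: "(\<Sum>j<N. h j) \<le> 2 * \<theta> * real g + 8 / \<gamma> * (\<Sum>s<steps \<sigma>. ls s) + p"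
      and S: "\<And>S. (\<forall>j<N. z0 j \<le> S j) \<Longrightarrow> (\<forall>s<steps \<sigma>. \<forall>j<N. iter \<sigma> s j \<le> S j) \<Longrightarrow> (\<forall>j<N. weight \<sigma> j \<le> S j + h j)"
      using wb unfolding weight_bound_def by blast
    define h' where "h' j = h j + max 0 (z j - 8 * weight \<sigma> j) + max 0 (w j - 8 * \<omega>1 j)" for j
    have "(\<Sum>j<N. h' j) = (\<Sum>j<N. h j) + excess (weight \<sigma>) z + excess \<omega>1 w"
      unfolding h'_def excess_def by (simp add: sum.distrib)
    also have "excess \<omega>1 w \<le> excess (weight \<sigma>) w" using mono1 by (intro excess_antimono)
    finally have "(\<Sum>j<N. h' j) \<le> 2 * \<theta> * real (Suc g) + 8 / \<gamma> * (\<Sum>s<steps \<sigma>. ls s) + p"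
      using hs pz(4) pw(4) by (simp add: algebra_simps)
    moreover have "0 \<le> h' j" if "j < N" for j using h[OF that] by (simp add: h'_def)
    moreover have "\<forall>j<N. \<omega> j \<le> S j + h' j"
      if "\<forall>j<N. z0 j \<le> S j" "\<forall>s<steps \<sigma>. \<forall>j<N. iter \<sigma> s j \<le> S j" for S
      using S[OF that] by (auto simp: h'_def \<omega>_def \<omega>1_def inject_def)
    ultimately show ?thesis unfolding weight_bound_def L using p by blast
  qed
  show ?thesis unfolding invariant_def using c' e' r' w' by blast
qed

lemma advance_invariant:
  assumes inv: "invariant \<sigma> g" and a: "\<And>j. j < N \<Longrightarrow> a j = mat_app N B (snd (probe \<sigma>)) j"
    and ng: "\<not> guilty \<sigma> a" and a': "\<And>j. j < N \<Longrightarrow> a' j = mat_app N B (snd (corrector \<sigma> a)) j"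
  shows "invariant (advance \<sigma> a a') g"
proof -
  define z where "z = snd (probe \<sigma>)"
  define t where "t = fst (probe \<sigma>)"
  define w where "w = snd (corrector \<sigma> a)"
  define s where "s = fst (corrector \<sigma> a)"
  define K where "K = steps \<sigma>"
  define it where "it = (iter \<sigma>)(K := w)"
  define \<omega>1 where "\<omega>1 = (\<lambda>j. max (weight \<sigma> j) (w j))"
  define c1 where "c1 = gibbs (geo it (Suc K)) (\<lambda>j. 0)"
  define \<omega> where "\<omega> = inject \<omega>1 c1"
  obtain ls0 where c: "consistent \<sigma>" and energy: "energy_bound \<sigma> g" and rg: "regret_bound \<sigma> ls0" and wb: "weight_bound \<sigma> g ls0"
    using inv unfolding invariant_def by blast
  define ls where "ls = ls0(K := loss \<sigma> a)"
  note pz = probe_props[OF c, folded z_def t_def]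
  note pw = corrector_props[OF c, where a=a, folded w_def s_def t_def]
  note lp = loss_props[OF c, where a=a, folded w_def s_def K_def]
  have L: "steps (advance \<sigma> a a') = Suc K" "iter (advance \<sigma> a a') = it" "time (advance \<sigma> a a') = time \<sigma> + s"
    "total (advance \<sigma> a a') = (\<lambda>j. total \<sigma> j + s * z j)" "image (advance \<sigma> a a') = a'"
    "weight (advance \<sigma> a a') = \<omega>" "model (advance \<sigma> a a') = model \<sigma>"
    unfolding advance_def Let_def \<omega>_def \<omega>1_def z_def w_def s_def it_def c1_def K_def by simp_all
  have itK: "it K = w" "\<And>l. l < K \<Longrightarrow> it l = iter \<sigma> l" by (auto simp: it_def)
  have an: "anchor it i l = anchor (iter \<sigma>) i l" if "l \<le> K" for i l
    using that by (intro anchor_cong) (auto simp: it_def)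
  have Kr: "Kreg it l = Kreg (iter \<sigma>) l" if "l \<le> K" for l
    using that by (intro Kreg_cong) (auto simp: it_def)
  have g0: "good (iter \<sigma>) K" using c by (simp add: consistent_def K_def)
  have g1: "good it (Suc K)"
    using g0 pw(6,7) by (auto simp: good_def less_Suc_eq it_def)
  have mono1: "weight \<sigma> j \<le> \<omega>1 j" "w j \<le> \<omega>1 j" for j by (auto simp: \<omega>1_def)
  have mono2: "\<omega>1 j \<le> \<omega> j" for j unfolding \<omega>_def by (rule inject_ge)
  have mono: "weight \<sigma> j \<le> \<omega> j" for j using mono1(1) mono2 by (rule order_trans)
  have w1p: "0 < \<omega>1 j" if "j < N" for j using weight_pos[OF c that] mono1(1)[of j] by linarith
  have om1: "z0 j \<le> \<omega>1 j" "l < Suc K \<Longrightarrow> it l j \<le> \<omega>1 j" if "j < N" for j l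
  proof -
    have cj: "z0 j \<le> weight \<sigma> j" "\<forall>l<K. iter \<sigma> l j \<le> weight \<sigma> j"
      using c that by (auto simp: consistent_def K_def)
    show "z0 j \<le> \<omega>1 j" using cj(1) mono1(1)[of j] by linarith
    show "it l j \<le> \<omega>1 j" if "l < Suc K"
    proof (cases "l = K")
      case False
      then have "l < K" using that by simp
      then have "it l j \<le> weight \<sigma> j" using cj(2) itK(2) by simp
      then show ?thesis using mono1(1)[of j] by linarith
    qed (use mono1(2) itK(1) in simp)
  qed
  have c': "consistent (advance \<sigma> a a')"
    unfolding consistent_def L
  proof (intro conjI allI impI)
    show "good it (Suc K)" by (rule g1)
    fix j assume j: "j < N"
    show "z0 j \<le> \<omega> j" using om1(1)[OF j] mono2[of j] by linarith
    show "it l j \<le> \<omega> j" if "l < Suc K" for l using om1(2)[OF j that] mono2[of j] by linarith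
    show "gibbs (ctr (advance \<sigma> a a')) (\<lambda>j. 0) j \<le> 8 * \<omega> j"
      unfolding ctr_def L c1_def[symmetric] \<omega>_def using w1p[OF j] by (intro inject_covers) simp
    show "a' j = mat_app N B (base (advance \<sigma> a a')) j"
      unfolding base_def L anchor_0_Suc itK using a'[OF j] by (simp add: w_def)
  qed (use c in \<open>auto simp: consistent_def\<close>)
  have e': "energy_bound (advance \<sigma> a a') g"
  proof -
    have "energy N \<omega> (\<lambda>j k. B j k - model \<sigma> j k) - 4 * (\<Sum>j<N. \<omega> j)\<^sup>2
        \<le> energy N (weight \<sigma>) (\<lambda>j k. B j k - model \<sigma> j k) - 4 * (\<Sum>j<N. weight \<sigma> j)\<^sup>2"
      using consistent_B_minus_model[OF c] weight_pos[OF c] mono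
      by (intro energy_weight_increase) (auto simp: less_imp_le)
    then show ?thesis using energy unfolding energy_bound_def L by linarith
  qed
  have sum_ls: "(\<Sum>l<Suc K. ls l) = (\<Sum>l<K. ls0 l) + loss \<sigma> a"
    by (simp add: ls_def)
  have r': "regret_bound (advance \<sigma> a a') ls"
  proof -
    note rr = rg[unfolded regret_bound_def, folded K_def]
    have ti: "0 \<le> time \<sigma>" using rr by blast
    have A2: "0 \<le> ls l \<and> (\<Sum>i\<le>I. gam i * hellinger N (it l) (anchor it i l)) \<le> 4 * ls l" if "l < Suc K" for l
    proof (cases "l = K")
      case True
      then show ?thesis using lp(1,3) by (simp add: ls_def itK an)
    next
      case False
      then have "l < K" using that by simp
      then show ?thesis using rr by (simp add: ls_def itK an)
    qed
    have A3: "- ip N (mat_app N B (\<lambda>j. total \<sigma> j + s * z j)) u + (\<Sum>l<Suc K. ls l)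
        \<le> (\<Sum>l<Suc K. Kreg it l u - Gam * kl N u (it l))" if u: "u \<in> Z" for u
    proof -
      have "ip N (mat_app N B (\<lambda>j. total \<sigma> j + s * z j)) u = ip N (mat_app N B (total \<sigma>)) u + s * ip N (mat_app N B z) u"
      proof -
        have "mat_app N B (\<lambda>j. total \<sigma> j + s * z j) = (\<lambda>j. mat_app N B (total \<sigma>) j + s * mat_app N B z j)"
          by (rule ext) (simp add: mat_app_add mat_app_scale)
        then show ?thesis by (simp add: ip_add_left ip_scale_left)
      qed
      moreover have "- ip N (mat_app N B (total \<sigma>)) u + (\<Sum>l<K. ls0 l) \<le> (\<Sum>l<K. Kreg (iter \<sigma>) l u - Gam * kl N u (iter \<sigma> l))"
        using rr u by blast
      moreover have "- s * ip N (mat_app N B z) u + loss \<sigma> a \<le> Kreg (iter \<sigma>) K u - Gam * kl N u w"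
        using step_regret[OF c a ng u] unfolding z_def s_def w_def K_def by blast
      moreover have "(\<Sum>l<Suc K. Kreg it l u - Gam * kl N u (it l))
          = (\<Sum>l<K. Kreg (iter \<sigma>) l u - Gam * kl N u (iter \<sigma> l)) + (Kreg (iter \<sigma>) K u - Gam * kl N u w)"
        by (simp add: itK Kr)
      ultimately show ?thesis unfolding sum_ls by linarith
    qed
    have A4: "real (Suc K) \<le> time \<sigma> + s + 16 / (\<gamma> * \<theta>) * (\<Sum>l<Suc K. ls l)"
    proof -
      have "real K \<le> time \<sigma> + 16 / (\<gamma> * \<theta>) * (\<Sum>l<K. ls0 l)" using rr by blast
      then show ?thesis using lp(4) unfolding sum_ls distrib_left by simp
    qed
    have tZ: "(\<Sum>j<n. total \<sigma> j + s * z j) = time \<sigma> + s" "(\<Sum>j=n..<N. total \<sigma> j + s * z j) = time \<sigma> + s"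
      using rr pz(6) by (auto simp: sum.distrib sum_distrib_left[symmetric] Z_def)
    have tn: "0 \<le> total \<sigma> j + s * z j" "N \<le> j \<Longrightarrow> total \<sigma> j + s * z j = 0" for j
      using rr pz(6) pw(1) by (auto simp: Z_def)
    show ?thesis unfolding regret_bound_def L using A2 A3 A4 tZ tn ti pw(1) by auto
  qed
  have w': "weight_bound (advance \<sigma> a a') g ls"
  proof -
    obtain h p where h: "\<And>j. j < N \<Longrightarrow> 0 \<le> h j" and p: "0 \<le> p" "p \<le> 2" "p = 0 \<or> \<gamma> / 2 \<le> slack (iter \<sigma>) K"
      and hs: "(\<Sum>j<N. h j) \<le> 2 * \<theta> * real g + 8 / \<gamma> * (\<Sum>l<K. ls0 l) + p"
      and S: "\<And>S. (\<forall>j<N. z0 j \<le> S j) \<Longrightarrow> (\<forall>l<K. \<forall>j<N. iter \<sigma> l j \<le> S j) \<Longrightarrow> (\<forall>j<N. weight \<sigma> j \<le> S j + h j)"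
      using wb unfolding weight_bound_def K_def by blast
    define p' where "p' = (\<Sum>j<N. max 0 (c1 j - 8 * \<omega>1 j))"
    define h' where "h' j = h j + max 0 (c1 j - 8 * \<omega>1 j)" for j
    have c1Z: "c1 \<in> Z" unfolding c1_def by (rule gibbs_Z) (rule geo_pos)
    have p'0: "0 \<le> p'" unfolding p'_def by (intro sum_nonneg) auto
    have p'2: "p' \<le> 2"
    proof -
      have "p' \<le> (\<Sum>j<N. c1 j)" unfolding p'_def
        using Z_nonneg[OF c1Z] w1p by (intro sum_mono) (auto simp: less_imp_le)
      then show ?thesis using Z_sum[OF c1Z] by simp
    qed
    have p'k: "p' = 0 \<or> \<gamma> / 2 \<le> slack it (Suc K)"
    proof (cases "\<exists>j<N. 8 * \<omega>1 j < c1 j")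
      case True
      then obtain j where "j < N" "8 * \<omega>1 j < c1 j" by blast
      then show ?thesis
        using base_excess[OF g1 order_refl om1] unfolding c1_def by blast
    next
      case False
      then have "c1 j \<le> 8 * \<omega>1 j" if "j < N" for j using that by (meson not_le)
      then have "p' = 0" unfolding p'_def by (intro sum.neutral) simp
      then show ?thesis ..
    qed
    \<comment> \<open>The centre of the step just accepted is paid for by the loss of that step.\<close>
    have "p \<le> 8 / \<gamma> * loss \<sigma> a"
    proof (cases "p = 0")
      case True then show ?thesis using lp(3) gamma_pos by simp
    next
      case False
      then have "\<gamma> / 4 \<le> loss \<sigma> a" using p(3) lp(2) by linarith
      then have "8 / \<gamma> * (\<gamma> / 4) \<le> 8 / \<gamma> * loss \<sigma> a" using gamma_pos by (intro mult_left_mono) auto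
      then show ?thesis using p(2) gamma_pos by simp
    qed
    then have "(\<Sum>j<N. h' j) \<le> 2 * \<theta> * real g + 8 / \<gamma> * (\<Sum>l<Suc K. ls l) + p'"
      using hs unfolding h'_def sum.distrib p'_def[symmetric] sum_ls distrib_left by linarith
    moreover have "0 \<le> h' j" if "j < N" for j using h[OF that] by (simp add: h'_def)
    moreover have "\<forall>j<N. \<omega> j \<le> S j + h' j"
      if S1: "\<forall>j<N. z0 j \<le> S j" "\<forall>l<Suc K. \<forall>j<N. it l j \<le> S j" for S
    proof (intro allI impI)
      fix j assume j: "j < N"
      have "\<forall>l<K. \<forall>j<N. iter \<sigma> l j \<le> S j" using S1(2) itK(2) by (metis less_Suc_eq)
      then have "weight \<sigma> j \<le> S j + h j" using S[OF S1(1)] j by blast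
      moreover have "w j \<le> S j" using S1(2) j itK(1) by (metis lessI)
      ultimately have "\<omega>1 j \<le> S j + h j" using h[OF j] by (simp add: \<omega>1_def)
      then show "\<omega> j \<le> S j + h' j" by (simp add: \<omega>_def inject_def h'_def)
    qed
    ultimately show ?thesis unfolding weight_bound_def L using p'0 p'2 p'k by blast
  qed
  show ?thesis unfolding invariant_def using c' e' r' w' by blast
qed

text \<open>The total loss is bounded by comparing with the average \<open>u\<close> of the trial points
  themselves, for which the bilinear term vanishes by skewness.\<close>
lemma invariant_consequences:
  assumes inv: "invariant \<sigma> g" and D: "\<forall>u\<in>Z. kl N u z0 \<le> D" and D0: "0 \<le> D"
  shows "u \<in> Z \<Longrightarrow> - ip N (mat_app N B (total \<sigma>)) u \<le> real (I + 1) * \<gamma> * D"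
    and "real (steps \<sigma>) \<le> time \<sigma> + 16 * real (I + 1) * D / \<theta>"
    and "0 < time \<sigma> \<Longrightarrow> (\<lambda>j. total \<sigma> j / time \<sigma>) \<in> Z"
    and "steps \<sigma> < 2 ^ I \<Longrightarrow> (\<Sum>j<N. weight \<sigma> j)
        \<le> weight_cap (real (I + 1)) D - 1 + 2 * \<theta> * real g"
    and "real g * \<gamma>\<^sup>2 / 512 \<le> 4 * (\<Sum>j<N. weight \<sigma> j)\<^sup>2"
    and "0 \<le> (\<Sum>j<N. weight \<sigma> j)"
proof -
  obtain ls where c: "consistent \<sigma>" and energy: "energy_bound \<sigma> g" and rg: "regret_bound \<sigma> ls" and wb: "weight_bound \<sigma> g ls"
    using inv unfolding invariant_def by blast
  note rr = rg[unfolded regret_bound_def]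
  define K where "K = steps \<sigma>"
  have g: "good (iter \<sigma>) K" using c by (simp add: consistent_def K_def)
  have ls0: "0 \<le> ls s" if "s < K" for s using rr that by (simp add: K_def)
  have lsum0: "0 \<le> (\<Sum>s<K. ls s)" using ls0 by (intro sum_nonneg) auto
  have tele: "- ip N (mat_app N B (total \<sigma>)) u + (\<Sum>s<K. ls s) \<le> real (I + 1) * \<gamma> * D" if u: "u \<in> Z" for u
  proof -
    have "- ip N (mat_app N B (total \<sigma>)) u + (\<Sum>s<K. ls s) \<le> (\<Sum>s<K. Kreg (iter \<sigma>) s u - Gam * kl N u (iter \<sigma> s))"
      using rr u by (simp add: K_def)
    also have "\<dots> \<le> real (I + 1) * \<gamma> * kl N u z0" using g u by (rule all_levels_telescope)
    also have "\<dots> \<le> real (I + 1) * \<gamma> * D" using D u gamma_pos by (intro mult_left_mono) auto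
    finally show ?thesis .
  qed
  then show "u \<in> Z \<Longrightarrow> - ip N (mat_app N B (total \<sigma>)) u \<le> real (I + 1) * \<gamma> * D"
    using lsum0 by force
  show avg: "(\<lambda>j. total \<sigma> j / time \<sigma>) \<in> Z" if "0 < time \<sigma>"
    using rr that by (auto simp: Z_def sum_divide_distrib[symmetric])
  have lsum: "(\<Sum>s<K. ls s) \<le> real (I + 1) * \<gamma> * D"
  proof (cases "0 < time \<sigma>")
    case True
    have "ip N (mat_app N B (total \<sigma>)) (\<lambda>j. total \<sigma> j / time \<sigma>) = (1 / time \<sigma>) * ip N (mat_app N B (total \<sigma>)) (total \<sigma>)"
      unfolding ip_scale_right[symmetric] by simp
    then have "ip N (mat_app N B (total \<sigma>)) (\<lambda>j. total \<sigma> j / time \<sigma>) = 0" by (simp add: skew_ip_self[OF B_skew])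
    then show ?thesis using tele[OF avg[OF True]] by simp
  next
    case False
    then have "K = 0" using rr unfolding K_def by blast
    then show ?thesis using gamma_pos D0 by simp
  qed
  show "real (steps \<sigma>) \<le> time \<sigma> + 16 * real (I + 1) * D / \<theta>"
  proof -
    have "real (steps \<sigma>) \<le> time \<sigma> + 16 / (\<gamma> * \<theta>) * (\<Sum>s<K. ls s)" using rr by (simp add: K_def)
    also have "16 / (\<gamma> * \<theta>) * (\<Sum>s<K. ls s) \<le> 16 / (\<gamma> * \<theta>) * (real (I + 1) * \<gamma> * D)"
      using lsum gamma_pos theta_pos by (intro mult_left_mono) auto
    also have "\<dots> = 16 * real (I + 1) * D / \<theta>" using gamma_pos theta_pos by (simp add: field_simps)
    finally show ?thesis by simp
  qed
  show "(\<Sum>j<N. weight \<sigma> j)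
        \<le> weight_cap (real (I + 1)) D - 1 + 2 * \<theta> * real g"
    if KI: "steps \<sigma> < 2 ^ I"
  proof -
    have H: "(\<Sum>s<K. hellinger N (iter \<sigma> s) (anchor (iter \<sigma>) i s)) \<le> 2 ^ i * (4 * real (I + 1) * D)" if i: "i \<le> I" for i
    proof -
      have "gam i * hellinger N (iter \<sigma> s) (anchor (iter \<sigma>) i s) \<le> 4 * ls s" if s: "s < K" for s
      proof -
        have "gam i * hellinger N (iter \<sigma> s) (anchor (iter \<sigma>) i s) \<le> (\<Sum>i\<le>I. gam i * hellinger N (iter \<sigma> s) (anchor (iter \<sigma>) i s))"
          using i gam_pos hellinger_nonneg by (intro member_le_sum) (auto simp: less_imp_le)
        then show ?thesis using rr s by (force simp: K_def)
      qed
      then have "(\<Sum>s<K. gam i * hellinger N (iter \<sigma> s) (anchor (iter \<sigma>) i s)) \<le> (\<Sum>s<K. 4 * ls s)"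
        by (intro sum_mono) auto
      also have "\<dots> \<le> 4 * (real (I + 1) * \<gamma> * D)" using lsum by (simp add: sum_distrib_left[symmetric])
      finally have "\<gamma> * (\<Sum>s<K. hellinger N (iter \<sigma> s) (anchor (iter \<sigma>) i s)) \<le> \<gamma> * (2 ^ i * (4 * real (I + 1) * D))"
        unfolding sum_distrib_left[symmetric] gam_def by (simp add: field_simps)
      then show ?thesis using gamma_pos by simp
    qed
    obtain S where S: "\<forall>s<K. \<forall>j<N. iter \<sigma> s j \<le> S j" "\<forall>j<N. z0 j \<le> S j"
      "(\<Sum>j<N. S j) \<le> 3 * (2 + real (I + 1) * (2 + 96 * (4 * real (I + 1) * D) * (real (I + 1))\<^sup>2))"
      using envelope[OF g KI[folded K_def] H] by blast
    obtain h p where p: "p \<le> 2" and hs: "(\<Sum>j<N. h j) \<le> 2 * \<theta> * real g + 8 / \<gamma> * (\<Sum>s<K. ls s) + p"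
      and W: "\<forall>j<N. weight \<sigma> j \<le> S j + h j"
      using wb S unfolding weight_bound_def K_def by blast
    have "8 / \<gamma> * (\<Sum>s<K. ls s) \<le> 8 / \<gamma> * (real (I + 1) * \<gamma> * D)"
      using lsum gamma_pos by (intro mult_left_mono) auto
    also have "\<dots> = 8 * real (I + 1) * D" using gamma_pos by simp
    finally have "(\<Sum>j<N. h j) \<le> 2 * \<theta> * real g + 8 * real (I + 1) * D + 2" using hs p by linarith
    moreover have "(\<Sum>j<N. weight \<sigma> j) \<le> (\<Sum>j<N. S j) + (\<Sum>j<N. h j)"
      unfolding sum.distrib[symmetric] using W by (intro sum_mono) auto
    ultimately show ?thesis using S(3) unfolding weight_cap_def by linarith
  qed
  have wp: "0 \<le> weight \<sigma> j" if "j < N" for j using weight_pos[OF c that] by simp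
  then have "0 \<le> energy N (weight \<sigma>) (\<lambda>j k. B j k - model \<sigma> j k)" by (intro energy_nonneg)
  then show "real g * \<gamma>\<^sup>2 / 512 \<le> 4 * (\<Sum>j<N. weight \<sigma> j)\<^sup>2"
    using energy unfolding energy_bound_def by linarith
  show "0 \<le> (\<Sum>j<N. weight \<sigma> j)" using wp by (intro sum_nonneg) auto
qed

end

section \<open>Playing the method as a query strategy\<close>

text \<open>What the next answer will be used for: the image of the uniform point, of the trial point, or of
  the corrector.\<close>
datatype phase = Initial | Probing core | Correcting core "nat \<Rightarrow> real"

context two_simplices begin

definition xpart :: "(nat \<Rightarrow> real) \<Rightarrow> real vec" where "xpart z = vec n z"
definition ypart :: "(nat \<Rightarrow> real) \<Rightarrow> real vec" where "ypart z = vec m (\<lambda>i. z (n + i))"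

text \<open>An answer \<open>(A\<^sup>T y, A x)\<close> read as \<open>B z\<close>.\<close>
definition decode :: "real vec \<times> real vec \<Rightarrow> nat \<Rightarrow> real" where
  "decode a j = (if j < n then fst a $ j else if j < N then - (snd a $ (j - n)) else 0)"

definition game_matrix :: "real mat \<Rightarrow> nat \<Rightarrow> nat \<Rightarrow> real" where
  "game_matrix A j k = (if j < n \<and> n \<le> k \<and> k < N then A $$ (k - n, j)
     else if n \<le> j \<and> j < N \<and> k < n then - A $$ (j - n, k) else 0)"

lemma upper_less: "n + i < N \<longleftrightarrow> i < m"
  by (simp add: N_eq)

lemma upper_index: "n \<le> j \<Longrightarrow> j < N \<Longrightarrow> j - n < m"
  by (simp add: N_eq)

lemma sum_upper_block: "(\<Sum>j=n..<N. f j) = (\<Sum>i<m. f (n + i))" for f :: "nat \<Rightarrow> real"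
  using sum.shift_bounds_nat_ivl[of f 0 n m] N_eq by (simp add: lessThan_atLeast0 add.commute)

lemma xpart_simplex: "z \<in> Z \<Longrightarrow> xpart z \<in> simplex n"
  by (auto simp: simplex_def xpart_def Z_def)

lemma ypart_simplex: "z \<in> Z \<Longrightarrow> ypart z \<in> simplex m"
  using sum_upper_block[of z] by (auto simp: simplex_def ypart_def Z_def)

lemma game_matrix_skew: "skew N (game_matrix A)"
  by (rule skewI) (auto simp: game_matrix_def)

lemma game_matrix_bounded:
  assumes "\<forall>i<m. \<forall>j<n. \<bar>A $$ (i, j)\<bar> \<le> 1"
  shows "\<bar>game_matrix A j k\<bar> \<le> 1"
  using assms upper_index by (auto simp: game_matrix_def)

lemma decode_matvec:
  assumes A: "A \<in> carrier_mat m n" and j: "j < N"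
  shows "decode (matvec A (xpart z) (ypart z)) j = mat_app N (game_matrix A) z j"
proof (cases "j < n")
  case True
  have "mat_app N (game_matrix A) z j = (\<Sum>k<n. game_matrix A j k * z k) + (\<Sum>i<m. game_matrix A j (n + i) * z (n + i))"
    unfolding mat_app_def sum_N sum_upper_block ..
  also have "\<dots> = (\<Sum>i<m. A $$ (i, j) * z (n + i))"
    using True by (simp add: game_matrix_def upper_less)
  also have "\<dots> = (transpose_mat A *\<^sub>v ypart z) $ j"
    using True A by (auto simp: ypart_def scalar_prod_def lessThan_atLeast0 intro!: sum.cong)
  finally show ?thesis using True by (simp add: decode_def matvec_def)
next
  case False
  define i where "i = j - n"
  have i: "i < m" "j = n + i" using False upper_index[OF _ j] by (auto simp: i_def)
  have "mat_app N (game_matrix A) z j = (\<Sum>k<n. game_matrix A j k * z k) + (\<Sum>i<m. game_matrix A j (n + i) * z (n + i))"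
    unfolding mat_app_def sum_N sum_upper_block ..
  also have "\<dots> = (\<Sum>k<n. - (A $$ (i, k) * z k))"
    using False j by (simp add: game_matrix_def i_def)
  also have "\<dots> = - (A *\<^sub>v xpart z) $ i"
    using i A by (auto simp: xpart_def scalar_prod_def lessThan_atLeast0 sum_negf intro!: sum.cong)
  finally show ?thesis using False j by (simp add: decode_def matvec_def i_def)
qed

definition joint :: "real vec \<Rightarrow> real vec \<Rightarrow> nat \<Rightarrow> real" where
  "joint x y j = (if j < n then x $ j else if j < N then y $ (j - n) else 0)"

lemma joint_Z:
  assumes "x \<in> simplex n" "y \<in> simplex m"
  shows "joint x y \<in> Z"
  using assms n_less_N upper_index by (auto simp: Z_def sum_upper_block joint_def simplex_def upper_less)

lemma payoff_difference:
  assumes A: "A \<in> carrier_mat m n" and x: "x \<in> simplex n" and y: "y \<in> simplex m"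
  shows "- ip N (mat_app N (game_matrix A) z) (joint x y) = y \<bullet> (A *\<^sub>v xpart z) - ypart z \<bullet> (A *\<^sub>v x)"
proof -
  have dx: "dim_vec x = n" "dim_vec y = m" using x y by (auto simp: simplex_def)
  have "ip N (mat_app N (game_matrix A) z) (joint x y) = (\<Sum>j<n. mat_app N (game_matrix A) z j * x $ j)
      + (\<Sum>i<m. mat_app N (game_matrix A) z (n + i) * y $ i)"
    unfolding ip_def sum_N sum_upper_block using n_less_N by (simp add: joint_def upper_less)
  also have "(\<Sum>j<n. mat_app N (game_matrix A) z j * x $ j) = (\<Sum>j<n. (\<Sum>i<m. A $$ (i, j) * z (n + i)) * x $ j)"
  proof (intro sum.cong refl)
    fix j assume j: "j \<in> {..<n}"
    then have "mat_app N (game_matrix A) z j = decode (matvec A (xpart z) (ypart z)) j"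
      using decode_matvec[OF A, of j z] n_less_N by simp
    also have "\<dots> = (\<Sum>i<m. A $$ (i, j) * z (n + i))"
      using j A by (auto simp: decode_def matvec_def ypart_def scalar_prod_def lessThan_atLeast0 intro!: sum.cong)
    finally show "mat_app N (game_matrix A) z j * x $ j = (\<Sum>i<m. A $$ (i, j) * z (n + i)) * x $ j" by simp
  qed
  also have "\<dots> = (\<Sum>i<m. \<Sum>j<n. A $$ (i, j) * z (n + i) * x $ j)"
    unfolding sum_distrib_right by (rule sum.swap)
  also have "\<dots> = ypart z \<bullet> (A *\<^sub>v x)"
    using A dx by (auto simp: ypart_def scalar_prod_def lessThan_atLeast0 sum_distrib_left mult_ac intro!: sum.cong)
  also have "(\<Sum>i<m. mat_app N (game_matrix A) z (n + i) * y $ i) = - (y \<bullet> (A *\<^sub>v xpart z))"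
  proof -
    have "mat_app N (game_matrix A) z (n + i) = - (A *\<^sub>v xpart z) $ i" if "i < m" for i
      using decode_matvec[OF A, of "n + i" z] that by (simp add: decode_def matvec_def upper_less)
    then have "(\<Sum>i<m. mat_app N (game_matrix A) z (n + i) * y $ i) = (\<Sum>i<m. - (y $ i * (A *\<^sub>v xpart z) $ i))"
      by (intro sum.cong) auto
    then show ?thesis using A by (simp add: scalar_prod_def lessThan_atLeast0 sum_negf)
  qed
  finally show ?thesis by simp
qed

lemma eps_solution_if_small_regret:
  assumes A: "A \<in> carrier_mat m n" and z: "z \<in> Z"
    and gap: "\<And>u. u \<in> Z \<Longrightarrow> - ip N (mat_app N (game_matrix A) z) u \<le> \<epsilon>"
  shows "eps_solution A \<epsilon> (xpart z) (ypart z)"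
proof -
  have d: "dim_row A = m" "dim_col A = n" using A by auto
  have pd: "y \<bullet> (A *\<^sub>v xpart z) - ypart z \<bullet> (A *\<^sub>v x) \<le> \<epsilon>" if "x \<in> simplex n" "y \<in> simplex m" for x y
    using gap[OF joint_Z[OF that]] payoff_difference[OF A that] by simp
  have ne: "xpart z \<in> simplex n" "ypart z \<in> simplex m" using z by (auto intro: xpart_simplex ypart_simplex)
  have "(SUP y\<in>simplex m. y \<bullet> (A *\<^sub>v xpart z)) - \<epsilon> \<le> (INF x\<in>simplex n. ypart z \<bullet> (A *\<^sub>v x))"
  proof (rule cINF_greatest)
    fix x assume x: "x \<in> simplex n"
    have "(SUP y\<in>simplex m. y \<bullet> (A *\<^sub>v xpart z)) \<le> \<epsilon> + ypart z \<bullet> (A *\<^sub>v x)"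
    proof (rule cSUP_least)
      fix y assume "y \<in> simplex m"
      then show "y \<bullet> (A *\<^sub>v xpart z) \<le> \<epsilon> + ypart z \<bullet> (A *\<^sub>v x)" using pd[OF x] by force
    qed (use ne in auto)
    then show "(SUP y\<in>simplex m. y \<bullet> (A *\<^sub>v xpart z)) - \<epsilon> \<le> ypart z \<bullet> (A *\<^sub>v x)" by simp
  qed (use ne in auto)
  then show ?thesis using ne unfolding eps_solution_def duality_gap_def d by simp
qed

end

context scheme begin

fun react :: "phase \<Rightarrow> (nat \<Rightarrow> real) \<Rightarrow> phase" where
  "react Initial a = Probing (start a)"
| "react (Probing \<sigma>) a = Correcting \<sigma> a"
| "react (Correcting \<sigma> a) a' = Probing (if guilty \<sigma> a then learn \<sigma> a else advance \<sigma> a a')"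

fun query_point :: "phase \<Rightarrow> nat \<Rightarrow> real" where
  "query_point Initial = z0"
| "query_point (Probing \<sigma>) = snd (probe \<sigma>)"
| "query_point (Correcting \<sigma> a) = snd (corrector \<sigma> a)"

definition current_phase :: "(real vec \<times> real vec) list \<Rightarrow> phase" where
  "current_phase h = foldl (\<lambda>p a. react p (decode a)) Initial h"

definition average :: "core \<Rightarrow> nat \<Rightarrow> real" where
  "average \<sigma> j = total \<sigma> j / time \<sigma>"

definition finished :: "real \<Rightarrow> phase \<Rightarrow> core option" where
  "finished T p = (case p of Probing \<sigma> \<Rightarrow> if T \<le> time \<sigma> then Some \<sigma> else None | _ \<Rightarrow> None)"

definition strategy :: "real \<Rightarrow> strategy" where
  "strategy T h = (let p = current_phase h in case finished T p of
      Some \<sigma> \<Rightarrow> Output (xpart (average \<sigma>)) (ypart (average \<sigma>))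
    | None \<Rightarrow> Query (xpart (query_point p)) (ypart (query_point p)))"

lemma current_phase_snoc: "current_phase (h @ [a]) = react (current_phase h) (decode a)"
  by (simp add: current_phase_def)

lemma transcript_snoc:
  assumes h: "transcript (strategy T) A h" and A: "A \<in> carrier_mat m n"
    and nf: "finished T (current_phase h) = None" and q: "query_point (current_phase h) \<in> Z"
  obtains h' where "transcript (strategy T) A h'" "length h' = Suc (length h)"
    "\<And>j. j < N \<Longrightarrow> decode (last h') j = mat_app N (game_matrix A) (query_point (current_phase h)) j"
    "current_phase h' = react (current_phase h) (decode (last h'))"
proof
  define z where "z = query_point (current_phase h)"
  define h' where "h' = h @ [matvec A (xpart z) (ypart z)]"
  have "strategy T h = Query (xpart z) (ypart z)" unfolding strategy_def Let_def nf z_def by simp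
  then show "transcript (strategy T) A h'"
    unfolding h'_def using h q A xpart_simplex[of z] ypart_simplex[of z] by (intro transcript.query) (auto simp: z_def)
  show "length h' = Suc (length h)" by (simp add: h'_def)
  show "decode (last h') j = mat_app N (game_matrix A) (query_point (current_phase h)) j" if "j < N" for j
    using decode_matvec[OF A that] by (simp add: h'_def z_def)
  show "current_phase h' = react (current_phase h) (decode (last h'))"
    by (simp add: h'_def current_phase_snoc)
qed

text \<open>Every trial is either accepted or a correction, so their number is the number of accepted steps
  plus the number \<open>g\<close> of corrections. As long as \<open>g \<le> G + 1\<close> the corrections
  have injected mass at most \<open>1\<close>, which keeps the total weight below \<open>W\<close>, and the
  energy then yields \<open>g \<le> G\<close>. So \<open>g\<close> cannot pass \<open>G\<close>, and the
  accumulated step length must reach \<open>T\<close>.\<close>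
lemma strategy_terminates:
  fixes A :: "real mat" and T D :: real
  defines "G \<equiv> guilt_cap (real (I + 1)) D \<gamma>"
  assumes A: "A \<in> carrier_mat m n" and Ab: "\<forall>i<m. \<forall>j<n. \<bar>A $$ (i, j)\<bar> \<le> 1"
    and D: "\<forall>u\<in>Z. kl N u z0 \<le> D" "0 \<le> D" and T: "0 < T"
    and th: "2 * \<theta> * (G + 1) \<le> 1" and levels: "T + 1 + 16 * real (I + 1) * D / \<theta> < 2 ^ I"
  shows "\<exists>q x y. returns (strategy T) A q x y \<and> eps_solution A (real (I + 1) * \<gamma> * D / T) x y
    \<and> real q \<le> 1 + 2 * (T + 1 + 16 * real (I + 1) * D / \<theta> + G)"
proof -
  define B where "B = game_matrix A"
  interpret game n m N \<gamma> I \<theta> B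
    by unfold_locales (auto simp: B_def game_matrix_skew game_matrix_bounded[OF Ab])
  define W where "W = weight_cap (real (I + 1)) D"
  have G: "G = 2048 * W\<^sup>2 / \<gamma>\<^sup>2" by (simp add: G_def guilt_cap_def W_def)
  define X where "X = T + 1 + 16 * real (I + 1) * D / \<theta>"
  define run where "run t h \<sigma> g \<longleftrightarrow> transcript (strategy T) A h \<and> length h = 1 + 2 * t \<and>
    current_phase h = Probing \<sigma> \<and> invariant \<sigma> g \<and> steps \<sigma> + g = t \<and> time \<sigma> \<le> T + 1 \<and> real g \<le> G" for t h \<sigma> g
  have bound_g: "real g \<le> G" if inv: "invariant \<sigma> g" and ti: "time \<sigma> \<le> T + 1" and g: "real g \<le> G + 1" for \<sigma> g
  proof -
    note co = invariant_consequences[OF inv D]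
    have "real (steps \<sigma>) < 2 ^ I" using co(2) ti levels by linarith
    then have "steps \<sigma> < 2 ^ I" by (metis of_nat_less_iff of_nat_numeral of_nat_power)
    moreover have "2 * \<theta> * real g \<le> 2 * \<theta> * (G + 1)" using g theta_pos by (intro mult_left_mono) auto
    ultimately have "(\<Sum>j<N. weight \<sigma> j) \<le> W" using co(4) th unfolding W_def by linarith
    then have "(\<Sum>j<N. weight \<sigma> j)\<^sup>2 \<le> W\<^sup>2" using co(6) by (intro power_mono) auto
    then have "real g * \<gamma>\<^sup>2 / 512 \<le> 4 * W\<^sup>2" using co(5) by linarith
    then have "real g * \<gamma>\<^sup>2 \<le> 2048 * W\<^sup>2" by simp
    then show ?thesis unfolding G using gamma_pos by (simp add: pos_le_divide_eq)
  qed
  have step: "\<exists>h' \<sigma>' g'. run (Suc t) h' \<sigma>' g'" if r: "run t h \<sigma> g" and ti: "time \<sigma> < T" for t h \<sigma> g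
  proof -
    have h: "transcript (strategy T) A h" "length h = 1 + 2 * t" "current_phase h = Probing \<sigma>"
      "invariant \<sigma> g" "steps \<sigma> + g = t" "real g \<le> G" using r by (auto simp: run_def)
    have c: "consistent \<sigma>" using h(4) by (simp add: invariant_def)
    obtain h1 where h1: "transcript (strategy T) A h1" "length h1 = Suc (length h)"
      "\<And>j. j < N \<Longrightarrow> decode (last h1) j = mat_app N B (snd (probe \<sigma>)) j"
      "current_phase h1 = Correcting \<sigma> (decode (last h1))"
    proof (rule transcript_snoc[OF h(1) A])
      show "finished T (current_phase h) = None" using h(3) ti by (simp add: finished_def)
      show "query_point (current_phase h) \<in> Z" using h(3) probe_props(6)[OF c] by simp
    qed (use h(3) that in \<open>simp add: B_def\<close>)
    define a where "a = decode (last h1)"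
    obtain h2 where h2: "transcript (strategy T) A h2" "length h2 = Suc (length h1)"
      "\<And>j. j < N \<Longrightarrow> decode (last h2) j = mat_app N B (snd (corrector \<sigma> a)) j"
      "current_phase h2 = Probing (if guilty \<sigma> a then learn \<sigma> a else advance \<sigma> a (decode (last h2)))"
    proof (rule transcript_snoc[OF h1(1) A])
      show "finished T (current_phase h1) = None" using h1(4) by (simp add: finished_def)
      show "query_point (current_phase h1) \<in> Z" using h1(4) corrector_props(6)[OF c] by simp
    qed (use h1(4) that in \<open>simp add: B_def a_def\<close>)
    have len: "length h2 = 1 + 2 * Suc t" using h1(2) h2(2) h(2) by simp
    show ?thesis
    proof (cases "guilty \<sigma> a")
      case True
      have i: "invariant (learn \<sigma> a) (Suc g)" using h(4) h1(3) True unfolding a_def by (rule learn_invariant)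
      have "steps (learn \<sigma> a) = steps \<sigma>" "time (learn \<sigma> a) = time \<sigma>" by (simp_all add: learn_def Let_def)
      then have "run (Suc t) h2 (learn \<sigma> a) (Suc g)"
        unfolding run_def using h2(1,4) len True i h(5,6) ti bound_g[OF i] by simp
      then show ?thesis by blast
    next
      case False
      define \<sigma>' where "\<sigma>' = advance \<sigma> a (decode (last h2))"
      have i: "invariant \<sigma>' g" unfolding \<sigma>'_def
        using h(4) h1(3)[folded a_def] False h2(3) by (rule advance_invariant)
      have "steps \<sigma>' = Suc (steps \<sigma>)" "time \<sigma>' = time \<sigma> + fst (corrector \<sigma> a)"
        by (simp_all add: \<sigma>'_def advance_def Let_def)
      moreover have "fst (corrector \<sigma> a) \<le> 1"
        using corrector_props(2)[OF c, of a] probe_props(2)[OF c] by linarith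
      ultimately have "run (Suc t) h2 \<sigma>' g"
        unfolding run_def using h2(1,4) len False i h(5,6) ti by (simp add: \<sigma>'_def)
      then show ?thesis by blast
    qed
  qed
  have G0: "0 \<le> G" unfolding G by simp
  have "\<exists>h \<sigma> g. run 0 h \<sigma> g"
  proof -
    have "transcript (strategy T) A []" by (rule transcript.start)
    then obtain h where h: "transcript (strategy T) A h" "length h = Suc (length [])"
      "\<And>j. j < N \<Longrightarrow> decode (last h) j = mat_app N B z0 j" "current_phase h = Probing (start (decode (last h)))"
    proof (rule transcript_snoc[OF _ A])
      show "finished T (current_phase []) = None" by (simp add: finished_def current_phase_def)
      show "query_point (current_phase []) \<in> Z" by (simp add: current_phase_def z0_Z)
    qed (use that in \<open>simp add: B_def current_phase_def\<close>)
    then have "run 0 h (start (decode (last h))) 0"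
      unfolding run_def using start_invariant[OF h(3)] G0 T by (simp add: start_def)
    then show ?thesis by blast
  qed
  then have alternatives: "(\<exists>h \<sigma> g. run t h \<sigma> g) \<or> (\<exists>t' h \<sigma> g. run t' h \<sigma> g \<and> T \<le> time \<sigma>)" for t
    by (induction t) (blast, meson step not_le)
  have size: "real t \<le> X + G" if "run t h \<sigma> g" for t h \<sigma> g
  proof -
    have r: "invariant \<sigma> g" "steps \<sigma> + g = t" "time \<sigma> \<le> T + 1" "real g \<le> G" using that by (auto simp: run_def)
    have "real t = real (steps \<sigma>) + real g" using r(2) by simp
    then show ?thesis using invariant_consequences(2)[OF r(1) D] r(3,4) unfolding X_def by linarith
  qed
  have "\<not> (\<exists>h \<sigma> g. run (nat \<lceil>X + G\<rceil> + 1) h \<sigma> g)"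
  proof
    assume "\<exists>h \<sigma> g. run (nat \<lceil>X + G\<rceil> + 1) h \<sigma> g"
    then have "real (nat \<lceil>X + G\<rceil> + 1) \<le> X + G" using size by blast
    then show False by linarith
  qed
  then obtain t h \<sigma> g where r: "run t h \<sigma> g" "T \<le> time \<sigma>" using alternatives by blast
  have inv: "invariant \<sigma> g" and h: "transcript (strategy T) A h" "length h = 1 + 2 * t" "current_phase h = Probing \<sigma>"
    using r(1) by (auto simp: run_def)
  note co = invariant_consequences[OF inv D]
  have tp: "0 < time \<sigma>" using r(2) T by linarith
  have aZ: "average \<sigma> \<in> Z" using co(3)[OF tp] unfolding average_def[abs_def] .
  have "eps_solution A (real (I + 1) * \<gamma> * D / T) (xpart (average \<sigma>)) (ypart (average \<sigma>))"
  proof (rule eps_solution_if_small_regret[OF A aZ])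
    fix u assume u: "u \<in> Z"
    have "average \<sigma> = (\<lambda>j. (1 / time \<sigma>) * total \<sigma> j)" by (rule ext) (simp add: average_def)
    then have "ip N (mat_app N B (average \<sigma>)) u = (1 / time \<sigma>) * ip N (mat_app N B (total \<sigma>)) u"
      by (simp only: mat_app_scale[abs_def] ip_scale_left)
    then have "- ip N (mat_app N B (average \<sigma>)) u = (- ip N (mat_app N B (total \<sigma>)) u) / time \<sigma>" by simp
    also have "\<dots> \<le> (real (I + 1) * \<gamma> * D) / time \<sigma>" using co(1)[OF u] tp by (intro divide_right_mono) auto
    also have "\<dots> \<le> real (I + 1) * \<gamma> * D / T"
      using r(2) T gamma_pos D(2) by (intro divide_left_mono) auto
    finally show "- ip N (mat_app N (game_matrix A) (average \<sigma>)) u \<le> real (I + 1) * \<gamma> * D / T" by (simp add: B_def)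
  qed
  moreover have "strategy T h = Output (xpart (average \<sigma>)) (ypart (average \<sigma>))"
    unfolding strategy_def Let_def h(3) finished_def using r(2) by simp
  then have "returns (strategy T) A (1 + 2 * t) (xpart (average \<sigma>)) (ypart (average \<sigma>))"
    unfolding returns_def using h by blast
  moreover have "real (1 + 2 * t) \<le> 1 + 2 * (X + G)" using size[OF r(1)] by simp
  ultimately show ?thesis unfolding X_def by blast
qed

end

section \<open>Choice of the parameters\<close>

lemma exponential_beats_power:
  "\<exists>J0. \<forall>J\<ge>J0. c * (2 * real J + 1) ^ 12 < 2 ^ J"
proof -
  \<comment> \<open>The twelfth power of \<open>J y\<^sup>J \<longlonglongrightarrow> 0\<close> is the claim up to a constant.\<close>
  define y where "y = root 12 (1 / 2 :: real)"
  have y: "0 \<le> y" "y < 1" "y ^ 12 = 1 / 2"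
    by (simp_all add: y_def)
  have "(\<lambda>J. real J * y ^ J) \<longlonglongrightarrow> 0"
    using powser_times_n_limit_0[of y] y by simp
  then have "(\<lambda>J. \<bar>c\<bar> * 3 ^ 12 * (real J * y ^ J) ^ 12) \<longlonglongrightarrow> \<bar>c\<bar> * 3 ^ 12 * 0 ^ 12"
    by (intro tendsto_intros)
  then have "\<forall>\<^sub>F J in sequentially. \<bar>c\<bar> * 3 ^ 12 * (real J * y ^ J) ^ 12 < 1"
    by (rule order_tendstoD(2)) simp
  then obtain J1 where J1: "\<And>J. J \<ge> J1 \<Longrightarrow> \<bar>c\<bar> * 3 ^ 12 * (real J * y ^ J) ^ 12 < 1"
    by (auto simp: eventually_sequentially)
  have "c * (2 * real J + 1) ^ 12 < 2 ^ J" if J: "J \<ge> max J1 1" for J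
  proof -
    have yJ: "(y ^ J) ^ 12 = (1 / 2) ^ J" unfolding power_mult[symmetric] mult.commute[of J] by (simp only: power_mult y(3))
    have "\<bar>c\<bar> * 3 ^ 12 * real J ^ 12 * (1 / 2) ^ J < 1"
      using J1[of J] J unfolding power_mult_distrib yJ by (simp add: mult.assoc)
    then have "\<bar>c\<bar> * (3 ^ 12 * real J ^ 12) < 2 ^ J"
      by (simp add: power_one_over field_simps)
    moreover have "c * (2 * real J + 1) ^ 12 \<le> \<bar>c\<bar> * (3 * real J) ^ 12"
      using J by (intro mult_mono power_mono) auto
    ultimately show ?thesis unfolding power_mult_distrib by linarith
  qed
  then show ?thesis by blast
qed

text \<open>\<open>E\<close> stands for \<open>\<epsilon>\<^bsup>-2/3\<^esup>\<close>, the value of \<open>1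
  / \<gamma>\<^sup>2\<close>.\<close>
lemma parameter_bounds:
  fixes i D E :: real
  assumes i: "1 \<le> i" and D: "0 \<le> D" "D \<le> 2 * i" and E: "1 / 4 \<le> E"
  defines "W \<equiv> weight_cap i D"
  defines "G \<equiv> 2048 * W\<^sup>2 * E"
  shows "0 \<le> G" "i * D * E + 1 + 16 * i * D * (2 * (G + 1)) + G \<le> 10 ^ 12 * (i ^ 12 * E)"
proof -
  have E0: "0 \<le> E" using E by simp
  show G0: "0 \<le> G" unfolding G_def using E0 by simp
  have pw: "i ^ a \<le> i ^ b" if "a \<le> b" for a b using that i by (rule power_increasing)
  have iD: "i * D \<le> 2 * i ^ 2" using D i by (simp add: power2_eq_square mult_left_mono)
  have iD0: "0 \<le> i * D" using D i by simp
  have W: "W \<le> 2400 * i ^ 5"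
  proof -
    have "W = 9 + 6 * i + 1152 * (i * D) * i ^ 3 + 8 * (i * D)"
      unfolding W_def weight_cap_def by (simp add: power2_eq_square power3_eq_cube algebra_simps)
    also have "\<dots> \<le> 9 + 6 * i + 1152 * (2 * i ^ 2) * i ^ 3 + 8 * (2 * i ^ 2)"
      using iD i by (intro add_mono mult_left_mono mult_right_mono) auto
    also have "\<dots> = 9 + 6 * i ^ 1 + 2304 * i ^ 5 + 16 * i ^ 2" by (simp add: power_add[symmetric] mult.assoc)
    also have "\<dots> \<le> 2400 * i ^ 5" using pw[of 0 5] pw[of 1 5] pw[of 2 5] by simp
    finally show ?thesis .
  qed
  have W0: "0 \<le> W" unfolding W_def weight_cap_def using iD0 i D by simp
  have "W\<^sup>2 \<le> (2400 * i ^ 5)\<^sup>2" using W W0 by (intro power_mono) auto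
  also have "(2400 * i ^ 5)\<^sup>2 = 5760000 * i ^ 10" by (simp add: power_mult_distrib flip: power_mult)
  finally have "W\<^sup>2 \<le> 5760000 * i ^ 10" .
  moreover have "0 \<le> i ^ 10" using i by simp
  ultimately have "2048 * W\<^sup>2 \<le> 12000000000 * i ^ 10" by linarith
  then have G: "G \<le> 12000000000 * i ^ 10 * E" unfolding G_def using E0 by (intro mult_right_mono) auto
  have one: "1 \<le> 4 * (i ^ k * E)" for k
  proof -
    have "1 * (1 / 4) \<le> i ^ k * E" using i E by (intro mult_mono one_le_power) auto
    then show ?thesis by simp
  qed
  have pE: "i ^ a * E \<le> i ^ 12 * E" if "a \<le> 12" for a using pw[OF that] E0 by (intro mult_right_mono) auto
  have t1: "i * D * E \<le> 2 * (i ^ 12 * E)"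
  proof -
    have "i * D * E \<le> 2 * i ^ 2 * E" using iD E0 by (intro mult_right_mono) auto
    then show ?thesis using pE[of 2] by simp
  qed
  have G1: "G + 1 \<le> 12000000004 * (i ^ 10 * E)" using G one[of 10] by simp
  have "16 * (i * D) * (2 * (G + 1)) \<le> 16 * (2 * i ^ 2) * (2 * (12000000004 * (i ^ 10 * E)))"
  proof (rule mult_mono)
    show "16 * (i * D) \<le> 16 * (2 * i ^ 2)" using iD by linarith
  qed (use G1 G0 in auto)
  also have "\<dots> = 768000000256 * (i ^ 12 * E)" by (simp add: power_add[symmetric] mult.assoc[symmetric])
  finally have t2: "16 * i * D * (2 * (G + 1)) \<le> 768000000256 * (i ^ 12 * E)" by (simp add: mult.assoc)
  have t3: "G \<le> 12000000000 * (i ^ 12 * E)" using G pE[of 10] by simp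
  show "i * D * E + 1 + 16 * i * D * (2 * (G + 1)) + G \<le> 10 ^ 12 * (i ^ 12 * E)"
  proof -
    define P where "P = i ^ 12 * E"
    define S where "S = 16 * i * D * (2 * (G + 1))"
    have "i * D * E + 1 + S + G \<le> 1000000000000 * P"
      using t1 t2 t3 one[of 12] unfolding P_def[symmetric] S_def[symmetric] by linarith
    then show ?thesis unfolding P_def S_def by simp
  qed
qed

lemma (in game) regret_le_4:
  assumes "z \<in> Z" "u \<in> Z"
  shows "- ip N (mat_app N B z) u \<le> 4"
proof -
  have b: "\<bar>mat_app N B z j\<bar> \<le> 2" if "j < N" for j
  proof -
    have "\<bar>mat_app N B z j\<bar> \<le> (\<Sum>k<N. \<bar>B j k * z k\<bar>)" unfolding mat_app_def by (rule sum_abs)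
    also have "\<dots> \<le> (\<Sum>k<N. 1 * z k)"
      using B_bounded that Z_nonneg[OF assms(1)] by (intro sum_mono) (auto simp: abs_mult intro: mult_left_le_one_le)
    finally show ?thesis using Z_sum[OF assms(1)] by simp
  qed
  have "- ip N (mat_app N B z) u = (\<Sum>j<N. - mat_app N B z j * u j)" by (simp add: ip_def sum_negf)
  also have "\<dots> \<le> (\<Sum>j<N. 2 * u j)"
  proof (intro sum_mono mult_right_mono)
    fix j assume "j \<in> {..<N}"
    then show "- mat_app N B z j \<le> 2" using b[of j] by (simp add: abs_le_iff)
  qed (use Z_nonneg[OF assms(2)] in simp)
  also have "\<dots> = 4" using Z_sum[OF assms(2)] by (simp add: sum_distrib_left[symmetric])
  finally show ?thesis .
qed

text \<open>There are \<open>I = 2 J\<close> levels: one factor \<open>2\<^sup>J\<close> of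
  \<open>2\<^sup>I\<close> absorbs the polynomial in \<open>J\<close> and the other absorbs
  \<open>\<epsilon>\<^bsup>-2/3\<^esup>\<close>, so that fewer than \<open>2\<^sup>I\<close> steps are
  accepted. The threshold \<open>\<theta> = 1 / (2 (G + 1))\<close> lets all corrections together inject
  mass at most \<open>1\<close>, and the horizon is chosen such that the gap is at most
  \<open>\<epsilon>\<close>.\<close>
lemma strategy_solves:
  fixes A :: "real mat" and \<epsilon> :: real and J n m :: nat
  defines "i \<equiv> real (2 * J + 1)" and "\<gamma> \<equiv> \<epsilon> powr (1 / 3)"
  defines "D \<equiv> 2 * ln (2 + real n + real m + 1 / \<epsilon>)"
  defines "G \<equiv> guilt_cap i D \<gamma>"
  assumes nm: "0 < n" "0 < m" and eps: "0 < \<epsilon>" "\<epsilon> < 4"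
    and A: "A \<in> carrier_mat m n" "\<forall>i<m. \<forall>j<n. \<bar>A $$ (i, j)\<bar> \<le> 1"
    and J: "D \<le> real J" "10 ^ 12 * (2 * real J + 1) ^ 12 < (2::real) ^ J"
  shows "\<exists>q x y. returns (scheme.strategy n m (n + m) \<gamma> (2 * J) (1 / (2 * (G + 1))) (i * \<gamma> * D / \<epsilon>)) A q x y
    \<and> eps_solution A \<epsilon> x y \<and> real q \<le> 6 * 10 ^ 12 * (i ^ 12 * \<epsilon> powr (- 2 / 3))"
proof -
  define E where "E = \<epsilon> powr (- 2 / 3)"
  have g2: "\<gamma>\<^sup>2 * E = 1" "\<gamma> = E * \<epsilon>" "0 < \<gamma>" "0 < E"
  proof -
    have "\<gamma>\<^sup>2 = \<epsilon> powr (2 / 3)"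
      unfolding \<gamma>_def power2_eq_square powr_add[symmetric] by simp
    then show "\<gamma>\<^sup>2 * E = 1" using eps by (simp add: E_def powr_add[symmetric])
    have "E * \<epsilon> powr 1 = \<gamma>" unfolding E_def \<gamma>_def powr_add[symmetric] by simp
    then show "\<gamma> = E * \<epsilon>" using eps by simp
    show "0 < \<gamma>" "0 < E" using eps by (auto simp: \<gamma>_def E_def)
  qed
  have E4: "1 / 4 \<le> E"
  proof -
    have "\<epsilon> powr (2 / 3) \<le> 4 powr (2 / 3)" using eps by (intro powr_mono2) auto
    also have "\<dots> \<le> 4 powr 1" by (intro powr_mono) auto
    finally have "\<epsilon> powr (2 / 3) \<le> 4" by simp
    then have "E * \<epsilon> powr (2 / 3) \<le> E * 4" using g2(4) by (intro mult_left_mono) auto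
    moreover have "E * \<epsilon> powr (2 / 3) = 1" using eps by (simp add: E_def powr_add[symmetric])
    ultimately show ?thesis by simp
  qed
  have i1: "1 \<le> i" by (simp add: i_def)
  have size: "4 \<le> 2 + real n + real m + 1 / \<epsilon>" using nm eps by (simp add: add_increasing2)
  have D1: "2 \<le> D"
  proof -
    have "exp (1::real) \<le> 2 + real n + real m + 1 / \<epsilon>" using exp_le size by linarith
    then have "1 \<le> ln (2 + real n + real m + 1 / \<epsilon>)" using size by (subst ln_ge_iff) auto
    then show ?thesis by (simp add: D_def)
  qed
  have Di: "D \<le> 2 * i" using J(1) by (simp add: i_def)
  have "1 / \<gamma>\<^sup>2 = E" using g2(1,3) by (simp add: divide_eq_eq mult.commute)
  then have GE: "G = 2048 * (weight_cap i D)\<^sup>2 * E"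
    unfolding G_def guilt_cap_def divide_inverse[of "2048 * (weight_cap i D)\<^sup>2"]
    by (simp add: inverse_eq_divide)
  note pb = parameter_bounds[OF i1 _ Di E4, folded GE]
  have G0: "0 \<le> G" using pb(1) D1 by simp
  have T: "i * \<gamma> * D / \<epsilon> = i * D * E" using g2(2) eps by simp
  have T0: "0 < i * \<gamma> * D / \<epsilon>" unfolding T using i1 D1 g2 by simp
  have total: "i * D * E + 1 + 16 * i * D * (2 * (G + 1)) + G \<le> 10 ^ 12 * (i ^ 12 * E)" using pb(2) D1 by simp
  interpret scheme n m "n + m" \<gamma> "2 * J" "1 / (2 * (G + 1))"
    using nm g2(3) G0 by unfold_locales auto
  have dvD: "\<forall>u\<in>Z. kl (n + m) u z0 \<le> D"
  proof
    fix u assume "u \<in> Z"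
    then have "kl (n + m) u z0 \<le> ln (real n) + ln (real m)" by (rule kl_z0_le)
    also have "\<dots> \<le> D"
    proof -
      have e: "0 \<le> 1 / \<epsilon>" using eps by simp
      have "ln (real n) \<le> ln (2 + real n + real m + 1 / \<epsilon>)" "ln (real m) \<le> ln (2 + real n + real m + 1 / \<epsilon>)"
        using nm e by (auto intro!: ln_mono)
      then show ?thesis by (simp add: D_def)
    qed
    finally show "kl (n + m) u z0 \<le> D" .
  qed
  have E2: "E \<le> 2 ^ J"
  proof -
    have e0: "0 < 1 / \<epsilon>" using eps by simp
    have "E = (1 / \<epsilon>) powr (2 / 3)" unfolding E_def using eps by (simp add: powr_minus powr_divide field_simps)
    also have "\<dots> \<le> (2 + real n + real m + 1 / \<epsilon>) powr (2 / 3)" using e0 by (intro powr_mono2) auto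
    also have "\<dots> \<le> (2 + real n + real m + 1 / \<epsilon>) powr 1" using size by (intro powr_mono) auto
    also have "\<dots> = exp (D / 2)" using size by (simp add: D_def)
    also have "\<dots> \<le> exp (real J * ln 2)"
    proof -
      have "exp (1::real) \<le> 2 ^ 2" using exp_le by (rule order_trans) simp
      then have "1 \<le> ln ((2::real) ^ 2)" by (subst ln_ge_iff) auto
      also have "\<dots> = 2 * ln 2" by (subst ln_realpow) auto
      finally have "1 / 2 \<le> ln (2::real)" by simp
      then have "real J * (1 / 2) \<le> real J * ln 2" by (intro mult_left_mono) auto
      moreover have "D / 2 \<le> real J * (1 / 2)" using J(1) by simp
      ultimately have "D / 2 \<le> real J * ln 2" by linarith
      then show ?thesis by simp
    qed
    also have "\<dots> = 2 ^ J" by (simp add: exp_of_nat_mult)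
    finally show ?thesis .
  qed
  have levels: "i * \<gamma> * D / \<epsilon> + 1 + 16 * real (2 * J + 1) * D / (1 / (2 * (G + 1))) < 2 ^ (2 * J)"
  proof -
    have "i * \<gamma> * D / \<epsilon> + 1 + 16 * real (2 * J + 1) * D / (1 / (2 * (G + 1))) \<le> 10 ^ 12 * (i ^ 12 * E)"
      using total G0 unfolding T i_def[symmetric] by simp
    also have "\<dots> = 10 ^ 12 * (2 * real J + 1) ^ 12 * E" by (simp add: i_def add.commute)
    also have "\<dots> < 2 ^ J * E" using J(2) g2(4) by (intro mult_strict_right_mono)
    also have "\<dots> \<le> 2 ^ J * 2 ^ J" using E2 by (intro mult_left_mono) auto
    also have "\<dots> = 2 ^ (2 * J)" by (simp add: power_add[symmetric] mult_2)
    finally show ?thesis .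
  qed
  have th: "2 * (1 / (2 * (G + 1))) * (G + 1) \<le> 1" using G0 by simp
  have "real (2 * J + 1) * \<gamma> * D / (i * \<gamma> * D / \<epsilon>) = \<epsilon>"
    unfolding i_def[symmetric] using i1 D1 g2(3) eps by simp
  then obtain q x y where q: "returns (strategy (i * \<gamma> * D / \<epsilon>)) A q x y" "eps_solution A \<epsilon> x y"
    "real q \<le> 1 + 2 * (i * \<gamma> * D / \<epsilon> + 1 + 16 * i * D / (1 / (2 * (G + 1))) + G)"
    using strategy_terminates[OF A dvD _ T0, folded i_def, folded G_def, OF _ th levels[folded i_def]] D1
    unfolding i_def[symmetric] by auto
  have "1 \<le> 4 * (i ^ 12 * E)"
  proof -
    have "1 * (1 / 4) \<le> i ^ 12 * E" using i1 E4 by (intro mult_mono one_le_power) auto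
    then show ?thesis by simp
  qed
  then have "real q \<le> 6 * 10 ^ 12 * (i ^ 12 * E)"
    using q(3) total unfolding T by simp
  then show ?thesis using q(1,2) unfolding E_def by blast
qed

theorem theorem1p1:
  "\<exists>(alg :: algorithm) (C :: real) (p :: nat).
     \<forall>(n :: nat) (m :: nat) (\<epsilon> :: real) (A :: real mat).
       0 < n \<longrightarrow> 0 < m \<longrightarrow> 0 < \<epsilon> \<longrightarrow> A \<in> carrier_mat m n \<longrightarrow>
       (\<forall>i<m. \<forall>j<n. \<bar>A $$ (i, j)\<bar> \<le> 1) \<longrightarrow>
       (\<exists>q x' y'. returns (alg n m \<epsilon>) A q x' y' \<and> eps_solution A \<epsilon> x' y' \<and>
          real q \<le> C * \<epsilon> powr (- 2 / 3) * ln (2 + real n + real m + 1 / \<epsilon>) ^ p)"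
proof -
  obtain J0 where J0: "\<And>J. J0 \<le> J \<Longrightarrow> 10 ^ 12 * (2 * real J + 1) ^ 12 < (2::real) ^ J"
    using exponential_beats_power[of "10 ^ 12"] by blast
  define lg where "lg n m \<epsilon> = ln (2 + real n + real m + 1 / \<epsilon>)" for n m :: nat and \<epsilon> :: real
  define J where "J n m \<epsilon> = J0 + nat \<lceil>2 * lg n m \<epsilon>\<rceil>" for n m \<epsilon>
  define alg :: algorithm where "alg n m \<epsilon> = (if 4 \<le> \<epsilon>
      then (\<lambda>h. Output (two_simplices.xpart n (two_simplices.z0 n m (n + m))) (two_simplices.ypart n m (two_simplices.z0 n m (n + m))))
      else (let i = real (2 * J n m \<epsilon> + 1); \<gamma> = \<epsilon> powr (1 / 3); D = 2 * lg n m \<epsilon>;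
          G = guilt_cap i D \<gamma>
        in scheme.strategy n m (n + m) \<gamma> (2 * J n m \<epsilon>) (1 / (2 * (G + 1))) (i * \<gamma> * D / \<epsilon>)))" for n m \<epsilon>
  define C where "C = 6 * 10 ^ 12 * (2 * real J0 + 7) ^ 12"
  have main: "\<exists>q x' y'. returns (alg n m \<epsilon>) A q x' y' \<and> eps_solution A \<epsilon> x' y' \<and>
          real q \<le> C * \<epsilon> powr (- 2 / 3) * ln (2 + real n + real m + 1 / \<epsilon>) ^ 12"
    if nm: "0 < n" "0 < m" and eps: "0 < \<epsilon>" and A: "A \<in> carrier_mat m n" "\<forall>i<m. \<forall>j<n. \<bar>A $$ (i, j)\<bar> \<le> 1"
    for n m \<epsilon> A
  proof -
    have size: "4 \<le> 2 + real n + real m + 1 / \<epsilon>" using nm eps by (simp add: add_increasing2)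
    have lg1: "1 \<le> lg n m \<epsilon>"
    proof -
      have "exp (1::real) \<le> 2 + real n + real m + 1 / \<epsilon>" using exp_le size by linarith
      then show ?thesis using size unfolding lg_def by (subst ln_ge_iff) auto
    qed
    show ?thesis
    proof (cases "4 \<le> \<epsilon>")
      case True
      \<comment> \<open>Every point has regret at most \<open>4\<close>, so no query is made.\<close>
      interpret game n m "n + m" 1 0 1 "two_simplices.game_matrix n (n + m) A"
      proof -
        interpret two_simplices n m "n + m" using nm by unfold_locales auto
        show "game n m (n + m) 1 1 (game_matrix A)"
          by unfold_locales (auto simp: game_matrix_skew game_matrix_bounded[OF A(2)])
      qed
      have "eps_solution A \<epsilon> (xpart z0) (ypart z0)"
      proof (rule eps_solution_if_small_regret[OF A(1) z0_Z])
        fix u assume "u \<in> Z"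
        then show "- ip (n + m) (mat_app (n + m) (game_matrix A) z0) u \<le> \<epsilon>"
          using regret_le_4[OF z0_Z] True by force
      qed
      moreover have "returns (alg n m \<epsilon>) A 0 (xpart z0) (ypart z0)"
        unfolding returns_def alg_def using True by (intro exI[of _ "[]"]) (auto intro: transcript.start)
      moreover have "0 \<le> C * \<epsilon> powr (- 2 / 3) * ln (2 + real n + real m + 1 / \<epsilon>) ^ 12"
        using lg1 unfolding C_def lg_def by simp
      ultimately show ?thesis by (metis of_nat_0)
    next
      case False
      define K where "K = J n m \<epsilon>"
      have K: "2 * lg n m \<epsilon> \<le> real K" "10 ^ 12 * (2 * real K + 1) ^ 12 < (2::real) ^ K"
        using J0[of K] lg1 by (auto simp: K_def J_def) linarith
      obtain q x y where q: "returns (alg n m \<epsilon>) A q x y" "eps_solution A \<epsilon> x y"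
        "real q \<le> 6 * 10 ^ 12 * (real (2 * K + 1) ^ 12 * \<epsilon> powr (- 2 / 3))"
        using strategy_solves[OF nm eps _ A K(1)[unfolded lg_def] K(2)] False
        unfolding alg_def Let_def lg_def K_def by auto
      have "real (2 * K + 1) \<le> (2 * real J0 + 7) * lg n m \<epsilon>"
      proof -
        have "real K \<le> real J0 + 2 * lg n m \<epsilon> + 1" using lg1 unfolding K_def J_def by simp
        moreover have "(2 * real J0 + 3) * 1 \<le> (2 * real J0 + 3) * lg n m \<epsilon>" using lg1 by (intro mult_left_mono) auto
        ultimately show ?thesis by (simp add: algebra_simps)
      qed
      then have "real (2 * K + 1) ^ 12 \<le> ((2 * real J0 + 7) * lg n m \<epsilon>) ^ 12" by (intro power_mono) auto
      then have "6 * 10 ^ 12 * (real (2 * K + 1) ^ 12 * \<epsilon> powr (- 2 / 3))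
          \<le> 6 * 10 ^ 12 * (((2 * real J0 + 7) * lg n m \<epsilon>) ^ 12 * \<epsilon> powr (- 2 / 3))"
        by (intro mult_left_mono mult_right_mono) auto
      also have "\<dots> = C * \<epsilon> powr (- 2 / 3) * lg n m \<epsilon> ^ 12"
        unfolding C_def power_mult_distrib by (simp only: mult_ac)
      finally show ?thesis using q unfolding lg_def by (meson order_trans)
    qed
  qed
  show ?thesis
    by (rule exI[of _ alg], rule exI[of _ C], rule exI[of _ 12]) (use main in blast)
qed

end
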